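(* Consider a discounted MDP, a mirror map $h$, a parameterization class $\mathcal F^\Theta$, and the iterates $(\pi^t)_{t\ge 0}$ of AMPO with step-sizes $(\eta_t)_{t\ge0}$, $\eta_t>0$ (all as described in the context). Assume that there are constants $\varepsilon_{\mathrm{approx}}\ge 0$, $C_v\ge 0$, $\nu_\mu\geq 0$ such that: (A1) for all $t\ge 0$, $\mathbb E\big[\|f^{t+1}-Q^t-\eta_t^{-1}\nabla h(\pi^t)\|_{L_2(v^t)}^2\big]\le \varepsilon_{\mathrm{approx}}$; (A2) for all $t\geq 0$, $\mathbb E_{(s,a)\sim v^t}\Big[\Big(\frac{d_\mu^\pi(s)\pi(a\mid s)}{v^t(s,a)}\Big)^2\Big]\le C_v$ whenever $(d_\mu^\pi,\pi)$ is one of $(d_\mu^\star,\pi^\star)$, $(d_\mu^{t+1},\pi^{t+1})$, $(d_\mu^\star,\pi^t)$, $(d_\mu^{t+1},\pi^t)$; (A3) $\sup_{s\in\mathcal S}\frac{d_\mu^\star(s)}{d_\mu^t(s)}\le \nu_\mu$ for all $t\ge 0$. Let $\mathcal D_0^\star=\mathbb E_{s\sim d_\mu^\star}[\mathcal D_h(\pi^\star_s,\pi^0_s)]$. (i) If $\eta_t\le\eta_{t+1}$ for all $t\ge0$, then for every $T\ge 1$, $$V^\star(\mu)-\frac1T\sum_{t<T}\mathbb E[V^t(\mu)]\le \frac1T\Big(\frac{\mathcal D_0^\star}{(1-\gamma)\eta_0}+\frac{\nu_\mu}{1-\gamma}\Big)+\frac{2(1+\nu_\mu)\sqrt{C_v\varepsilon_{\mathrm{approx}}}}{1-\gamma}.$$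 (ii) If $\nu_\mu>1$ and $\eta_{t+1}\ge\frac{\nu_\mu}{\nu_\mu-1}\eta_t$ for all $t\ge 0$, then for every $T\ge0$, $$V^\star(\mu)-\mathbb E[V^T(\mu)]\le\frac1{1-\gamma}\Big(1-\frac1{\nu_\mu}\Big)^T\Big(1+\frac{\mathcal D_0^\star}{\eta_0(\nu_\mu-1)}\Big)+\frac{2(1+\nu_\mu)\sqrt{C_v\varepsilon_{\mathrm{approx}}}}{1-\gamma}.$$
   Context: MDP. $(\mathcal S,\mathcal A,P,r,\gamma,\mu)$ is a discounted Markov decision process: $\mathcal S$ a possibly infinite state space, $\mathcal A$ a finite action set, $P(s'\mid s,a)$ transition probabilities, $r(s,a)\in[0,1]$ rewards, $\gamma\in[0,1)$, $\mu$ a distribution on $\mathcal S$. $\Delta(\mathcal A)$ is the probability simplex in $\mathbb R^{|\mathcal A|}$. A policy $\pi$ assigns to each $s$ a vector $\pi_s=[\pi(a\mid s)]_{a\in\mathcal A}\in\Delta(\mathcal A)$. $V^\pi(s)=\mathbb E[\sum_{t\ge0}\gamma^t r(s_t,a_t)\mid \pi,s_0=s]$ and $Q^\pi(s,a)=\mathbb E[\sum_{t\ge0}\gamma^t r(s_t,a_t)\mid\pi, s_0=s,a_0=a]$, with $a_t\sim\pi(\cdot\mid s_t)$, $s_{t+1}\sim P(\cdot\mid s_t,a_t)$; $V^\pi(\mu)=\mathbb E_{s\sim\mu}[V^\pi(s)]$. $\pi^\star$ is a policy maximizing $V^\pi(\mu)$ over all policies and $V^\star=V^{\pi^\star}$.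 The discounted state visitation distribution is $d_\mu^\pi(s)=(1-\gamma)\mathbb E_{s_0\sim\mu}[\sum_{t\ge0}\gamma^tP(s_t=s\mid\pi,s_0)]$; $d_\mu^\star=d_\mu^{\pi^\star}$. Ratios of distributions are ratios of mass functions (or of densities with respect to a common reference measure), with denominators positive wherever numerators are. Mirror map. $\mathcal Y\subseteq\mathbb R^{|\mathcal A|}$ is convex with $\Delta(\mathcal A)\subseteq\mathcal Y$; $h:\mathcal Y\to\mathbb R$ is strictly convex, continuous on $\mathcal Y$, continuously differentiable on $\operatorname{int}\mathcal Y$, essentially smooth ($\|\nabla h(x)\|_2\to+\infty$ as $x\to\partial\mathcal Y$), and $\nabla h(\operatorname{int}\mathcal Y)=\mathbb R^{|\mathcal A|}$. $h^*(x^* )=\sup_{x\in\mathcal Y}\langle x^*,x\rangle-h(x)$ is its conjugate; $\nabla h^*$ is the inverse of $\nabla h$. Bregman divergence: $\mathcal D_h(x,y)=h(x)-h(y)-\langle\nabla h(y),x-y\rangle$. Bregman projection: $\mathrm{Proj}^h_{\Delta(\mathcal A)}(y)=\arg\min_{x\in\Delta(\mathcal A)}\mathcal D_h(x,y)$. AMPO (Approximate Mirror Policy Optimization). $\mathcal F^\Theta=\{f^\theta:\mathcal S\times\mathcal A\to\mathbb R,\ \theta\in\Theta\}$ is any parameterized function class; $f^\theta_s=[f^\theta(s,a)]_{a\in\mathcal A}$. $(v^t)_{t\ge0}$ is a sequence of distributions on $\mathcal S\times\mathcal A$, and $\|y\|_{L_2(v)}^2=\mathbb E_{(s,a)\sim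 v}[y(s,a)^2]$. Start from an initial policy $\pi^0$ with $\pi^0_s\in\operatorname{int}\mathcal Y$ for all $s$. For $t=0,1,\dots$: (1) obtain, by a possibly randomized procedure, $\theta^{t+1}\in\Theta$ as a solution of $\min_{\theta\in\Theta}\|f^\theta-Q^t-\eta_t^{-1}\nabla h(\pi^t)\|^2_{L_2(v^t)}$, where $\nabla h(\pi^t)(s,a)=[\nabla h(\pi^t_s)]_a$ (the accuracy achieved is quantified by the approximation-error assumption (A1)); (2) set $\pi^{t+1}_s=\mathrm{Proj}^h_{\Delta(\mathcal A)}(\nabla h^*(\eta_tf^{t+1}_s))$ for all $s\in\mathcal S$. Notation: $f^{t}=f^{\theta^{t}}$, $V^t=V^{\pi^t}$, $Q^t=Q^{\pi^t}$, $d_\mu^t=d_\mu^{\pi^t}$. Outer expectations $\mathbb E$ are over the randomness of the algorithm; (A2), (A3) hold for (almost) every realization. All expectations appearing are assumed well defined. *)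

theory Defs
  imports "HOL-Probability.Probability"
begin

section \<open>Discounted Markov decision processes\<close>

text \<open>
  The state space is an arbitrary measurable space, so that countable (or discrete) state spaces
  and continuous ones are covered at once; in the discrete case the measurability conditions below
  hold automatically. The finite action set is a type of class \<open>finite\<close>.
\<close>

record ('s, 'a) mdp =
  states :: "'s measure"
  transition :: "'s \<Rightarrow> 'a \<Rightarrow> 's measure"
  reward :: "'s \<Rightarrow> 'a \<Rightarrow> real"
  discount :: real
  init :: "'s measure"

definition is_mdp :: "('s, 'a::finite) mdp \<Rightarrow> bool" where
  "is_mdp M \<longleftrightarrow>
     (\<forall>a. (\<lambda>s. transition M s a) \<in> states M \<rightarrow>\<^sub>M prob_algebra (states M)) \<and>
     (\<forall>a. (\<lambda>s. reward M s a) \<in> borel_measurable (states M)) \<and>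
     (\<forall>s\<in>space (states M). \<forall>a. 0 \<le> reward M s a \<and> reward M s a \<le> 1) \<and>
     0 \<le> discount M \<and> discount M < 1 \<and>
     init M \<in> space (prob_algebra (states M))"

definition prob_simplex :: "(real ^ 'a::finite) set" where
  "prob_simplex = {p. (\<forall>a. 0 \<le> p $ a) \<and> (\<Sum>a\<in>UNIV. p $ a) = 1}"

definition is_policy :: "('s, 'a::finite) mdp \<Rightarrow> ('s \<Rightarrow> real ^ 'a) \<Rightarrow> bool" where
  "is_policy M \<pi> \<longleftrightarrow>
     \<pi> \<in> borel_measurable (states M) \<and> (\<forall>s\<in>space (states M). \<pi> s \<in> prob_simplex)"

definition sa_space :: "('s, 'a::finite) mdp \<Rightarrow> ('s \<times> 'a) measure" where
  "sa_space M = states M \<Otimes>\<^sub>M count_space UNIV"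

text \<open>The law of \<open>(s, a)\<close> for a fixed state \<open>s\<close> and \<open>a\<close> drawn from \<open>\<pi> s\<close>.\<close>

definition choose_action ::
    "('s, 'a::finite) mdp \<Rightarrow> ('s \<Rightarrow> real ^ 'a) \<Rightarrow> 's \<Rightarrow> ('s \<times> 'a) measure" where
  "choose_action M \<pi> s =
     distr (point_measure UNIV (\<lambda>a. ennreal (\<pi> s $ a))) (sa_space M) (\<lambda>a. (s, a))"

text \<open>
  The law of the trajectory \<open>((s\<^sub>t, a\<^sub>t))\<^sub>t\<close> generated by \<open>\<pi>\<close> when \<open>(s\<^sub>0, a\<^sub>0)\<close> has law \<open>\<iota>\<close>:
  the Ionescu-Tulcea measure on the infinite product of copies of the state-action space whose
  kernel at time 0 is \<open>\<iota>\<close> and whose kernel at a later time only looks at the preceding pair.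
\<close>

primrec traj_kernel ::
    "('s, 'a::finite) mdp \<Rightarrow> ('s \<Rightarrow> real ^ 'a) \<Rightarrow> ('s \<times> 'a) measure \<Rightarrow>
     nat \<Rightarrow> (nat \<Rightarrow> 's \<times> 'a) \<Rightarrow> ('s \<times> 'a) measure" where
  "traj_kernel M \<pi> \<iota> 0 \<tau> = \<iota>"
| "traj_kernel M \<pi> \<iota> (Suc t) \<tau> =
     bind (transition M (fst (\<tau> t)) (snd (\<tau> t))) (choose_action M \<pi>)"

definition trajectory ::
    "('s, 'a::finite) mdp \<Rightarrow> ('s \<Rightarrow> real ^ 'a) \<Rightarrow> ('s \<times> 'a) measure \<Rightarrow>
     (nat \<Rightarrow> 's \<times> 'a) measure" where
  "trajectory M \<pi> \<iota> =
     projective_family.lim UNIV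
       (Ionescu_Tulcea.CI (traj_kernel M \<pi> \<iota>) (\<lambda>_. sa_space M)) (\<lambda>_. sa_space M)"

definition discounted_return :: "('s, 'a::finite) mdp \<Rightarrow> (nat \<Rightarrow> 's \<times> 'a) \<Rightarrow> real" where
  "discounted_return M \<tau> = (\<Sum>t. discount M ^ t * reward M (fst (\<tau> t)) (snd (\<tau> t)))"

definition V_fun :: "('s, 'a::finite) mdp \<Rightarrow> ('s \<Rightarrow> real ^ 'a) \<Rightarrow> 's \<Rightarrow> real" where
  "V_fun M \<pi> s = (\<integral>\<tau>. discounted_return M \<tau> \<partial>trajectory M \<pi> (choose_action M \<pi> s))"

definition Q_fun :: "('s, 'a::finite) mdp \<Rightarrow> ('s \<Rightarrow> real ^ 'a) \<Rightarrow> 's \<Rightarrow> 'a \<Rightarrow> real" where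
  "Q_fun M \<pi> s a = (\<integral>\<tau>. discounted_return M \<tau> \<partial>trajectory M \<pi> (return (sa_space M) (s, a)))"

definition V_init :: "('s, 'a::finite) mdp \<Rightarrow> ('s \<Rightarrow> real ^ 'a) \<Rightarrow> real" where
  "V_init M \<pi> = (\<integral>s. V_fun M \<pi> s \<partial>init M)"

definition is_optimal_policy :: "('s, 'a::finite) mdp \<Rightarrow> ('s \<Rightarrow> real ^ 'a) \<Rightarrow> bool" where
  "is_optimal_policy M \<pi> \<longleftrightarrow>
     is_policy M \<pi> \<and> (\<forall>\<pi>'. is_policy M \<pi>' \<longrightarrow> V_init M \<pi>' \<le> V_init M \<pi>)"

text \<open>The discounted state visitation distribution \<open>d\<^sub>\<mu>\<^sup>\<pi>\<close>, as a measure on the state space.\<close>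

definition visitation :: "('s, 'a::finite) mdp \<Rightarrow> ('s \<Rightarrow> real ^ 'a) \<Rightarrow> 's measure" where
  "visitation M \<pi> = measure_of (space (states M)) (sets (states M))
     (\<lambda>B. ennreal (1 - discount M) *
        (\<integral>\<^sup>+ s0. (\<Sum>t. ennreal (discount M ^ t) *
             emeasure (trajectory M \<pi> (choose_action M \<pi> s0))
               {\<tau> \<in> space (trajectory M \<pi> (choose_action M \<pi> s0)). fst (\<tau> t) \<in> B}) \<partial>init M))"

text \<open>
  \<open>p\<close> is a version of the density of \<open>N\<close> with respect to the reference measure \<open>\<rho>\<close>
  (for a counting measure: the mass function of \<open>N\<close>).
\<close>

definition has_density :: "'b measure \<Rightarrow> 'b measure \<Rightarrow> ('b \<Rightarrow> real) \<Rightarrow> bool" where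
  "has_density \<rho> N p \<longleftrightarrow>
     p \<in> borel_measurable \<rho> \<and> (\<forall>x\<in>space \<rho>. 0 \<le> p x) \<and> N = density \<rho> (\<lambda>x. ennreal (p x))"

text \<open>
  The squared norm of \<open>L\<^sub>2(v)\<close> takes values in \<open>[0, \<infinity>]\<close>, so that a function which is not square
  integrable has infinite norm.
\<close>

definition L2_norm_sq :: "('s \<times> 'a) measure \<Rightarrow> ('s \<Rightarrow> 'a \<Rightarrow> real) \<Rightarrow> ennreal" where
  "L2_norm_sq v y = (\<integral>\<^sup>+ (s, a). ennreal ((y s a)\<^sup>2) \<partial>v)"

section \<open>Mirror maps\<close>

definition grad :: "('v::real_inner \<Rightarrow> real) \<Rightarrow> 'v \<Rightarrow> 'v" where
  "grad h x = (THE D. GDERIV h x :> D)"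

definition strictly_convex_on :: "'v::real_vector set \<Rightarrow> ('v \<Rightarrow> real) \<Rightarrow> bool" where
  "strictly_convex_on Y h \<longleftrightarrow>
     (\<forall>x\<in>Y. \<forall>y\<in>Y. \<forall>u. x \<noteq> y \<longrightarrow> 0 < u \<longrightarrow> u < 1 \<longrightarrow>
        h ((1 - u) *\<^sub>R x + u *\<^sub>R y) < (1 - u) * h x + u * h y)"

text \<open>Values of \<open>h\<close> outside \<open>Y\<close> play no role.\<close>

definition mirror_map :: "(real ^ 'a::finite) set \<Rightarrow> (real ^ 'a \<Rightarrow> real) \<Rightarrow> bool" where
  "mirror_map Y h \<longleftrightarrow>
     convex Y \<and> prob_simplex \<subseteq> Y \<and>
     strictly_convex_on Y h \<and> continuous_on Y h \<and>
     (\<forall>x\<in>interior Y. h differentiable (at x)) \<and> continuous_on (interior Y) (grad h) \<and>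
     (\<forall>z\<in>frontier Y. filterlim (\<lambda>x. norm (grad h x)) at_top (at z within interior Y)) \<and>
     grad h ` interior Y = UNIV"

text \<open>
  For a mirror map the supremum is finite at every \<open>x'\<close> because \<open>grad h\<close> is onto, so that the
  real-valued supremum is the convex conjugate.
\<close>

definition conjugate_fun :: "'v::real_inner set \<Rightarrow> ('v \<Rightarrow> real) \<Rightarrow> 'v \<Rightarrow> real" where
  "conjugate_fun Y h x' = (SUP x\<in>Y. x' \<bullet> x - h x)"

definition bregman :: "('v::real_inner \<Rightarrow> real) \<Rightarrow> 'v \<Rightarrow> 'v \<Rightarrow> real" where
  "bregman h x y = h x - h y - grad h y \<bullet> (x - y)"

definition bregman_proj :: "('v::real_inner \<Rightarrow> real) \<Rightarrow> 'v set \<Rightarrow> 'v \<Rightarrow> 'v" where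
  "bregman_proj h C y = arg_min_on (\<lambda>x. bregman h x y) C"

end

theory Submission
  imports Defs
begin

text \<open>
  The mirror step satisfies a three-point inequality (first-order optimality of the Bregman
  projection; essential smoothness keeps the iterates in the interior of \<open>Y\<close>, so that the gradients
  exist). Comparing with \<open>\<pi>\<^sup>\<star>\<close> and with \<open>\<pi>\<^sup>t\<close>, averaging over \<open>d\<^sup>\<star>\<close>, replacing \<open>d\<^sup>\<star>\<close> by
  \<open>\<nu> d\<^sup>t\<^sup>+\<^sup>1\<close> in the term of constant sign and applying the performance difference lemma twice
  gives, for the suboptimality gap \<open>\<delta>\<close> and \<open>D\<^sub>t\<close> the expected divergence from \<open>\<pi>\<^sup>t\<close> to \<open>\<pi>\<^sup>\<star>\<close>,
  \<open>\<delta>\<^sub>t + \<nu> (\<delta>\<^sub>t\<^sub>+\<^sub>1 - \<delta>\<^sub>t) \<le> (D\<^sub>t - D\<^sub>t\<^sub>+\<^sub>1) / ((1 - \<gamma>) \<eta>\<^sub>t) + error\<close>.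
  This telescopes for nondecreasing step sizes and contracts by \<open>1 - 1 / \<nu>\<close> for geometrically
  increasing ones. As \<open>D\<^sub>t\<close> need not be measurable in the randomness of the algorithm, the recursion is
  solved realization by realization and expectations are taken afterwards.
\<close>

section \<open>Mirror maps and the mirror step\<close>

text \<open>The pairs controlled in (A2) dictate the decomposition. The three-point inequality at
  \<open>\<pi>star\<close> involves the increment from the new policy to \<open>\<pi>star\<close>
  under the optimal visitation, but the new policy is not paired with that visitation in (A2).
  Splitting the increment at the old policy leaves one error for each of the four listed pairs, two
  under the optimal visitation and two under the new one with weight \<nu>; hence the factor
  \<open>2 * (1 + \<nu>)\<close>. Gradients at the iterates require a point of the simplex in
  \<open>interior Y\<close>; the values of \<open>\<pi>0\<close> provide it. Only the initial
  divergence is assumed integrable, so integrability is carried along the recursion. Young's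
  inequality with a free weight, common to all realizations, makes the error bound affine in the
  squared norm of (A1); optimising the weight after taking expectations produces the square root.
  Values and visitations are handled in \<open>ennreal\<close>, where series and integrals of
  nonnegative functions commute; the bound 1 / (1 - \<gamma>) then allows the return to real
  numbers.\<close>

lemma grad_eqI: "GDERIV h x :> D \<Longrightarrow> grad h x = D"
  unfolding grad_def
proof (rule the_equality)
  fix D' assume "GDERIV h x :> D" "GDERIV h x :> D'"
  then have "(\<lambda>w. w \<bullet> D) = (\<lambda>w. w \<bullet> D')"
    unfolding gderiv_def by (rule has_derivative_unique)
  then have "w \<bullet> D = w \<bullet> D'" for w
    by (rule fun_cong)
  then show "D' = D"
    using vector_eq_ldot[of D' D] by simp
qed

text \<open>A derivative is a linear functional; its Riesz vector is assembled from the values on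
  \<open>Basis\<close>, and uniqueness identifies that vector with the definite description behind
  \<open>grad\<close>.\<close>

lemma GDERIV_grad:
  fixes h :: "'v::euclidean_space \<Rightarrow> real"
  assumes "h differentiable (at x)"
  shows "GDERIV h x :> grad h x"
proof -
  obtain h' where h': "(h has_derivative h') (at x)"
    using assms by (auto simp: differentiable_def)
  interpret bounded_linear h' by (rule has_derivative_bounded_linear[OF h'])
  define D where "D = (\<Sum>b\<in>Basis. h' b *\<^sub>R b)"
  have "h' w = w \<bullet> D" for w
    by (subst euclidean_representation[of w, symmetric])
      (simp add: D_def sum scale inner_sum_right mult.commute del: euclidean_representation)
  then have "GDERIV h x :> D"
    using h' unfolding gderiv_def by presburger
  with grad_eqI[OF this] show ?thesis by simp
qed

text \<open>Only the limit at \<open>at_right 0\<close> is recorded: the segments compared later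
  start at \<open>y\<close> and may leave \<open>Y\<close> for negative parameters.\<close>

lemma GDERIV_directional:
  assumes "GDERIV h y :> D"
  shows "((\<lambda>u. (h (y + u *\<^sub>R d) - h y) / u) \<longlongrightarrow> D \<bullet> d) (at_right 0)"
proof -
  have "((\<lambda>u. h (y + u *\<^sub>R d)) has_derivative (\<lambda>u. (u *\<^sub>R d) \<bullet> D)) (at 0)"
    by (rule has_derivative_compose[where f="\<lambda>u. y + u *\<^sub>R d" and g=h, of "\<lambda>u. u *\<^sub>R d"])
      (auto intro!: derivative_eq_intros simp: assms[unfolded gderiv_def])
  then have "((\<lambda>u. h (y + u *\<^sub>R d)) has_field_derivative (D \<bullet> d)) (at 0)"
    unfolding has_field_derivative_def
    by (rule has_derivative_eq_rhs) (auto simp: inner_commute)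
  then have "((\<lambda>u. (h (y + u *\<^sub>R d) - h y) / u) \<longlongrightarrow> D \<bullet> d) (at 0)"
    by (simp add: has_field_derivative_iff)
  then show ?thesis
    by (rule filterlim_mono) (auto simp: at_within_le_at)
qed

text \<open>Convexity bounds each difference quotient along the segment from \<open>y\<close> to
  \<open>x\<close> by \<open>h x - h y\<close>; the limit is the directional derivative.\<close>

lemma strictly_convex_gradient_le:
  assumes h: "strictly_convex_on Y h"
    and y: "y \<in> Y" "GDERIV h y :> D" and x: "x \<in> Y"
  shows "D \<bullet> (x - y) \<le> h x - h y"
proof (cases "x = y")
  case False
  have "\<forall>\<^sub>F u in at_right (0::real). (h (y + u *\<^sub>R (x - y)) - h y) / u \<le> h x - h y"
    using eventually_at_right_less[of 0] eventually_at_right_real[of 0 1, simplified]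
  proof eventually_elim
    case (elim u)
    have "h ((1 - u) *\<^sub>R y + u *\<^sub>R x) < (1 - u) * h y + u * h x"
      using h False y x elim unfolding strictly_convex_on_def by auto
    moreover have "(1 - u) *\<^sub>R y + u *\<^sub>R x = y + u *\<^sub>R (x - y)"
      by (simp add: algebra_simps)
    ultimately show ?case
      using elim by (simp add: field_simps)
  qed
  then show ?thesis
    by (rule tendsto_upperbound[OF GDERIV_directional[OF y(2)]]) simp
qed simp

text \<open>The strictness lost in the limit is recovered at the midpoint: the weak inequality there
  carries half of the gradient term, while \<open>h m\<close> lies strictly below the
  average.\<close>

lemma strictly_convex_gradient_less:
  assumes Y: "convex Y" and h: "strictly_convex_on Y h"
    and y: "y \<in> Y" "GDERIV h y :> D" and x: "x \<in> Y" "x \<noteq> y"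
  shows "D \<bullet> (x - y) < h x - h y"
proof -
  define m where "m = (1 - 1/2) *\<^sub>R y + (1/2) *\<^sub>R x"
  have m: "m \<in> Y"
    unfolding m_def using Y y(1) x(1) by (rule convexD_alt) auto
  have "h m < (1 - 1/2) * h y + (1/2) * h x"
    unfolding m_def using h[unfolded strictly_convex_on_def, rule_format, of y x "1/2"] y(1) x by auto
  moreover have "m - y = (1/2) *\<^sub>R (x - y)"
    by (simp add: m_def algebra_simps flip: scaleR_add_left)
  ultimately show ?thesis
    using strictly_convex_gradient_le[OF h y m] by simp
qed

text \<open>The midpoint of two distinct minimisers would do strictly better, since subtracting a
  linear functional preserves strict convexity.\<close>

lemma strictly_convex_minimiser_unique:
  assumes h: "strictly_convex_on Y h" and C: "convex C" "C \<subseteq> Y" "p \<in> C" "p' \<in> C"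
    and p: "\<And>x. x \<in> C \<Longrightarrow> h p - w \<bullet> p \<le> h x - w \<bullet> x"
    and p': "\<And>x. x \<in> C \<Longrightarrow> h p' - w \<bullet> p' \<le> h x - w \<bullet> x"
  shows "p = p'"
proof (rule ccontr)
  assume ne: "p \<noteq> p'"
  define m where "m = (1 - 1/2) *\<^sub>R p + (1/2) *\<^sub>R p'"
  have m: "m \<in> C"
    unfolding m_def using C by (intro convexD_alt) auto
  have "h m < (1 - 1/2) * h p + (1/2) * h p'"
    unfolding m_def using h[unfolded strictly_convex_on_def, rule_format, of p p' "1/2"] C ne by auto
  moreover have "w \<bullet> m = (w \<bullet> p + w \<bullet> p') / 2"
    by (simp add: m_def inner_add_right)
  moreover have "h p - w \<bullet> p = h p' - w \<bullet> p'"
    using p[OF C(4)] p'[OF C(3)] by simp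
  ultimately show False
    using p[OF m] by (simp add: field_simps)
qed

section \<open>The probability simplex\<close>

lemma convex_prob_simplex: "convex prob_simplex"
  unfolding convex_def prob_simplex_def
  by (auto simp: sum.distrib simp flip: sum_distrib_left)

lemma prob_simplex_le_1: "p \<in> prob_simplex \<Longrightarrow> p $ a \<le> 1"
  using member_le_sum[of a UNIV "\<lambda>a. p $ a"] by (auto simp: prob_simplex_def)

lemma compact_prob_simplex: "compact (prob_simplex :: (real ^ 'a::finite) set)"
proof (rule compact_eq_bounded_closed[THEN iffD2], rule conjI)
  have "norm p \<le> real CARD('a)" if "p \<in> prob_simplex" for p :: "real ^ 'a"
  proof -
    have "norm p \<le> (\<Sum>a\<in>UNIV. \<bar>p $ a\<bar>)" by (rule norm_le_l1_cart)
    also have "\<dots> \<le> (\<Sum>a\<in>(UNIV::'a set). 1)"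
      using that prob_simplex_le_1[OF that] by (intro sum_mono) (auto simp: prob_simplex_def abs_le_iff)
    finally show ?thesis by simp
  qed
  then show "bounded (prob_simplex :: (real ^ 'a) set)" by (auto simp: bounded_iff)
  have "prob_simplex = (\<Inter>a. {p :: real ^ 'a. 0 \<le> p $ a}) \<inter> {p. (\<Sum>a\<in>UNIV. p $ a) = 1}"
    by (auto simp: prob_simplex_def)
  moreover have "closed \<dots>"
    by (intro closed_Int closed_INT ballI closed_Collect_le closed_Collect_eq continuous_intros)
  ultimately show "closed (prob_simplex :: (real ^ 'a) set)"
    by simp
qed

lemma axis_in_prob_simplex: "axis a 1 \<in> prob_simplex"
  by (auto simp: prob_simplex_def axis_def)

text \<open>The update at a single state as a function of the dual vector \<open>w\<close>. In this
  form, measurability of the next policy in the state reduces to continuity of one map between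
  Euclidean spaces.\<close>

definition mirror_step :: "(real ^ 'a::finite) set \<Rightarrow> (real ^ 'a \<Rightarrow> real) \<Rightarrow> real ^ 'a \<Rightarrow> real ^ 'a" where
  "mirror_step Y h w = bregman_proj h prob_simplex (grad (conjugate_fun Y h) w)"

section \<open>Gradient map, conjugate and Bregman projection of a mirror map\<close>

context
  fixes Y :: "(real ^ 'a::finite) set" and h :: "real ^ 'a \<Rightarrow> real"
  assumes mm: "mirror_map Y h"
begin

lemma mirror_convex: "convex Y" and mirror_simplex: "prob_simplex \<subseteq> Y"
  and mirror_strict: "strictly_convex_on Y h" and mirror_cont: "continuous_on Y h"
  and mirror_diff: "x \<in> interior Y \<Longrightarrow> h differentiable (at x)"
  and mirror_grad_cont: "continuous_on (interior Y) (grad h)"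
  and mirror_frontier: "z \<in> frontier Y \<Longrightarrow>
        filterlim (\<lambda>x. norm (grad h x)) at_top (at z within interior Y)"
  and mirror_onto: "grad h ` interior Y = UNIV"
  using mm by (auto simp: mirror_map_def)

lemma mirror_GDERIV: "x \<in> interior Y \<Longrightarrow> GDERIV h x :> grad h x"
  by (intro GDERIV_grad mirror_diff)

lemma mirror_gradient_le:
  "y \<in> interior Y \<Longrightarrow> x \<in> Y \<Longrightarrow> grad h y \<bullet> (x - y) \<le> h x - h y"
  using interior_subset by (blast intro: strictly_convex_gradient_le mirror_strict mirror_GDERIV)

lemma bregman_nonneg: "y \<in> interior Y \<Longrightarrow> x \<in> Y \<Longrightarrow> 0 \<le> bregman h x y"
  using mirror_gradient_le by (force simp: bregman_def)

text \<open>If the gradients at two distinct points agreed, adding the strict gradient inequalities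
  based at these points would give 0 < 0.\<close>

lemma inj_on_grad: "inj_on (grad h) (interior Y)"
proof (rule inj_onI, rule ccontr)
  fix x y assume *: "x \<in> interior Y" "y \<in> interior Y" "grad h x = grad h y" "x \<noteq> y"
  have "grad h a \<bullet> (b - a) < h b - h a" if "a \<in> interior Y" "b \<in> interior Y" "b \<noteq> a" for a b
    using that interior_subset[of Y]
    by (intro strictly_convex_gradient_less[OF mirror_convex mirror_strict _ mirror_GDERIV]) auto
  from this[of x y] this[of y x] *
  have "grad h x \<bullet> (y - x) < h y - h x" "grad h y \<bullet> (x - y) < h x - h y"
    by auto
  with *(3) show False by (simp add: inner_diff_right)
qed

lemma conjugate_grad:
  assumes y: "y \<in> interior Y"
  shows "conjugate_fun Y h (grad h y) = grad h y \<bullet> y - h y"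
  unfolding conjugate_fun_def
proof (rule cSup_eq_maximum)
  show "grad h y \<bullet> y - h y \<in> (\<lambda>x. grad h y \<bullet> x - h x) ` Y"
    using y interior_subset by auto
  show "b \<le> grad h y \<bullet> y - h y" if "b \<in> (\<lambda>x. grad h y \<bullet> x - h x) ` Y" for b
    using that mirror_gradient_le[OF y] by (force simp: inner_diff_right)
qed

text \<open>Invariance of domain yields a continuous inverse \<open>g\<close> of
  \<open>grad h\<close>. Fenchel's inequality, with equality at \<open>g w\<close>, squeezes the
  first-order remainder of the conjugate between 0 and \<open>(z - w) \<bullet> (g z - g w)\<close>,
  so continuity of \<open>g\<close> at \<open>w\<close> is exactly what makes \<open>g w\<close> the
  gradient of the conjugate there.\<close>

lemma homeomorphism_grad:
  "homeomorphism (interior Y) UNIV (grad h) (grad (conjugate_fun Y h))"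
proof -
  obtain g where g: "homeomorphism (interior Y) UNIV (grad h) g"
    using invariance_of_domain_homeomorphism[OF open_interior mirror_grad_cont order_refl inj_on_grad]
    unfolding mirror_onto .
  have gY: "g w \<in> interior Y" and hg: "grad h (g w) = w" for w
    using g by (auto simp: homeomorphism_def)
  have conj: "conjugate_fun Y h w = w \<bullet> g w - h (g w)" for w
    using conjugate_grad[OF gY[of w]] by (simp add: hg)
  have fenchel: "w \<bullet> x - h x \<le> w \<bullet> g w - h (g w)" if "x \<in> Y" for w x
    using mirror_gradient_le[OF gY[of w] that] by (simp add: hg inner_diff_right)
  have "GDERIV (conjugate_fun Y h) w :> g w" for w
    unfolding gderiv_def
  proof (rule has_derivativeI_sandwich[where e = 1 and H = "\<lambda>z. norm (g z - g w)"])
    fix z assume "z \<noteq> w"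
    have gw: "g w \<in> Y" "g z \<in> Y" using gY interior_subset by blast+
    define r where "r = conjugate_fun Y h z - conjugate_fun Y h w - (z - w) \<bullet> g w"
    have "0 \<le> r"
      using fenchel[OF gw(1), of z] by (simp add: r_def conj algebra_simps)
    moreover have "r \<le> (z - w) \<bullet> (g z - g w)"
      using fenchel[OF gw(2), of w] by (simp add: r_def conj algebra_simps)
    moreover have "(z - w) \<bullet> (g z - g w) \<le> norm (z - w) * norm (g z - g w)"
      by (rule norm_cauchy_schwarz)
    ultimately have "norm r \<le> norm (z - w) * norm (g z - g w)" by simp
    then show "norm (conjugate_fun Y h z - conjugate_fun Y h w - (z - w) \<bullet> g w) / norm (z - w)
        \<le> norm (g z - g w)"
      using \<open>z \<noteq> w\<close> by (simp add: r_def divide_le_eq mult.commute)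
  next
    have "isCont g w"
      using g by (auto simp: homeomorphism_def continuous_on_eq_continuous_at)
    then have "((\<lambda>z. norm (g z - g w)) \<longlongrightarrow> norm (g w - g w)) (at w)"
      by (intro tendsto_intros) (simp add: isCont_def)
    then show "((\<lambda>z. norm (g z - g w)) \<longlongrightarrow> 0) (at w)" by simp
  qed (auto simp: bounded_linear_inner_left)
  then have "grad (conjugate_fun Y h) = g"
    by (intro ext grad_eqI)
  with g show ?thesis by simp
qed

lemma grad_grad_conjugate [simp]: "grad h (grad (conjugate_fun Y h) w) = w"
  using homeomorphism_grad by (auto simp: homeomorphism_def)

lemma mirror_step_in: "mirror_step Y h w \<in> prob_simplex" (is "?p \<in> _")
  and mirror_step_le: "x \<in> prob_simplex \<Longrightarrow>
    h (mirror_step Y h w) - w \<bullet> mirror_step Y h w \<le> h x - w \<bullet> x"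
proof -
  define y where "y = grad (conjugate_fun Y h) w"
  \<comment> \<open>Because \<open>grad h y = w\<close>, the divergence differs from
    \<open>h x - w \<bullet> x\<close> by a term free of \<open>x\<close>. The projection is thus
    the minimiser of a linear perturbation of \<open>h\<close>, and later arguments need neither
    \<open>y\<close> nor the conjugate.\<close>
  have B: "bregman h x y = (h x - w \<bullet> x) + (w \<bullet> y - h y)" for x
    by (simp add: bregman_def y_def inner_diff_right)
  have "continuous_on prob_simplex (\<lambda>x. bregman h x y)"
    unfolding B by (intro continuous_intros continuous_on_subset[OF mirror_cont mirror_simplex])
  then obtain x0 where "x0 \<in> prob_simplex" "\<forall>x\<in>prob_simplex. bregman h x0 y \<le> bregman h x y"
    using continuous_attains_inf[OF compact_prob_simplex] axis_in_prob_simplex by blast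
  then have "is_arg_min (\<lambda>x. bregman h x y) (\<lambda>x. x \<in> prob_simplex) x0"
    by (auto simp: is_arg_min_linorder)
  then have "is_arg_min (\<lambda>x. bregman h x y) (\<lambda>x. x \<in> prob_simplex) ?p"
    unfolding mirror_step_def bregman_proj_def arg_min_on_def arg_min_def y_def[symmetric]
    by (rule someI)
  then show "?p \<in> prob_simplex" "x \<in> prob_simplex \<Longrightarrow> h ?p - w \<bullet> ?p \<le> h x - w \<bullet> x"
    by (auto simp: is_arg_min_linorder B)
qed

lemma mirror_step_eqI:
  assumes "p \<in> prob_simplex" "\<And>x. x \<in> prob_simplex \<Longrightarrow> h p - w \<bullet> p \<le> h x - w \<bullet> x"
  shows "mirror_step Y h w = p"
  using strictly_convex_minimiser_unique[OF mirror_strict convex_prob_simplex mirror_simplex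
      mirror_step_in assms(1) mirror_step_le assms(2)] .

text \<open>The values lie in a compact set, so a closed graph suffices. The graph is an
  intersection of closed sets, one optimality inequality for each competitor \<open>x\<close>;
  uniqueness of the minimiser shows that nothing else lies in the intersection.\<close>

lemma continuous_mirror_step: "continuous_on UNIV (mirror_step Y h)"
proof (rule continuous_from_closed_graph[OF compact_prob_simplex])
  show "mirror_step Y h \<in> UNIV \<rightarrow> prob_simplex"
    using mirror_step_in by auto
  have simplex: "closed (prob_simplex :: (real ^ 'a) set)"
    using compact_imp_closed[OF compact_prob_simplex] .
  have "closed {z \<in> UNIV \<times> prob_simplex. h (snd z) - fst z \<bullet> snd z \<le> h x - fst z \<bullet> x}" for x
    by (intro continuous_on_closed_Collect_le continuous_intros closed_Times closed_UNIV simplex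
        continuous_on_compose2[OF mirror_cont]) (use mirror_simplex in auto)
  then have "closed (\<Inter>x\<in>prob_simplex.
      {z \<in> UNIV \<times> prob_simplex. h (snd z) - fst z \<bullet> snd z \<le> h x - fst z \<bullet> x})"
    by blast
  also have "(\<Inter>x\<in>prob_simplex.
      {z \<in> UNIV \<times> prob_simplex. h (snd z) - fst z \<bullet> snd z \<le> h x - fst z \<bullet> x}) =
      (\<lambda>w. (w, mirror_step Y h w)) ` UNIV"
    using axis_in_prob_simplex mirror_step_in mirror_step_le
    by (fastforce simp: image_iff intro!: mirror_step_eqI[symmetric])
  finally show "closed ((\<lambda>w. (w, mirror_step Y h w)) ` UNIV)" .
qed

text \<open>
  At a frontier point the one-sided derivative of \<open>h\<close> towards an interior point \<open>z\<close> is \<open>-\<infinity>\<close>: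
  a ball around \<open>z\<close> lies in \<open>Y\<close>, so the gradient inequality in the direction of the (exploding)
  gradient bounds the derivative towards \<open>z\<close> from above by \<open>-\<epsilon> \<parallel>grad h\<parallel>\<close> up to a constant.
\<close>
lemma mirror_step_interior:
  assumes z: "z \<in> prob_simplex" "z \<in> interior Y"
  shows "mirror_step Y h w \<in> interior Y"
proof (rule ccontr)
  define p where "p = mirror_step Y h w"
  assume "mirror_step Y h w \<notin> interior Y"
  moreover have pY: "p \<in> Y" using mirror_step_in mirror_simplex by (auto simp: p_def)
  ultimately have pF: "p \<in> frontier Y"
    using closure_subset by (auto simp: frontier_def p_def)
  define x where "x u = p + u *\<^sub>R (z - p)" for u :: real
  have x_int: "x u \<in> interior Y" if "0 < u" "u \<le> 1" for u
  proof -
    have "p - u *\<^sub>R (p - z) \<in> interior Y"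
      using mirror_convex z(2) pY that by (intro mem_interior_convex_shrink) auto
    then show ?thesis by (simp add: x_def algebra_simps)
  qed
  have x_lim: "(x \<longlongrightarrow> p) (at_right 0)"
  proof -
    have "(x \<longlongrightarrow> p + 0 *\<^sub>R (z - p)) (at_right 0)"
      unfolding x_def by (intro tendsto_intros)
    then show ?thesis by simp
  qed
  have ev: "\<forall>\<^sub>F u in at_right 0. 0 < u \<and> u < (1::real)"
    using eventually_at_right_real[of 0 1] by (auto simp: greaterThanLessThan_iff)
  have ne: "p \<noteq> z" using pF z by (auto simp: frontier_def)
  have "filterlim x (at p within interior Y) (at_right 0)"
    unfolding filterlim_at
  proof
    show "\<forall>\<^sub>F u in at_right 0. x u \<in> interior Y \<and> x u \<noteq> p"
      using ev by eventually_elim (use ne x_int in \<open>auto simp: x_def\<close>)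
  qed (rule x_lim)
  then have grad_lim: "filterlim (\<lambda>u. norm (grad h (x u))) at_top (at_right 0)"
    by (rule filterlim_compose[OF mirror_frontier[OF pF]])
  have hx_lim: "((\<lambda>u. h (x u)) \<longlongrightarrow> h p) (at_right 0)"
    by (rule continuous_on_tendsto_compose[OF mirror_cont x_lim pY])
      (use ev interior_subset[of Y] x_int in \<open>auto elim!: eventually_mono\<close>)
  obtain e where e: "0 < e" "cball z e \<subseteq> Y"
    using z(2) by (auto simp: mem_interior_cball)
  have "compact (h ` cball z e)"
    by (intro compact_continuous_image continuous_on_subset[OF mirror_cont] e compact_cball)
  then obtain B where B: "\<And>y. y \<in> cball z e \<Longrightarrow> h y \<le> B"
    by (meson bounded_imp_bdd_above compact_imp_bounded bdd_above.E image_eqI)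
  have le: "grad h (x u) \<bullet> (z - x u) \<le> B - h (x u) - e * norm (grad h (x u))"
    if u: "0 < u" "u < 1" for u
  proof -
    define g where "g = grad h (x u)"
    have "z + e *\<^sub>R sgn g \<in> cball z e"
      using e(1) by (simp add: dist_norm norm_sgn)
    then have "g \<bullet> (z + e *\<^sub>R sgn g - x u) \<le> B - h (x u)"
      using mirror_gradient_le[OF x_int, of u "z + e *\<^sub>R sgn g"] B e u by (force simp: g_def)
    moreover have "g \<bullet> sgn g = norm g"
      by (cases "g = 0") (simp_all add: sgn_div_norm dot_square_norm power2_eq_square)
    ultimately show ?thesis
      by (simp add: g_def[symmetric] inner_diff_right inner_add_right)
  qed
  \<comment> \<open>The parenthesized terms stay bounded as \<open>u\<close> tends to 0 while the
    gradient norm explodes. Some \<open>u\<close> therefore makes the slope of \<open>h\<close> at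
    \<open>x u\<close> towards \<open>z\<close> smaller than the slope of the functional
    \<open>w\<close>.\<close>
  have "((\<lambda>u. - (B - h (x u) - (1 - u) * (w \<bullet> (z - p)))) \<longlongrightarrow>
      - (B - h p - (1 - 0) * (w \<bullet> (z - p)))) (at_right 0)"
    by (intro tendsto_intros hx_lim)
  from filterlim_tendsto_add_at_top[OF this
      filterlim_tendsto_pos_mult_at_top[OF tendsto_const e(1) grad_lim]]
  have "\<forall>\<^sub>F u in at_right 0.
      0 < - (B - h (x u) - (1 - u) * (w \<bullet> (z - p))) + e * norm (grad h (x u))"
    unfolding filterlim_at_top_dense by blast
  with ev have "\<exists>u. (0 < u \<and> u < 1) \<and>
      0 < - (B - h (x u) - (1 - u) * (w \<bullet> (z - p))) + e * norm (grad h (x u))"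
    by (intro eventually_happens'[OF _ eventually_conj]) auto
  then obtain u where u: "0 < u" "u < 1"
    and "0 < - (B - h (x u) - (1 - u) * (w \<bullet> (z - p))) + e * norm (grad h (x u))"
    by blast
  with le[OF u] have "grad h (x u) \<bullet> (z - x u) < (1 - u) * (w \<bullet> (z - p))"
    by linarith
  moreover have "z - x u = (1 - u) *\<^sub>R (z - p)"
    by (simp add: x_def algebra_simps)
  ultimately have less: "grad h (x u) \<bullet> (z - p) < w \<bullet> (z - p)"
    using u by simp
  \<comment> \<open>The gradient inequality based at \<open>x u\<close> and evaluated back at
    \<open>p\<close> turns this comparison of slopes into a strict decrease of \<open>h - w\<close>
    on the way from \<open>p\<close> to the feasible point \<open>x u\<close>, against minimality of
    \<open>p\<close>.\<close>
  have "grad h (x u) \<bullet> (p - x u) \<le> h p - h (x u)"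
    using u by (intro mirror_gradient_le x_int pY) auto
  moreover have "p - x u = - u *\<^sub>R (z - p)"
    by (simp add: x_def)
  ultimately have "h (x u) - h p \<le> u * (grad h (x u) \<bullet> (z - p))"
    by simp
  also have "\<dots> < u * (w \<bullet> (z - p))"
    using less u by simp
  also have "\<dots> = w \<bullet> x u - w \<bullet> p"
    by (simp add: x_def inner_add_right)
  finally have "h (x u) - w \<bullet> x u < h p - w \<bullet> p" by simp
  moreover have "x u \<in> prob_simplex"
    using convexD_alt[OF convex_prob_simplex mirror_step_in z(1), of u w] u
    by (simp add: x_def p_def algebra_simps)
  ultimately show False
    using mirror_step_le[of "x u" w] by (simp add: p_def)
qed

text \<open>Minimality along the feasible segment from the projection to \<open>x\<close> bounds
  each difference quotient of \<open>h\<close> from below by the slope of \<open>w\<close>; the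
  limit exists because the projection is interior.\<close>

lemma mirror_step_variational:
  assumes p: "mirror_step Y h w \<in> interior Y" and x: "x \<in> prob_simplex"
  shows "w \<bullet> (x - mirror_step Y h w) \<le> grad h (mirror_step Y h w) \<bullet> (x - mirror_step Y h w)"
proof -
  define p where "p = mirror_step Y h w"
  have "\<forall>\<^sub>F u in at_right (0::real). w \<bullet> (x - p) \<le> (h (p + u *\<^sub>R (x - p)) - h p) / u"
    using eventually_at_right_real[of 0 1, simplified]
  proof eventually_elim
    case (elim u)
    have "p + u *\<^sub>R (x - p) = (1 - u) *\<^sub>R p + u *\<^sub>R x"
      by (simp add: algebra_simps)
    moreover have "\<dots> \<in> prob_simplex"
      using elim x by (intro convexD_alt convex_prob_simplex) (auto simp: p_def mirror_step_in)
    ultimately have "h p - w \<bullet> p \<le> h (p + u *\<^sub>R (x - p)) - w \<bullet> (p + u *\<^sub>R (x - p))"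
      unfolding p_def by (intro mirror_step_le) simp
    then show ?case
      using elim by (simp add: inner_add_right le_divide_eq mult.commute)
  qed
  then show ?thesis
    unfolding p_def[symmetric]
    by (intro tendsto_lowerbound[OF GDERIV_directional[OF mirror_GDERIV]])
      (use p in \<open>auto simp: p_def\<close>)
qed

text \<open>With \<open>p\<close> the projection, the right-hand side is identically
  \<open>(grad h p - grad h y) \<bullet> (x - p)\<close>; the variational inequality allows
  \<open>grad h p\<close> to be replaced by \<open>w\<close>.\<close>

lemma mirror_step_three_point:
  assumes p: "mirror_step Y h w \<in> interior Y" and x: "x \<in> prob_simplex"
  shows "(w - grad h y) \<bullet> (x - mirror_step Y h w) \<le>
    bregman h x y - bregman h x (mirror_step Y h w) - bregman h (mirror_step Y h w) y"
  using mirror_step_variational[OF p x] by (simp add: bregman_def inner_diff)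

end

section \<open>Values and visitation distributions of a policy\<close>

text \<open>Valued in \<open>ennreal\<close>, so that iterating over time and exchanging sums with
  integrals needs measurability but no integrability.\<close>

definition policy_mean :: "('s \<Rightarrow> real ^ 'a::finite) \<Rightarrow> ('s \<Rightarrow> 'a \<Rightarrow> ennreal) \<Rightarrow> 's \<Rightarrow> ennreal" where
  "policy_mean \<pi> g s = (\<Sum>a\<in>UNIV. ennreal (\<pi> s $ a) * g s a)"

definition policy_step ::
    "('s, 'a::finite) mdp \<Rightarrow> ('s \<Rightarrow> real ^ 'a) \<Rightarrow> ('s \<Rightarrow> ennreal) \<Rightarrow> 's \<Rightarrow> ennreal" where
  "policy_step M \<pi> w = policy_mean \<pi> (\<lambda>s a. \<integral>\<^sup>+ s'. w s' \<partial>transition M s a)"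

text \<open>The resolvent of the one-step operator. Applied to the mean reward it is the value
  function; applied to an indicator and averaged over the initial law it is the visitation of a set,
  up to the factor 1 - \<gamma>.\<close>

definition discounted_sum ::
    "('s, 'a::finite) mdp \<Rightarrow> ('s \<Rightarrow> real ^ 'a) \<Rightarrow> ('s \<Rightarrow> ennreal) \<Rightarrow> 's \<Rightarrow> ennreal" where
  "discounted_sum M \<pi> w s = (\<Sum>t. ennreal (discount M ^ t) * (policy_step M \<pi> ^^ t) w s)"

definition policy_reward :: "('s, 'a::finite) mdp \<Rightarrow> ('s \<Rightarrow> real ^ 'a) \<Rightarrow> 's \<Rightarrow> ennreal" where
  "policy_reward M \<pi> = policy_mean \<pi> (\<lambda>s a. ennreal (reward M s a))"

lemma space_sa_space: "space (sa_space M) = space (states M) \<times> UNIV"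
  by (simp add: sa_space_def space_pair_measure)

text \<open>There are countably many actions, so joint measurability can be tested on the sections
  with a fixed action.\<close>

lemma measurable_sa_space:
  assumes "\<And>a. (\<lambda>s. g (s, a)) \<in> states M \<rightarrow>\<^sub>M N"
  shows "g \<in> sa_space M \<rightarrow>\<^sub>M N"
  unfolding sa_space_def
  by (rule measurable_compose_countable[where f="\<lambda>a x. g (fst x, a)" and g=snd, simplified])
    (auto intro!: measurable_compose[OF measurable_fst] assms)

lemma measurable_Pair_sa_space: "(\<lambda>s. (s, a)) \<in> states M \<rightarrow>\<^sub>M sa_space M"
  by (simp add: sa_space_def)

lemma
  assumes "is_mdp M"
  shows mdp_transition: "(\<lambda>s. transition M s a) \<in> states M \<rightarrow>\<^sub>M prob_algebra (states M)"
    and mdp_reward_measurable: "(\<lambda>s. reward M s a) \<in> borel_measurable (states M)"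
    and mdp_reward_nonneg: "s \<in> space (states M) \<Longrightarrow> 0 \<le> reward M s a"
    and mdp_reward_le_1: "s \<in> space (states M) \<Longrightarrow> reward M s a \<le> 1"
    and mdp_discount: "0 \<le> discount M" "discount M < 1"
    and mdp_init: "sets (init M) = sets (states M)" "prob_space (init M)"
  using assms by (auto simp: is_mdp_def space_prob_algebra)

lemma mdp_transition_space:
  assumes "is_mdp M" "s \<in> space (states M)"
  shows "sets (transition M s a) = sets (states M)" "prob_space (transition M s a)"
    "space (transition M s a) = space (states M)"
proof -
  show *: "sets (transition M s a) = sets (states M)" "prob_space (transition M s a)"
    using measurable_space[OF mdp_transition assms(2)] assms(1) by (auto simp: space_prob_algebra)
  show "space (transition M s a) = space (states M)"
    using sets_eq_imp_space_eq[OF *(1)] .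
qed

lemma measurable_transition_integral:
  assumes "is_mdp M" "w \<in> borel_measurable (states M)"
  shows "(\<lambda>s. \<integral>\<^sup>+ s'. w s' \<partial>transition M s a) \<in> borel_measurable (states M)"
  using measurable_compose[OF measurable_prob_algebraD[OF mdp_transition]
      nn_integral_measurable_subprob_algebra] assms by blast

lemma
  assumes "is_policy M \<pi>"
  shows policy_measurable: "\<pi> \<in> borel_measurable (states M)"
    and policy_simplex: "s \<in> space (states M) \<Longrightarrow> \<pi> s \<in> prob_simplex"
    and policy_nonneg: "s \<in> space (states M) \<Longrightarrow> 0 \<le> \<pi> s $ a"
    and policy_sum: "s \<in> space (states M) \<Longrightarrow> (\<Sum>a\<in>UNIV. \<pi> s $ a) = 1"
  using assms by (auto simp: is_policy_def prob_simplex_def)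

lemma policy_component_measurable:
  assumes "is_policy M \<pi>"
  shows "(\<lambda>s. \<pi> s $ a) \<in> borel_measurable (states M)"
  by (rule measurable_compose[OF policy_measurable[OF assms] borel_measurable_continuous_onI])
    (intro continuous_intros)

lemma policy_sum_ennreal:
  assumes "is_policy M \<pi>" "s \<in> space (states M)"
  shows "(\<Sum>a\<in>UNIV. ennreal (\<pi> s $ a)) = 1"
  using policy_nonneg[OF assms] policy_sum[OF assms] by (simp add: sum_ennreal)

lemma measurable_policy_mean:
  assumes "is_policy M \<pi>" "\<And>a. (\<lambda>s. g s a) \<in> borel_measurable (states M)"
  shows "policy_mean \<pi> g \<in> borel_measurable (states M)"
  unfolding policy_mean_def
  by (intro borel_measurable_sum borel_measurable_times_ennreal measurable_compose[OF _ measurable_ennreal]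
      policy_component_measurable assms)

lemma policy_mean_le:
  assumes "is_policy M \<pi>" "s \<in> space (states M)" "\<And>a. g s a \<le> c"
  shows "policy_mean \<pi> g s \<le> c"
proof -
  have "policy_mean \<pi> g s \<le> (\<Sum>a\<in>UNIV. ennreal (\<pi> s $ a) * c)"
    unfolding policy_mean_def by (intro sum_mono mult_left_mono assms) simp
  then show ?thesis
    using policy_sum_ennreal[OF assms(1,2)] by (simp flip: sum_distrib_right)
qed

lemma policy_mean_const:
  assumes "is_policy M \<pi>" "s \<in> space (states M)"
  shows "policy_mean \<pi> (\<lambda>s a. w s) s = w s"
  using policy_sum_ennreal[OF assms] by (simp add: policy_mean_def flip: sum_distrib_right)

section \<open>Iterates of the one-step operator of a fixed policy\<close>

context
  fixes M :: "('s, 'a::finite) mdp" and \<pi> :: "'s \<Rightarrow> real ^ 'a"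
  assumes mdp: "is_mdp M" and pol: "is_policy M \<pi>"
begin

lemma policy_step_cong:
  assumes "\<And>s. s \<in> space (states M) \<Longrightarrow> w s = w' s" "s \<in> space (states M)"
  shows "(policy_step M \<pi> ^^ t) w s = (policy_step M \<pi> ^^ t) w' s"
  using assms(2)
proof (induction t arbitrary: s)
  case (Suc t)
  then show ?case
    using mdp_transition_space(3)[OF mdp]
    by (auto simp: policy_step_def policy_mean_def intro!: sum.cong arg_cong2[where f="(*)"] nn_integral_cong)
qed (use assms in simp)

lemma measurable_policy_step:
  assumes "w \<in> borel_measurable (states M)"
  shows "(policy_step M \<pi> ^^ t) w \<in> borel_measurable (states M)"
proof (induction t)
  case (Suc t)
  then show ?case
    by (simp, subst policy_step_def)
      (intro measurable_policy_mean pol measurable_transition_integral mdp)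
qed (use assms in simp)

lemma policy_step_le:
  assumes "\<And>s. s \<in> space (states M) \<Longrightarrow> w s \<le> c" "s \<in> space (states M)"
  shows "(policy_step M \<pi> ^^ t) w s \<le> c"
  using assms(2)
proof (induction t arbitrary: s)
  case (Suc t)
  have "(\<integral>\<^sup>+ s'. (policy_step M \<pi> ^^ t) w s' \<partial>transition M s a) \<le> c" for a
  proof -
    interpret prob_space "transition M s a" by (rule mdp_transition_space[OF mdp Suc.prems])
    have "(\<integral>\<^sup>+ s'. (policy_step M \<pi> ^^ t) w s' \<partial>transition M s a) \<le> (\<integral>\<^sup>+ s'. c \<partial>transition M s a)"
      by (intro nn_integral_mono Suc.IH) (simp add: mdp_transition_space[OF mdp Suc.prems])
    then show ?thesis by (simp add: emeasure_space_1)
  qed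
  then show ?case
    by (simp, subst policy_step_def) (intro policy_mean_le[OF pol Suc.prems])
qed (use assms in simp)

lemma measurable_policy_reward: "policy_reward M \<pi> \<in> borel_measurable (states M)"
  unfolding policy_reward_def
  by (intro measurable_policy_mean pol measurable_compose[OF mdp_reward_measurable[OF mdp]] measurable_ennreal)

lemma policy_reward_le_1: "s \<in> space (states M) \<Longrightarrow> policy_reward M \<pi> s \<le> 1"
  unfolding policy_reward_def
  by (intro policy_mean_le[OF pol]) (auto simp: mdp_reward_le_1[OF mdp])

lemma measurable_discounted_sum:
  "w \<in> borel_measurable (states M) \<Longrightarrow> discounted_sum M \<pi> w \<in> borel_measurable (states M)"
  unfolding discounted_sum_def
  by (intro borel_measurable_suminf_order borel_measurable_times_ennreal measurable_policy_step) auto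

lemma suminf_discount: "(\<Sum>t. ennreal (discount M ^ t)) = ennreal (1 / (1 - discount M))"
  using mdp_discount[OF mdp]
  by (subst suminf_ennreal2) (auto simp: suminf_geometric)

lemma discounted_sum_le:
  assumes "\<And>s. s \<in> space (states M) \<Longrightarrow> w s \<le> 1" "s \<in> space (states M)"
  shows "discounted_sum M \<pi> w s \<le> ennreal (1 / (1 - discount M))"
proof -
  have "discounted_sum M \<pi> w s \<le> (\<Sum>t. ennreal (discount M ^ t) * 1)"
    unfolding discounted_sum_def
    by (intro suminf_le mult_left_mono policy_step_le assms) auto
  then show ?thesis by (simp add: suminf_discount)
qed

lemma discounted_sum_unfold:
  assumes w: "w \<in> borel_measurable (states M)"
  shows "discounted_sum M \<pi> w s =
    w s + ennreal (discount M) * discounted_sum M \<pi> (policy_step M \<pi> w) s"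
proof -
  have "discounted_sum M \<pi> w s =
      (\<Sum>t. ennreal (discount M ^ Suc t) * (policy_step M \<pi> ^^ Suc t) w s) + w s"
    unfolding discounted_sum_def by (subst suminf_offset[where i=1]) (auto simp: lessThan_Suc)
  also have "(\<Sum>t. ennreal (discount M ^ Suc t) * (policy_step M \<pi> ^^ Suc t) w s) =
      ennreal (discount M) * discounted_sum M \<pi> (policy_step M \<pi> w) s"
    unfolding discounted_sum_def
    by (subst ennreal_suminf_cmult[symmetric])
      (simp add: funpow_swap1 mult.assoc ennreal_mult mdp_discount[OF mdp])
  finally show ?thesis by (simp add: add.commute)
qed

section \<open>Trajectory laws as iterated kernels\<close>

lemma nn_integral_choose_action:
  assumes s: "s \<in> space (states M)" and g: "g \<in> borel_measurable (sa_space M)"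
  shows "(\<integral>\<^sup>+ x. g x \<partial>choose_action M \<pi> s) = policy_mean \<pi> (\<lambda>s a. g (s, a)) s"
proof -
  have "(\<lambda>a. (s, a)) \<in> point_measure UNIV (\<lambda>a. ennreal (\<pi> s $ a)) \<rightarrow>\<^sub>M sa_space M"
    using s by (simp add: measurable_point_measure_eq1 space_sa_space)
  then show ?thesis
    using g by (simp add: choose_action_def nn_integral_distr nn_integral_point_measure_finite policy_mean_def)
qed

lemma measurable_choose_action: "choose_action M \<pi> \<in> states M \<rightarrow>\<^sub>M prob_algebra (sa_space M)"
proof -
  have sets: "sets (choose_action M \<pi> s) = sets (sa_space M)" for s
    by (simp add: choose_action_def)
  have em: "emeasure (choose_action M \<pi> s) A = policy_mean \<pi> (\<lambda>s a. indicator A (s, a)) s"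
    if "s \<in> space (states M)" "A \<in> sets (sa_space M)" for s A
    using nn_integral_choose_action[OF that(1), of "indicator A"] that(2) by (simp add: sets)
  have prob: "prob_space (choose_action M \<pi> s)" if s: "s \<in> space (states M)" for s
  proof
    have "emeasure (choose_action M \<pi> s) (space (choose_action M \<pi> s)) =
        policy_mean \<pi> (\<lambda>s a. indicator (space (sa_space M)) (s, a)) s"
      using em[OF s sets.top] by (simp add: choose_action_def)
    also have "\<dots> = 1"
      using s policy_sum_ennreal[OF pol s] by (simp add: policy_mean_def space_sa_space)
    finally show "emeasure (choose_action M \<pi> s) (space (choose_action M \<pi> s)) = 1" .
  qed
  show ?thesis
  proof (intro measurable_prob_algebraI measurable_subprob_algebra prob prob_space_imp_subprob_space sets)
    fix A assume A: "A \<in> sets (sa_space M)"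
    have "policy_mean \<pi> (\<lambda>s a. indicator A (s, a)) \<in> borel_measurable (states M)"
      by (intro measurable_policy_mean pol measurable_compose[OF measurable_Pair_sa_space]
          borel_measurable_indicator A)
    then show "(\<lambda>s. emeasure (choose_action M \<pi> s) A) \<in> borel_measurable (states M)"
      by (rule measurable_cong[THEN iffD2, rotated]) (rule em[OF _ A])
  qed
qed

text \<open>The time-homogeneous Markov kernel on state-action pairs: each
  \<open>traj_kernel\<close> after time 0 is this kernel applied to the last pair of the
  history.\<close>

definition sa_kernel :: "'s \<times> 'a \<Rightarrow> ('s \<times> 'a) measure" where
  "sa_kernel x = bind (transition M (fst x) (snd x)) (choose_action M \<pi>)"

lemma measurable_sa_kernel: "sa_kernel \<in> sa_space M \<rightarrow>\<^sub>M prob_algebra (sa_space M)"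
  unfolding sa_kernel_def
  by (rule measurable_bind_prob_space[OF measurable_sa_space measurable_choose_action])
    (simp add: mdp_transition[OF mdp])

lemma nn_integral_sa_kernel:
  assumes "x \<in> space (sa_space M)" and g: "g \<in> borel_measurable (sa_space M)"
  shows "(\<integral>\<^sup>+ y. g y \<partial>sa_kernel x) =
    (\<integral>\<^sup>+ s'. policy_mean \<pi> (\<lambda>s a. g (s, a)) s' \<partial>transition M (fst x) (snd x))"
proof -
  have s: "fst x \<in> space (states M)" using assms by (auto simp: space_sa_space)
  note tr = mdp_transition_space[OF mdp s]
  have "(\<integral>\<^sup>+ y. g y \<partial>sa_kernel x) =
      (\<integral>\<^sup>+ s'. (\<integral>\<^sup>+ y. g y \<partial>choose_action M \<pi> s') \<partial>transition M (fst x) (snd x))"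
    unfolding sa_kernel_def
    by (rule nn_integral_bind[OF g])
      (use measurable_prob_algebraD[OF measurable_choose_action] in
        \<open>simp add: measurable_cong_sets[OF tr(1) refl]\<close>)
  also have "\<dots> = (\<integral>\<^sup>+ s'. policy_mean \<pi> (\<lambda>s a. g (s, a)) s' \<partial>transition M (fst x) (snd x))"
    by (intro nn_integral_cong nn_integral_choose_action g) (simp add: tr)
  finally show ?thesis .
qed

lemma Ionescu_Tulcea_traj:
  assumes \<iota>: "\<iota> \<in> space (prob_algebra (sa_space M))"
  shows "Ionescu_Tulcea (traj_kernel M \<pi> \<iota>) (\<lambda>_. sa_space M)"
proof -
  have "traj_kernel M \<pi> \<iota> i \<in> PiM {0..<i} (\<lambda>_. sa_space M) \<rightarrow>\<^sub>M prob_algebra (sa_space M)" for i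
  proof (cases i)
    case 0
    have "traj_kernel M \<pi> \<iota> 0 = (\<lambda>_. \<iota>)" by (simp add: fun_eq_iff)
    then show ?thesis using 0 \<iota> by simp
  next
    case (Suc t)
    have "(\<lambda>\<tau>. sa_kernel (\<tau> t)) \<in> PiM {0..<i} (\<lambda>_. sa_space M) \<rightarrow>\<^sub>M prob_algebra (sa_space M)"
      by (rule measurable_compose[OF _ measurable_sa_kernel]) (simp add: Suc)
    moreover have "traj_kernel M \<pi> \<iota> (Suc t) = (\<lambda>\<tau>. sa_kernel (\<tau> t))"
      by (simp add: fun_eq_iff sa_kernel_def)
    ultimately show ?thesis by (simp add: Suc)
  qed
  note meas = this
  show ?thesis
    by (rule Ionescu_Tulcea.intro, rule measurable_prob_algebraD[OF meas])
      (use measurable_space[OF meas] in \<open>simp add: space_prob_algebra\<close>)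
qed

context
  fixes \<iota> assumes \<iota>: "\<iota> \<in> space (prob_algebra (sa_space M))"
begin

interpretation IT: Ionescu_Tulcea "traj_kernel M \<pi> \<iota>" "\<lambda>_. sa_space M"
  by (rule Ionescu_Tulcea_traj[OF \<iota>])

lemma trajectory_eq: "trajectory M \<pi> \<iota> = IT.PF.lim"
  by (simp add: trajectory_def)

lemma sets_trajectory: "sets (trajectory M \<pi> \<iota>) = sets (PiM UNIV (\<lambda>_. sa_space M))"
  by (simp add: trajectory_eq)

lemma measurable_trajectory_component: "(\<lambda>\<tau>. \<tau> t) \<in> trajectory M \<pi> \<iota> \<rightarrow>\<^sub>M sa_space M"
  by (subst measurable_cong_sets[OF sets_trajectory refl]) simp

text \<open>A coordinate of the infinite product is seen by the marginal on finitely many times, and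
  the last stage in the construction of that marginal draws coordinate \<open>t\<close> from kernel
  \<open>t\<close>, given the history before it.\<close>

lemma nn_integral_trajectory_step:
  assumes g: "g \<in> borel_measurable (sa_space M)"
  shows "(\<integral>\<^sup>+ \<tau>. g (\<tau> t) \<partial>trajectory M \<pi> \<iota>) =
    (\<integral>\<^sup>+ \<omega>. (\<integral>\<^sup>+ y. g y \<partial>traj_kernel M \<pi> \<iota> t \<omega>) \<partial>IT.C 0 t (\<lambda>_. undefined))"
proof -
  \<comment> \<open>The construction starts from the empty history; the only element of a product
    over no index is the function constantly \<open>undefined\<close>.\<close>
  let ?J = "{0..<Suc t}" and ?u = "\<lambda>_::nat. undefined :: 's \<times> 'a" and ?P = "\<lambda>J. PiM J (\<lambda>_. sa_space M)"
  have u: "?u \<in> space (?P {0..<0})" by simp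
  \<comment> \<open>The marginal on \<open>?J\<close> takes \<open>Suc t\<close> stages, the first
    bound beyond all its indices, so its last stage is kernel \<open>t\<close>.\<close>
  have up: "IT.up_to ?J = Suc t"
    unfolding IT.up_to_def by (rule Least_equality) (auto simp: not_less_eq_eq)
  have comp: "(\<lambda>x. x t) \<in> ?P ?J \<rightarrow>\<^sub>M sa_space M"
    by simp
  have gt: "(\<lambda>x. g (x t)) \<in> borel_measurable (?P ?J)"
    by (rule measurable_compose[OF comp g])
  have restr: "(\<lambda>x. restrict x ?J) \<in> trajectory M \<pi> \<iota> \<rightarrow>\<^sub>M ?P ?J"
    by (subst measurable_cong_sets[OF sets_trajectory refl]) (intro measurable_restrict_subset subset_UNIV)
  have "(\<integral>\<^sup>+ \<tau>. g (\<tau> t) \<partial>trajectory M \<pi> \<iota>) =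
      (\<integral>\<^sup>+ x. g (x t) \<partial>distr (trajectory M \<pi> \<iota>) (?P ?J) (\<lambda>x. restrict x ?J))"
    by (subst nn_integral_distr[OF restr]) (use gt in simp_all)
  also have "\<dots> = (\<integral>\<^sup>+ x. g (x t) \<partial>IT.CI ?J)"
    unfolding trajectory_eq by (subst IT.distr_lim) simp_all
  also have "\<dots> = (\<integral>\<^sup>+ x. g (restrict x ?J t) \<partial>IT.C 0 (Suc t) ?u)"
    unfolding IT.CI_def up
    by (subst nn_integral_distr)
      (use gt in \<open>simp_all add: measurable_cong_sets[OF IT.sets_C[OF u] refl] del: IT.C.simps\<close>)
  also have "\<dots> = (\<integral>\<^sup>+ x. g (x t) \<partial>(IT.C 0 t ?u \<bind> IT.eP t))"
    by simp
  also have "\<dots> = (\<integral>\<^sup>+ \<omega>. (\<integral>\<^sup>+ x. g (x t) \<partial>IT.eP t \<omega>) \<partial>IT.C 0 t ?u)"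
    by (rule nn_integral_bind[OF gt])
      (use IT.measurable_eP[of t] in \<open>simp add: measurable_cong_sets[OF IT.sets_C[OF u] refl]\<close>)
  also have "\<dots> = (\<integral>\<^sup>+ \<omega>. (\<integral>\<^sup>+ y. g y \<partial>traj_kernel M \<pi> \<iota> t \<omega>) \<partial>IT.C 0 t ?u)"
    by (intro nn_integral_cong, subst IT.nn_integral_eP[OF _ gt])
      (simp_all add: IT.space_C[OF u])
  finally show ?thesis .
qed

lemma nn_integral_trajectory_0:
  assumes g: "g \<in> borel_measurable (sa_space M)"
  shows "(\<integral>\<^sup>+ \<tau>. g (\<tau> 0) \<partial>trajectory M \<pi> \<iota>) = (\<integral>\<^sup>+ x. g x \<partial>\<iota>)"
  by (subst nn_integral_trajectory_step[OF g]) (simp add: nn_integral_return)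

text \<open>The Markov property in one-step form: integrating out the last pair replaces
  \<open>g\<close> by its mean under \<open>sa_kernel\<close>, and what remains depends only on
  coordinate \<open>t\<close>.\<close>

lemma nn_integral_trajectory_Suc:
  assumes g: "g \<in> borel_measurable (sa_space M)"
  shows "(\<integral>\<^sup>+ \<tau>. g (\<tau> (Suc t)) \<partial>trajectory M \<pi> \<iota>) =
    (\<integral>\<^sup>+ \<tau>. (\<integral>\<^sup>+ y. g y \<partial>sa_kernel (\<tau> t)) \<partial>trajectory M \<pi> \<iota>)"
proof -
  let ?u = "\<lambda>_::nat. undefined :: 's \<times> 'a"
  have u: "?u \<in> space (PiM {0..<0} (\<lambda>_. sa_space M))" by simp
  define g' where "g' x = (\<integral>\<^sup>+ y. g y \<partial>sa_kernel x)" for x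
  have g': "g' \<in> borel_measurable (sa_space M)"
    unfolding g'_def
    using measurable_compose[OF measurable_prob_algebraD[OF measurable_sa_kernel]
        nn_integral_measurable_subprob_algebra[OF g]] .
  have gt: "(\<lambda>x. g' (x t)) \<in> borel_measurable (PiM {0..<Suc t} (\<lambda>_. sa_space M))"
    by (rule measurable_compose[OF _ g']) simp
  have "(\<integral>\<^sup>+ \<tau>. g (\<tau> (Suc t)) \<partial>trajectory M \<pi> \<iota>) = (\<integral>\<^sup>+ \<omega>. g' (\<omega> t) \<partial>IT.C 0 (Suc t) ?u)"
    by (subst nn_integral_trajectory_step[OF g]) (simp add: g'_def sa_kernel_def del: IT.C.simps)
  also have "\<dots> = (\<integral>\<^sup>+ x. g' (x t) \<partial>(IT.C 0 t ?u \<bind> IT.eP t))"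
    by simp
  also have "\<dots> = (\<integral>\<^sup>+ \<omega>. (\<integral>\<^sup>+ x. g' (x t) \<partial>IT.eP t \<omega>) \<partial>IT.C 0 t ?u)"
    by (rule nn_integral_bind[OF gt])
      (use IT.measurable_eP[of t] in \<open>simp add: measurable_cong_sets[OF IT.sets_C[OF u] refl]\<close>)
  also have "\<dots> = (\<integral>\<^sup>+ \<omega>. (\<integral>\<^sup>+ y. g' y \<partial>traj_kernel M \<pi> \<iota> t \<omega>) \<partial>IT.C 0 t ?u)"
    by (intro nn_integral_cong, subst IT.nn_integral_eP[OF _ gt])
      (simp_all add: IT.space_C[OF u])
  also have "\<dots> = (\<integral>\<^sup>+ \<tau>. g' (\<tau> t) \<partial>trajectory M \<pi> \<iota>)"
    by (rule nn_integral_trajectory_step[OF g', symmetric])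
  finally show ?thesis by (simp add: g'_def)
qed

end

lemma return_in_prob_algebra:
  "x \<in> space N \<Longrightarrow> return N x \<in> space (prob_algebra N)"
  by (simp add: space_prob_algebra prob_space_return)

lemma choose_action_in_prob_algebra:
  "s \<in> space (states M) \<Longrightarrow> choose_action M \<pi> s \<in> space (prob_algebra (sa_space M))"
  using measurable_choose_action by (rule measurable_space)

text \<open>The intertwining relation that transfers the dynamics on pairs to the operator on
  states; the action drawn by the kernel is averaged before the transition instead of after
  it.\<close>

lemma policy_mean_sa_kernel:
  assumes "s \<in> space (states M)" and g: "g \<in> borel_measurable (sa_space M)"
  shows "policy_mean \<pi> (\<lambda>s a. \<integral>\<^sup>+ y. g y \<partial>sa_kernel (s, a)) s =
    policy_step M \<pi> (policy_mean \<pi> (\<lambda>s a. g (s, a))) s"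
  using assms by (simp add: policy_step_def policy_mean_def nn_integral_sa_kernel space_sa_space)

lemma measurable_sa_kernel_integral:
  "g \<in> borel_measurable (sa_space M) \<Longrightarrow> (\<lambda>x. \<integral>\<^sup>+ y. g y \<partial>sa_kernel x) \<in> borel_measurable (sa_space M)"
  using measurable_compose[OF measurable_prob_algebraD[OF measurable_sa_kernel]
      nn_integral_measurable_subprob_algebra] .

text \<open>The induction removes the last time step, not the first. It therefore runs over all
  \<open>g\<close>: the Markov property hands the mean of \<open>g\<close> under the kernel to the
  induction hypothesis.\<close>

lemma nn_integral_trajectory_choose_action:
  assumes s: "s \<in> space (states M)" and g: "g \<in> borel_measurable (sa_space M)"
  shows "(\<integral>\<^sup>+ \<tau>. g (\<tau> t) \<partial>trajectory M \<pi> (choose_action M \<pi> s)) =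
    (policy_step M \<pi> ^^ t) (policy_mean \<pi> (\<lambda>s a. g (s, a))) s"
  using g
proof (induction t arbitrary: g)
  case 0
  then show ?case
    by (simp add: nn_integral_trajectory_0[OF choose_action_in_prob_algebra[OF s]]
        nn_integral_choose_action[OF s])
next
  case (Suc t)
  let ?g = "\<lambda>x. \<integral>\<^sup>+ y. g y \<partial>sa_kernel x"
  have "(\<integral>\<^sup>+ \<tau>. g (\<tau> (Suc t)) \<partial>trajectory M \<pi> (choose_action M \<pi> s)) =
      (policy_step M \<pi> ^^ t) (policy_mean \<pi> (\<lambda>s a. ?g (s, a))) s"
    by (simp add: nn_integral_trajectory_Suc[OF choose_action_in_prob_algebra[OF s] Suc.prems]
        Suc.IH[OF measurable_sa_kernel_integral[OF Suc.prems]])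
  also have "\<dots> = (policy_step M \<pi> ^^ t) (policy_step M \<pi> (policy_mean \<pi> (\<lambda>s a. g (s, a)))) s"
    by (intro policy_step_cong policy_mean_sa_kernel Suc.prems s)
  finally show ?case by (simp add: funpow_swap1)
qed

text \<open>With the first action prescribed, the policy acts only from time 1 on. Hence time
  \<open>Suc t\<close> meets power \<open>t\<close>, after one bare transition, and time 0 is
  treated separately.\<close>

lemma nn_integral_trajectory_return:
  assumes s: "s \<in> space (states M)" and g: "g \<in> borel_measurable (sa_space M)"
  shows "(\<integral>\<^sup>+ \<tau>. g (\<tau> (Suc t)) \<partial>trajectory M \<pi> (return (sa_space M) (s, a))) =
    (\<integral>\<^sup>+ s'. (policy_step M \<pi> ^^ t) (policy_mean \<pi> (\<lambda>s a. g (s, a))) s' \<partial>transition M s a)"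
  using g
proof (induction t arbitrary: g)
  case 0
  have sa: "(s, a) \<in> space (sa_space M)" using s by (simp add: space_sa_space)
  show ?case
    by (simp add: nn_integral_trajectory_Suc[OF return_in_prob_algebra[OF sa] 0]
      nn_integral_trajectory_0[OF return_in_prob_algebra[OF sa] measurable_sa_kernel_integral[OF 0]]
      nn_integral_return[OF sa measurable_sa_kernel_integral[OF 0]] nn_integral_sa_kernel[OF sa 0])
next
  case (Suc t)
  let ?g = "\<lambda>x. \<integral>\<^sup>+ y. g y \<partial>sa_kernel x"
  have sa: "(s, a) \<in> space (sa_space M)" using s by (simp add: space_sa_space)
  have "(\<integral>\<^sup>+ \<tau>. g (\<tau> (Suc (Suc t))) \<partial>trajectory M \<pi> (return (sa_space M) (s, a))) =
      (\<integral>\<^sup>+ s'. (policy_step M \<pi> ^^ t) (policy_mean \<pi> (\<lambda>s a. ?g (s, a))) s' \<partial>transition M s a)"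
    by (simp add: nn_integral_trajectory_Suc[OF return_in_prob_algebra[OF sa] Suc.prems]
        Suc.IH[OF measurable_sa_kernel_integral[OF Suc.prems]])
  also have "\<dots> = (\<integral>\<^sup>+ s'. (policy_step M \<pi> ^^ t) (policy_step M \<pi> (policy_mean \<pi> (\<lambda>s a. g (s, a)))) s'
      \<partial>transition M s a)"
    by (intro nn_integral_cong policy_step_cong policy_mean_sa_kernel Suc.prems)
      (simp_all add: mdp_transition_space(3)[OF mdp s])
  finally show ?case by (simp add: funpow_swap1)
qed

section \<open>Values as discounted sums\<close>

lemma measurable_reward_sa: "(\<lambda>x. ennreal (reward M (fst x) (snd x))) \<in> borel_measurable (sa_space M)"
  by (intro measurable_compose[OF measurable_sa_space measurable_ennreal])
    (simp add: mdp_reward_measurable[OF mdp])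

text \<open>Rewards in [0, 1] and \<gamma> < 1 make the return a convergent series of nonnegative
  terms, so the Bochner integral equals the real part of a nonnegative integral, in which the series
  may be taken outside.\<close>

lemma integral_discounted_return:
  assumes \<iota>: "\<iota> \<in> space (prob_algebra (sa_space M))"
  shows "(\<integral>\<tau>. discounted_return M \<tau> \<partial>trajectory M \<pi> \<iota>) =
    enn2real (\<Sum>t. ennreal (discount M ^ t) *
      (\<integral>\<^sup>+ \<tau>. ennreal (reward M (fst (\<tau> t)) (snd (\<tau> t))) \<partial>trajectory M \<pi> \<iota>))"
proof -
  let ?T = "trajectory M \<pi> \<iota>"
  note \<gamma> = mdp_discount[OF mdp]
  have comp: "fst (\<tau> t) \<in> space (states M)" if "\<tau> \<in> space ?T" for \<tau> t
    using measurable_space[OF measurable_trajectory_component[OF \<iota>] that, of t]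
    by (auto simp: space_sa_space)
  have r_meas: "(\<lambda>\<tau>. reward M (fst (\<tau> t)) (snd (\<tau> t))) \<in> borel_measurable ?T" for t
    by (rule measurable_compose[OF measurable_trajectory_component[OF \<iota>],
          of "\<lambda>x. reward M (fst x) (snd x)"], rule measurable_sa_space)
      (simp add: mdp_reward_measurable[OF mdp])
  have nonneg: "0 \<le> discount M ^ t * reward M (fst (\<tau> t)) (snd (\<tau> t))" if "\<tau> \<in> space ?T" for \<tau> t
    using comp[OF that] \<gamma> mdp_reward_nonneg[OF mdp] by simp
  have summable: "summable (\<lambda>t. discount M ^ t * reward M (fst (\<tau> t)) (snd (\<tau> t)))"
    if "\<tau> \<in> space ?T" for \<tau>
  proof (rule summable_comparison_test')
    show "summable (\<lambda>t. discount M ^ t)" using \<gamma> by (simp add: summable_geometric)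
    show "norm (discount M ^ t * reward M (fst (\<tau> t)) (snd (\<tau> t))) \<le> discount M ^ t" for t
      using nonneg[OF that, of t] comp[OF that] \<gamma> mdp_reward_le_1[OF mdp]
      by (simp add: mult_left_le)
  qed
  have "discounted_return M \<in> borel_measurable ?T"
    unfolding discounted_return_def
    by (intro borel_measurable_suminf borel_measurable_times r_meas borel_measurable_const)
  moreover have "AE \<tau> in ?T. 0 \<le> discounted_return M \<tau>"
    by (intro AE_I2) (auto simp: discounted_return_def intro!: suminf_nonneg summable nonneg)
  ultimately have "(\<integral>\<tau>. discounted_return M \<tau> \<partial>?T) = enn2real (\<integral>\<^sup>+ \<tau>. ennreal (discounted_return M \<tau>) \<partial>?T)"
    by (rule integral_eq_nn_integral)
  also have "(\<integral>\<^sup>+ \<tau>. ennreal (discounted_return M \<tau>) \<partial>?T) =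
      (\<integral>\<^sup>+ \<tau>. (\<Sum>t. ennreal (discount M ^ t) * ennreal (reward M (fst (\<tau> t)) (snd (\<tau> t)))) \<partial>?T)"
  proof (rule nn_integral_cong)
    fix \<tau> assume \<tau>: "\<tau> \<in> space ?T"
    show "ennreal (discounted_return M \<tau>) =
        (\<Sum>t. ennreal (discount M ^ t) * ennreal (reward M (fst (\<tau> t)) (snd (\<tau> t))))"
      unfolding discounted_return_def
      by (subst suminf_ennreal2[symmetric, OF nonneg[OF \<tau>] summable[OF \<tau>]])
        (simp add: ennreal_mult \<gamma> comp[OF \<tau>] mdp_reward_nonneg[OF mdp])
  qed
  also have "\<dots> = (\<Sum>t. ennreal (discount M ^ t) *
      (\<integral>\<^sup>+ \<tau>. ennreal (reward M (fst (\<tau> t)) (snd (\<tau> t))) \<partial>?T))"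
    using r_meas
    by (subst nn_integral_suminf)
      (auto intro!: suminf_cong nn_integral_cmult borel_measurable_times_ennreal)
  finally show ?thesis .
qed

text \<open>Extended-valued twin of \<open>V_fun\<close>. The Bellman and flow identities are proved
  for it and carried over to real numbers by \<open>ennreal_V_fun\<close>.\<close>

definition value_ennreal :: "'s \<Rightarrow> ennreal" where
  "value_ennreal = discounted_sum M \<pi> (policy_reward M \<pi>)"

lemma measurable_value_ennreal: "value_ennreal \<in> borel_measurable (states M)"
  unfolding value_ennreal_def by (intro measurable_discounted_sum measurable_policy_reward)

lemma value_ennreal_le: "s \<in> space (states M) \<Longrightarrow> value_ennreal s \<le> ennreal (1 / (1 - discount M))"
  unfolding value_ennreal_def by (intro discounted_sum_le policy_reward_le_1)

lemma V_fun_eq: "s \<in> space (states M) \<Longrightarrow> V_fun M \<pi> s = enn2real (value_ennreal s)"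
  unfolding V_fun_def
  by (subst integral_discounted_return[OF choose_action_in_prob_algebra])
    (simp_all add: nn_integral_trajectory_choose_action[OF _ measurable_reward_sa]
      value_ennreal_def discounted_sum_def policy_reward_def)

lemma V_fun_nonneg: "s \<in> space (states M) \<Longrightarrow> 0 \<le> V_fun M \<pi> s"
  by (simp add: V_fun_eq)

lemma ennreal_V_fun: "s \<in> space (states M) \<Longrightarrow> ennreal (V_fun M \<pi> s) = value_ennreal s"
  using value_ennreal_le[of s] by (simp add: V_fun_eq order.strict_trans1[OF _ ennreal_less_top])

lemma V_fun_le: "s \<in> space (states M) \<Longrightarrow> V_fun M \<pi> s \<le> 1 / (1 - discount M)"
  using value_ennreal_le[of s] mdp_discount[OF mdp]
  by (simp add: ennreal_V_fun[symmetric] del: ennreal_1)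

lemma measurable_V_fun: "V_fun M \<pi> \<in> borel_measurable (states M)"
  by (subst measurable_cong[OF V_fun_eq], assumption)
    (intro borel_measurable_enn2real measurable_value_ennreal)

lemma Q_fun_eq:
  assumes s: "s \<in> space (states M)"
  shows "Q_fun M \<pi> s a = enn2real (ennreal (reward M s a) +
    ennreal (discount M) * (\<integral>\<^sup>+ s'. value_ennreal s' \<partial>transition M s a))"
proof -
  let ?g = "\<lambda>x. ennreal (reward M (fst x) (snd x))"
  have sa: "(s, a) \<in> space (sa_space M)" using s by (simp add: space_sa_space)
  let ?T = "trajectory M \<pi> (return (sa_space M) (s, a))"
  have "Q_fun M \<pi> s a = enn2real (\<Sum>t. ennreal (discount M ^ t) * (\<integral>\<^sup>+ \<tau>. ?g (\<tau> t) \<partial>?T))"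
    unfolding Q_fun_def by (rule integral_discounted_return[OF return_in_prob_algebra[OF sa]])
  also have "(\<Sum>t. ennreal (discount M ^ t) * (\<integral>\<^sup>+ \<tau>. ?g (\<tau> t) \<partial>?T)) =
      (\<Sum>t. ennreal (discount M ^ Suc t) * (\<integral>\<^sup>+ \<tau>. ?g (\<tau> (Suc t)) \<partial>?T)) + (\<integral>\<^sup>+ \<tau>. ?g (\<tau> 0) \<partial>?T)"
    by (subst suminf_offset[where i=1]) (auto simp: lessThan_Suc)
  also have "(\<integral>\<^sup>+ \<tau>. ?g (\<tau> 0) \<partial>?T) = ennreal (reward M s a)"
    by (subst nn_integral_trajectory_0[OF return_in_prob_algebra[OF sa] measurable_reward_sa])
      (simp add: nn_integral_return[OF sa measurable_reward_sa])
  also have "(\<Sum>t. ennreal (discount M ^ Suc t) * (\<integral>\<^sup>+ \<tau>. ?g (\<tau> (Suc t)) \<partial>?T)) =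
      (\<Sum>t. ennreal (discount M) * (\<integral>\<^sup>+ s'. ennreal (discount M ^ t) *
        (policy_step M \<pi> ^^ t) (policy_reward M \<pi>) s' \<partial>transition M s a))"
  proof (rule suminf_cong)
    fix t
    have "(policy_step M \<pi> ^^ t) (policy_reward M \<pi>) \<in> borel_measurable (transition M s a)"
      using measurable_policy_step[OF measurable_policy_reward]
      by (simp add: measurable_cong_sets[OF mdp_transition_space(1)[OF mdp s] refl])
    then show "ennreal (discount M ^ Suc t) * (\<integral>\<^sup>+ \<tau>. ?g (\<tau> (Suc t)) \<partial>?T) =
      ennreal (discount M) * (\<integral>\<^sup>+ s'. ennreal (discount M ^ t) *
        (policy_step M \<pi> ^^ t) (policy_reward M \<pi>) s' \<partial>transition M s a)"
      by (subst nn_integral_trajectory_return[OF s measurable_reward_sa])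
        (simp add: nn_integral_cmult policy_reward_def ennreal_mult mdp_discount[OF mdp] mult.assoc)
  qed
  also have "\<dots> = ennreal (discount M) * (\<integral>\<^sup>+ s'. value_ennreal s' \<partial>transition M s a)"
    unfolding value_ennreal_def discounted_sum_def
    by (subst nn_integral_suminf)
      (use measurable_policy_step[OF measurable_policy_reward] in
        \<open>auto simp: measurable_cong_sets[OF mdp_transition_space(1)[OF mdp s] refl]
          intro!: borel_measurable_times_ennreal\<close>)
  finally show ?thesis by (simp add: add.commute)
qed

text \<open>From 1 + \<gamma> / (1 - \<gamma>) = 1 / (1 - \<gamma>). Finiteness guarantees that
  \<open>enn2real\<close> in the formula for \<open>Q_fun\<close> loses nothing.\<close>

lemma transition_value_le:
  assumes s: "s \<in> space (states M)"
  shows "ennreal (reward M s a) + ennreal (discount M) * (\<integral>\<^sup>+ s'. value_ennreal s' \<partial>transition M s a)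
    \<le> ennreal (1 / (1 - discount M))"
proof -
  interpret prob_space "transition M s a" by (rule mdp_transition_space[OF mdp s])
  note \<gamma> = mdp_discount[OF mdp]
  have "(\<integral>\<^sup>+ s'. value_ennreal s' \<partial>transition M s a) \<le> (\<integral>\<^sup>+ s'. ennreal (1 / (1 - discount M)) \<partial>transition M s a)"
    by (intro nn_integral_mono value_ennreal_le) (simp add: mdp_transition_space[OF mdp s])
  then have "ennreal (reward M s a) + ennreal (discount M) * (\<integral>\<^sup>+ s'. value_ennreal s' \<partial>transition M s a)
      \<le> ennreal 1 + ennreal (discount M) * ennreal (1 / (1 - discount M))"
    using mdp_reward_le_1[OF mdp s]
    by (intro add_mono mult_left_mono ennreal_leI) (auto simp: emeasure_space_1)
  also have "\<dots> = ennreal (1 + discount M * (1 / (1 - discount M)))"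
    using \<gamma> by (simp add: ennreal_plus[symmetric] ennreal_mult[symmetric] del: ennreal_plus ennreal_1)
  also have "1 + discount M * (1 / (1 - discount M)) = 1 / (1 - discount M)"
    using \<gamma> by (simp add: field_simps)
  finally show ?thesis .
qed

lemma ennreal_Q_fun:
  assumes s: "s \<in> space (states M)"
  shows "ennreal (Q_fun M \<pi> s a) = ennreal (reward M s a) +
    ennreal (discount M) * (\<integral>\<^sup>+ s'. value_ennreal s' \<partial>transition M s a)"
  using order.strict_trans1[OF transition_value_le[OF s] ennreal_less_top] by (simp add: Q_fun_eq[OF s])

lemma Q_fun_nonneg: "s \<in> space (states M) \<Longrightarrow> 0 \<le> Q_fun M \<pi> s a"
  by (simp add: Q_fun_eq)

lemma Q_fun_le: "s \<in> space (states M) \<Longrightarrow> Q_fun M \<pi> s a \<le> 1 / (1 - discount M)"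
  using transition_value_le[of s a] mdp_discount[OF mdp]
  by (simp add: ennreal_Q_fun[symmetric] del: ennreal_1)

lemma measurable_Q_fun: "(\<lambda>s. Q_fun M \<pi> s a) \<in> borel_measurable (states M)"
  by (subst measurable_cong[OF Q_fun_eq], assumption)
    (intro borel_measurable_enn2real borel_measurable_add borel_measurable_times_ennreal
      measurable_compose[OF mdp_reward_measurable[OF mdp] measurable_ennreal] borel_measurable_const
      measurable_transition_integral mdp measurable_value_ennreal measurable_ident)

text \<open>An operator commutes with its resolvent; here this is monotone exchange of the series
  with the transition integral and the finite sum over actions.\<close>

lemma policy_step_discounted_sum:
  assumes w: "w \<in> borel_measurable (states M)" and s: "s \<in> space (states M)"
  shows "policy_step M \<pi> (discounted_sum M \<pi> w) s = discounted_sum M \<pi> (policy_step M \<pi> w) s"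
proof -
  have meas: "(policy_step M \<pi> ^^ t) w \<in> borel_measurable (transition M s a)" for t a
    using measurable_policy_step[OF w] by (simp add: measurable_cong_sets[OF mdp_transition_space(1)[OF mdp s] refl])
  have "policy_step M \<pi> (discounted_sum M \<pi> w) s = (\<Sum>a\<in>UNIV. \<Sum>t. ennreal (\<pi> s $ a) *
      (ennreal (discount M ^ t) * (\<integral>\<^sup>+ s'. (policy_step M \<pi> ^^ t) w s' \<partial>transition M s a)))"
    using meas
    by (simp add: policy_step_def policy_mean_def discounted_sum_def nn_integral_suminf nn_integral_cmult
        borel_measurable_times_ennreal)
  also have "\<dots> = (\<Sum>t. \<Sum>a\<in>UNIV. ennreal (\<pi> s $ a) *
      (ennreal (discount M ^ t) * (\<integral>\<^sup>+ s'. (policy_step M \<pi> ^^ t) w s' \<partial>transition M s a)))"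
    by (rule suminf_sum[symmetric]) simp
  also have "\<dots> = (\<Sum>t. ennreal (discount M ^ t) * (policy_step M \<pi> ^^ Suc t) w s)"
    by (simp add: policy_step_def policy_mean_def sum_distrib_left mult.left_commute)
  finally show ?thesis by (simp add: discounted_sum_def funpow_swap1)
qed

lemma value_ennreal_Bellman:
  assumes s: "s \<in> space (states M)"
  shows "value_ennreal s = policy_reward M \<pi> s + ennreal (discount M) * policy_step M \<pi> value_ennreal s"
  using discounted_sum_unfold[OF measurable_policy_reward] policy_step_discounted_sum[OF measurable_policy_reward s]
  by (simp add: value_ennreal_def)

text \<open>The law of the state at time \<open>t\<close> is made a Markov kernel in the starting
  state, so that it can be composed with the initial law and with a random time.\<close>

lemma measurable_trajectory_state:
  "(\<lambda>s. distr (trajectory M \<pi> (choose_action M \<pi> s)) (states M) (\<lambda>\<tau>. fst (\<tau> t)))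
    \<in> states M \<rightarrow>\<^sub>M prob_algebra (states M)" (is "?L \<in> _")
  and nn_integral_trajectory_state: "\<And>s w. s \<in> space (states M) \<Longrightarrow> w \<in> borel_measurable (states M) \<Longrightarrow>
    (\<integral>\<^sup>+ s'. w s' \<partial>distr (trajectory M \<pi> (choose_action M \<pi> s)) (states M) (\<lambda>\<tau>. fst (\<tau> t))) =
      (policy_step M \<pi> ^^ t) w s"
  and emeasure_trajectory_state: "\<And>s B. s \<in> space (states M) \<Longrightarrow> B \<in> sets (states M) \<Longrightarrow>
    emeasure (trajectory M \<pi> (choose_action M \<pi> s))
      {\<tau> \<in> space (trajectory M \<pi> (choose_action M \<pi> s)). fst (\<tau> t) \<in> B} =
      (policy_step M \<pi> ^^ t) (indicator B) s"
proof -
  have fst_meas: "(\<lambda>\<tau>. fst (\<tau> t)) \<in> trajectory M \<pi> (choose_action M \<pi> s) \<rightarrow>\<^sub>M states M"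
    if "s \<in> space (states M)" for s
    by (rule measurable_compose[OF measurable_trajectory_component[OF choose_action_in_prob_algebra[OF that]]])
      (simp add: sa_space_def)
  show nn: "(\<integral>\<^sup>+ s'. w s' \<partial>?L s) = (policy_step M \<pi> ^^ t) w s"
    if s: "s \<in> space (states M)" and w: "w \<in> borel_measurable (states M)" for s w
  proof -
    have w': "(\<lambda>x. w (fst x)) \<in> borel_measurable (sa_space M)"
      by (rule measurable_sa_space) (simp add: w)
    have "(\<integral>\<^sup>+ s'. w s' \<partial>?L s) = (\<integral>\<^sup>+ \<tau>. w (fst (\<tau> t)) \<partial>trajectory M \<pi> (choose_action M \<pi> s))"
      by (rule nn_integral_distr[OF fst_meas[OF s]]) (simp add: w)
    also have "\<dots> = (policy_step M \<pi> ^^ t) (policy_mean \<pi> (\<lambda>s a. w s)) s"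
      using nn_integral_trajectory_choose_action[OF s w', of t] by simp
    also have "\<dots> = (policy_step M \<pi> ^^ t) w s"
      by (rule policy_step_cong[OF policy_mean_const[OF pol] s])
    finally show ?thesis .
  qed
  have em: "emeasure (?L s) B = (policy_step M \<pi> ^^ t) (indicator B) s"
    if "s \<in> space (states M)" "B \<in> sets (states M)" for s B
    using nn[OF that(1), of "indicator B"] that(2) by simp
  show "emeasure (trajectory M \<pi> (choose_action M \<pi> s))
      {\<tau> \<in> space (trajectory M \<pi> (choose_action M \<pi> s)). fst (\<tau> t) \<in> B} =
      (policy_step M \<pi> ^^ t) (indicator B) s"
    if "s \<in> space (states M)" "B \<in> sets (states M)" for s B
    unfolding em[OF that, symmetric] emeasure_distr[OF fst_meas[OF that(1)] that(2)]
    by (rule arg_cong2[where f = emeasure]) auto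
  have "prob_space (?L s)" if s: "s \<in> space (states M)" for s
  proof
    have "emeasure (?L s) (space (states M)) = (policy_step M \<pi> ^^ t) (\<lambda>_. 1) s"
      using em[OF s sets.top] policy_step_cong[OF _ s, of "indicator (space (states M))" "\<lambda>_. 1"] by simp
    also have "\<dots> = 1"
      using s
    proof (induction t arbitrary: s)
      case (Suc t)
      have "(\<integral>\<^sup>+ s'. (policy_step M \<pi> ^^ t) (\<lambda>_. 1) s' \<partial>transition M s a) = 1" for a
      proof -
        interpret prob_space "transition M s a" by (rule mdp_transition_space[OF mdp Suc.prems])
        have "(\<integral>\<^sup>+ s'. (policy_step M \<pi> ^^ t) (\<lambda>_. 1) s' \<partial>transition M s a) = (\<integral>\<^sup>+ s'. 1 \<partial>transition M s a)"
          by (intro nn_integral_cong Suc.IH) (simp add: mdp_transition_space(3)[OF mdp Suc.prems])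
        then show ?thesis by (simp add: emeasure_space_1)
      qed
      then show ?case
        using policy_sum_ennreal[OF pol Suc.prems] by (simp, subst policy_step_def) (simp add: policy_mean_def)
    qed simp
    finally show "emeasure (?L s) (space (?L s)) = 1" by simp
  qed
  then show "?L \<in> states M \<rightarrow>\<^sub>M prob_algebra (states M)"
  proof (intro measurable_prob_algebraI measurable_subprob_algebra prob_space_imp_subprob_space)
    fix B assume "B \<in> sets (states M)"
    then show "(\<lambda>s. emeasure (?L s) B) \<in> borel_measurable (states M)"
      using measurable_policy_step[of "indicator B" t] em by (subst measurable_cong[OF em]) auto
  qed auto
qed

text \<open>The visitation distribution as the law of the state at an independent geometric time.\<close>

lemma
  shows prob_space_visitation: "prob_space (visitation M \<pi>)"
    and sets_visitation: "sets (visitation M \<pi>) = sets (states M)"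
    and nn_integral_visitation: "\<And>w. w \<in> borel_measurable (states M) \<Longrightarrow>
      (\<integral>\<^sup>+ s. w s \<partial>visitation M \<pi>) =
        ennreal (1 - discount M) * (\<integral>\<^sup>+ s. discounted_sum M \<pi> w s \<partial>init M)"
proof -
  note \<gamma> = mdp_discount[OF mdp] and \<mu> = mdp_init[OF mdp]
  let ?L = "\<lambda>t s. distr (trajectory M \<pi> (choose_action M \<pi> s)) (states M) (\<lambda>\<tau>. fst (\<tau> t))"
  \<comment> \<open>The weights have total mass 1 because \<gamma> < 1. Drawing the time from
    \<open>G\<close> turns the discounted sum in \<open>visitation\<close> into a composition of
    Markov kernels, which gives total mass 1.\<close>
  define G where "G = density (count_space UNIV) (\<lambda>t::nat. ennreal ((1 - discount M) * discount M ^ t))"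
  define N where "N = bind G (\<lambda>t. bind (init M) (?L t))"
  have init: "init M \<in> space (prob_algebra (states M))"
    using \<mu> by (simp add: space_prob_algebra)
  have nn_G: "(\<integral>\<^sup>+ t. g t \<partial>G) = (\<Sum>t. ennreal ((1 - discount M) * discount M ^ t) * g t)" for g
    by (simp add: G_def nn_integral_density nn_integral_count_space_nat)
  have "prob_space G"
  proof
    have "emeasure G (space G) = (\<Sum>t. ennreal ((1 - discount M) * discount M ^ t))"
      using nn_G[of "\<lambda>_. 1"] by simp
    also have "\<dots> = ennreal (\<Sum>t. (1 - discount M) * discount M ^ t)"
      using \<gamma> by (intro suminf_ennreal2) (auto intro!: summable_mult summable_geometric)
    also have "(\<Sum>t. (1 - discount M) * discount M ^ t) = 1"
      using \<gamma> by (subst suminf_mult) (auto simp: suminf_geometric summable_geometric)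
    finally show "emeasure G (space G) = 1" by simp
  qed
  then have G: "G \<in> space (prob_algebra (count_space UNIV))"
    by (simp add: space_prob_algebra G_def)
  have inner: "(\<lambda>t. bind (init M) (?L t)) \<in> count_space UNIV \<rightarrow>\<^sub>M prob_algebra (states M)"
    using measurable_space[OF measurable_bind_prob_space[OF measurable_const[OF init] measurable_trajectory_state],
        of _ "count_space UNIV"] by simp
  have nn_N: "(\<integral>\<^sup>+ s. w s \<partial>N) = ennreal (1 - discount M) * (\<integral>\<^sup>+ s. discounted_sum M \<pi> w s \<partial>init M)"
    if w: "w \<in> borel_measurable (states M)" for w
  proof -
    have meas: "(policy_step M \<pi> ^^ t) w \<in> borel_measurable (init M)" for t
      using measurable_policy_step[OF w] by (simp add: measurable_cong_sets[OF \<mu>(1) refl])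
    have "(\<integral>\<^sup>+ s. w s \<partial>N) = (\<integral>\<^sup>+ t. (\<integral>\<^sup>+ s. w s \<partial>bind (init M) (?L t)) \<partial>G)"
      unfolding N_def
      by (rule nn_integral_bind[OF w])
        (use measurable_prob_algebraD[OF inner] in \<open>simp add: G_def measurable_cong_sets[OF sets_density refl]\<close>)
    also have "\<dots> = (\<integral>\<^sup>+ t. (\<integral>\<^sup>+ s. (policy_step M \<pi> ^^ t) w s \<partial>init M) \<partial>G)"
    proof (intro nn_integral_cong)
      fix t
      have "(\<integral>\<^sup>+ s. w s \<partial>bind (init M) (?L t)) = (\<integral>\<^sup>+ s. (\<integral>\<^sup>+ s'. w s' \<partial>?L t s) \<partial>init M)"
        by (rule nn_integral_bind[OF w])
          (use measurable_prob_algebraD[OF measurable_trajectory_state] in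
            \<open>simp add: measurable_cong_sets[OF \<mu>(1) refl]\<close>)
      also have "\<dots> = (\<integral>\<^sup>+ s. (policy_step M \<pi> ^^ t) w s \<partial>init M)"
        by (intro nn_integral_cong nn_integral_trajectory_state w)
          (simp add: sets_eq_imp_space_eq[OF \<mu>(1)])
      finally show "(\<integral>\<^sup>+ s. w s \<partial>bind (init M) (?L t)) = (\<integral>\<^sup>+ s. (policy_step M \<pi> ^^ t) w s \<partial>init M)" .
    qed
    also have "\<dots> = (\<Sum>t. ennreal (1 - discount M) *
        (\<integral>\<^sup>+ s. ennreal (discount M ^ t) * (policy_step M \<pi> ^^ t) w s \<partial>init M))"
      using \<gamma> meas by (simp add: nn_G nn_integral_cmult ennreal_mult mult.assoc)
    also have "\<dots> = ennreal (1 - discount M) * (\<integral>\<^sup>+ s. discounted_sum M \<pi> w s \<partial>init M)"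
      unfolding discounted_sum_def
      using meas by (simp add: nn_integral_suminf borel_measurable_times_ennreal)
    finally show ?thesis .
  qed
  have sets_N: "sets N = sets (states M)"
    unfolding N_def by (rule sets_bind'[OF G inner])
  \<comment> \<open>A set function passed to \<open>measure_of\<close> yields its intended values
    only if it is countably additive. Agreement with the measure \<open>N\<close> on measurable sets
    settles this.\<close>
  have "visitation M \<pi> = measure_of (space N) (sets N) (emeasure N)"
    unfolding visitation_def sets_N sets_eq_imp_space_eq[OF sets_N]
  proof (rule measure_of_eq[OF sets.space_closed])
    fix B assume "B \<in> sigma_sets (space (states M)) (sets (states M))"
    then have B: "B \<in> sets (states M)" by (simp add: sets.sigma_sets_eq)
    then have "emeasure N B = (\<integral>\<^sup>+ s. indicator B s \<partial>N)"
      by (simp add: sets_N)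
    also have "\<dots> = ennreal (1 - discount M) * (\<integral>\<^sup>+ s. discounted_sum M \<pi> (indicator B) s \<partial>init M)"
      by (rule nn_N[OF borel_measurable_indicator[OF B]])
    finally show "ennreal (1 - discount M) * (\<integral>\<^sup>+ s0. (\<Sum>t. ennreal (discount M ^ t) *
        emeasure (trajectory M \<pi> (choose_action M \<pi> s0))
          {\<tau> \<in> space (trajectory M \<pi> (choose_action M \<pi> s0)). fst (\<tau> t) \<in> B}) \<partial>init M) = emeasure N B"
      by (simp add: discounted_sum_def, intro arg_cong2[where f = "(*)"] nn_integral_cong refl)
        (simp add: emeasure_trajectory_state B sets_eq_imp_space_eq[OF \<mu>(1)])
  qed
  then have eq: "visitation M \<pi> = N" by (simp add: measure_of_of_measure)
  show "prob_space (visitation M \<pi>)" "sets (visitation M \<pi>) = sets (states M)"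
    unfolding eq N_def by (rule prob_space_bind'[OF G inner], rule sets_bind'[OF G inner])
  show "(\<integral>\<^sup>+ s. w s \<partial>visitation M \<pi>) =
      ennreal (1 - discount M) * (\<integral>\<^sup>+ s. discounted_sum M \<pi> w s \<partial>init M)"
    if "w \<in> borel_measurable (states M)" for w
    unfolding eq by (rule nn_N[OF that])
qed

lemma policy_mean_Q_fun:
  assumes s: "s \<in> space (states M)"
  shows "(\<Sum>a\<in>UNIV. \<pi> s $ a * Q_fun M \<pi> s a) = V_fun M \<pi> s"
proof -
  have "ennreal (\<Sum>a\<in>UNIV. \<pi> s $ a * Q_fun M \<pi> s a) = policy_mean \<pi> (\<lambda>s a. ennreal (Q_fun M \<pi> s a)) s"
    using policy_nonneg[OF pol s] Q_fun_nonneg[OF s]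
    by (simp add: policy_mean_def sum_ennreal flip: ennreal_mult)
  also have "\<dots> = policy_reward M \<pi> s + ennreal (discount M) * policy_step M \<pi> value_ennreal s"
    by (simp add: policy_mean_def policy_reward_def policy_step_def ennreal_Q_fun[OF s] distrib_left
        sum.distrib sum_distrib_left mult.left_commute)
  also have "\<dots> = ennreal (V_fun M \<pi> s)"
    by (simp add: ennreal_V_fun[OF s] value_ennreal_Bellman[OF s, symmetric])
  finally show ?thesis
    using policy_nonneg[OF pol s] Q_fun_nonneg[OF s] V_fun_nonneg[OF s]
    by (simp add: ennreal_inj sum_nonneg)
qed

lemma nn_integral_visitation_reward:
  "(\<integral>\<^sup>+ s. policy_reward M \<pi> s \<partial>visitation M \<pi>) =
    ennreal (1 - discount M) * (\<integral>\<^sup>+ s. value_ennreal s \<partial>init M)"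
  unfolding value_ennreal_def by (rule nn_integral_visitation[OF measurable_policy_reward])

text \<open>The balance equation of discounted occupancy: the visitation is the initial law with
  weight 1 - \<gamma> plus its own push-forward with weight \<gamma>. It is the discounted sum
  unfolded once under the initial law.\<close>

lemma nn_integral_visitation_flow:
  assumes w: "w \<in> borel_measurable (states M)"
  shows "(\<integral>\<^sup>+ s. w s \<partial>visitation M \<pi>) = ennreal (1 - discount M) * (\<integral>\<^sup>+ s. w s \<partial>init M) +
    ennreal (discount M) * (\<integral>\<^sup>+ s. policy_step M \<pi> w s \<partial>visitation M \<pi>)"
proof -
  have Tw: "policy_step M \<pi> w \<in> borel_measurable (states M)"
    using measurable_policy_step[OF w, of 1] by simp
  note meas = w Tw measurable_discounted_sum[OF Tw]
  note meas = meas[folded measurable_cong_sets[OF mdp_init(1)[OF mdp] refl]]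
  show ?thesis
    using meas
    by (simp add: nn_integral_visitation[OF w] nn_integral_visitation[OF Tw] discounted_sum_unfold[OF w]
        nn_integral_add nn_integral_cmult borel_measurable_times_ennreal distrib_left mult.left_commute)
qed

lemma ennreal_V_init: "ennreal (V_init M \<pi>) = (\<integral>\<^sup>+ s. value_ennreal s \<partial>init M)"
  and V_init_nonneg: "0 \<le> V_init M \<pi>"
  and V_init_le: "V_init M \<pi> \<le> 1 / (1 - discount M)"
proof -
  interpret prob_space "init M" by (rule mdp_init[OF mdp])
  have sp: "space (init M) = space (states M)"
    by (rule sets_eq_imp_space_eq[OF mdp_init(1)[OF mdp]])
  have meas: "V_fun M \<pi> \<in> borel_measurable (init M)"
    using measurable_V_fun by (simp add: measurable_cong_sets[OF mdp_init(1)[OF mdp] refl])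
  have int: "integrable (init M) (V_fun M \<pi>)"
    by (rule integrable_const_bound[where B = "1 / (1 - discount M)", OF AE_I2 meas])
      (simp add: sp V_fun_nonneg V_fun_le)
  have "(\<integral>\<^sup>+ s. ennreal (V_fun M \<pi> s) \<partial>init M) = ennreal (V_init M \<pi>)"
    unfolding V_init_def by (rule nn_integral_eq_integral[OF int AE_I2]) (simp add: sp V_fun_nonneg)
  moreover have "(\<integral>\<^sup>+ s. ennreal (V_fun M \<pi> s) \<partial>init M) = (\<integral>\<^sup>+ s. value_ennreal s \<partial>init M)"
    by (intro nn_integral_cong) (simp add: sp ennreal_V_fun)
  ultimately show "ennreal (V_init M \<pi>) = (\<integral>\<^sup>+ s. value_ennreal s \<partial>init M)" by simp
  show "0 \<le> V_init M \<pi>"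
    unfolding V_init_def by (rule Bochner_Integration.integral_nonneg) (simp add: sp V_fun_nonneg)
  have "V_init M \<pi> \<le> (\<integral>s. 1 / (1 - discount M) \<partial>init M)"
    unfolding V_init_def by (rule integral_mono[OF int]) (simp_all add: sp V_fun_le)
  then show "V_init M \<pi> \<le> 1 / (1 - discount M)" by (simp add: prob_space)
qed

end

section \<open>The performance difference lemma\<close>

lemma integrable_visitation_bounded:
  fixes g :: "'s \<Rightarrow> real"
  assumes "is_mdp M" "is_policy M \<pi>" "g \<in> borel_measurable (states M)"
    "\<And>s. s \<in> space (states M) \<Longrightarrow> \<bar>g s\<bar> \<le> B"
  shows "integrable (visitation M \<pi>) g"
proof -
  interpret prob_space "visitation M \<pi>" by (rule prob_space_visitation[OF assms(1,2)])
  note sets = sets_visitation[OF assms(1,2)]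
  show ?thesis
    by (rule integrable_const_bound[where B = B, OF AE_I2])
      (use assms in \<open>simp_all add: sets_eq_imp_space_eq[OF sets] measurable_cong_sets[OF sets refl]\<close>)
qed

text \<open>The balance equation replaces the usual telescoping along trajectories. It is applied to
  the value of \<pi>', while averaging the rewards of \<pi> under its own visitation produces the
  value of \<pi>; the part with \<pi>' in the inner product is the value of \<pi>' by Bellman's
  equation.\<close>

lemma performance_difference:
  assumes mdp: "is_mdp M" and pol: "is_policy M \<pi>" and pol': "is_policy M \<pi>'"
  shows "(\<integral>s. (\<chi> a. Q_fun M \<pi>' s a) \<bullet> (\<pi> s - \<pi>' s) \<partial>visitation M \<pi>) =
    (1 - discount M) * (V_init M \<pi> - V_init M \<pi>')"
proof -
  note \<gamma> = mdp_discount[OF mdp]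
  let ?d = "visitation M \<pi>"
  interpret prob_space ?d by (rule prob_space_visitation[OF mdp pol])
  note sets = sets_visitation[OF mdp pol]
  note sp = sets_eq_imp_space_eq[OF sets]
  let ?V = "value_ennreal M \<pi>'"
  define X where "X s = (\<Sum>a\<in>UNIV. \<pi> s $ a * Q_fun M \<pi>' s a)" for s
  have X_nonneg: "0 \<le> X s" if "s \<in> space (states M)" for s
    using that by (auto simp: X_def intro!: sum_nonneg mult_nonneg_nonneg policy_nonneg[OF pol] Q_fun_nonneg[OF mdp pol'])
  have X_eq: "ennreal (X s) = policy_reward M \<pi> s + ennreal (discount M) * policy_step M \<pi> ?V s"
    if s: "s \<in> space (states M)" for s
  proof -
    have "ennreal (X s) = policy_mean \<pi> (\<lambda>s a. ennreal (Q_fun M \<pi>' s a)) s"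
      using policy_nonneg[OF pol s] Q_fun_nonneg[OF mdp pol' s]
      by (simp add: X_def policy_mean_def sum_ennreal flip: ennreal_mult)
    then show ?thesis
      by (simp add: policy_mean_def policy_reward_def policy_step_def ennreal_Q_fun[OF mdp pol' s] distrib_left
          sum.distrib sum_distrib_left mult.left_commute)
  qed
  have X_le: "X s \<le> 1 / (1 - discount M)" if s: "s \<in> space (states M)" for s
  proof -
    have "X s \<le> (\<Sum>a\<in>UNIV. \<pi> s $ a * (1 / (1 - discount M)))"
      unfolding X_def by (intro sum_mono mult_left_mono Q_fun_le[OF mdp pol' s] policy_nonneg[OF pol s])
    then show ?thesis using policy_sum[OF pol s] by (simp flip: sum_divide_distrib)
  qed
  have X_meas: "X \<in> borel_measurable (states M)"
    unfolding X_def
    by (intro borel_measurable_sum borel_measurable_times policy_component_measurable[OF pol]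
        measurable_Q_fun[OF mdp pol'])
  have X_int: "integrable ?d X"
    by (rule integrable_visitation_bounded[OF mdp pol X_meas, of "1 / (1 - discount M)"])
      (simp add: X_nonneg X_le)
  have V_int: "integrable ?d (V_fun M \<pi>')"
    by (rule integrable_visitation_bounded[OF mdp pol measurable_V_fun[OF mdp pol'], of "1 / (1 - discount M)"])
      (simp add: V_fun_nonneg[OF mdp pol'] V_fun_le[OF mdp pol'])
  have "policy_step M \<pi> ?V \<in> borel_measurable ?d" "policy_reward M \<pi> \<in> borel_measurable ?d"
    using measurable_policy_step[OF mdp pol measurable_value_ennreal[OF mdp pol'], of 1]
      measurable_policy_reward[OF mdp pol]
    by (simp_all add: measurable_cong_sets[OF sets refl])
  moreover have "(\<integral>\<^sup>+ s. ennreal (X s) \<partial>?d) =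
      (\<integral>\<^sup>+ s. policy_reward M \<pi> s + ennreal (discount M) * policy_step M \<pi> ?V s \<partial>?d)"
    by (intro nn_integral_cong X_eq) (simp add: sp)
  ultimately have "(\<integral>\<^sup>+ s. ennreal (X s) \<partial>?d) = (\<integral>\<^sup>+ s. policy_reward M \<pi> s \<partial>?d) +
      ennreal (discount M) * (\<integral>\<^sup>+ s. policy_step M \<pi> ?V s \<partial>?d)"
    by (simp add: nn_integral_add nn_integral_cmult borel_measurable_times_ennreal)
  \<comment> \<open>Both sides are written as sums because cancellation in \<open>ennreal\<close>
    would require finiteness; subtraction takes place once every term is known to be real.\<close>
  then have "(\<integral>\<^sup>+ s. ennreal (X s) \<partial>?d) + ennreal (1 - discount M) * (\<integral>\<^sup>+ s. ?V s \<partial>init M) =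
      ennreal (1 - discount M) * (\<integral>\<^sup>+ s. value_ennreal M \<pi> s \<partial>init M) + (\<integral>\<^sup>+ s. ?V s \<partial>?d)"
    by (simp add: nn_integral_visitation_reward[OF mdp pol]
        nn_integral_visitation_flow[OF mdp pol measurable_value_ennreal[OF mdp pol']] ac_simps)
  moreover have "(\<integral>\<^sup>+ s. ennreal (X s) \<partial>?d) = ennreal (\<integral>s. X s \<partial>?d)"
    by (rule nn_integral_eq_integral[OF X_int AE_I2]) (simp add: sp X_nonneg)
  moreover have "(\<integral>\<^sup>+ s. ?V s \<partial>?d) = (\<integral>\<^sup>+ s. ennreal (V_fun M \<pi>' s) \<partial>?d)"
    by (intro nn_integral_cong) (simp add: sp ennreal_V_fun[OF mdp pol'])
  moreover have "\<dots> = ennreal (\<integral>s. V_fun M \<pi>' s \<partial>?d)"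
    by (rule nn_integral_eq_integral[OF V_int AE_I2]) (simp add: sp V_fun_nonneg[OF mdp pol'])
  moreover have "0 \<le> (\<integral>s. X s \<partial>?d)" "0 \<le> (\<integral>s. V_fun M \<pi>' s \<partial>?d)"
    by (auto intro!: Bochner_Integration.integral_nonneg simp: sp X_nonneg V_fun_nonneg[OF mdp pol'])
  ultimately have "(\<integral>s. X s \<partial>?d) + (1 - discount M) * V_init M \<pi>' =
      (1 - discount M) * V_init M \<pi> + (\<integral>s. V_fun M \<pi>' s \<partial>?d)"
    using \<gamma> V_init_nonneg[OF mdp pol] V_init_nonneg[OF mdp pol']
    by (simp add: ennreal_V_init[OF mdp pol, symmetric] ennreal_V_init[OF mdp pol', symmetric]
        ennreal_mult[symmetric] ennreal_plus[symmetric] ennreal_inj del: ennreal_plus)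
  moreover have "(\<integral>s. (\<chi> a. Q_fun M \<pi>' s a) \<bullet> (\<pi> s - \<pi>' s) \<partial>?d) = (\<integral>s. X s - V_fun M \<pi>' s \<partial>?d)"
    by (intro Bochner_Integration.integral_cong refl)
      (simp add: sp X_def policy_mean_Q_fun[OF mdp pol', symmetric] inner_vec_def sum_subtractf algebra_simps)
  ultimately show ?thesis
    using X_int V_int by (simp add: algebra_simps)
qed

section \<open>The AMPO recursion\<close>

lemma borel_measurable_vec_lambda:
  fixes g :: "'b \<Rightarrow> 'a::finite \<Rightarrow> real"
  assumes "\<And>a. (\<lambda>x. g x a) \<in> borel_measurable N"
  shows "(\<lambda>x. \<chi> a. g x a) \<in> borel_measurable N"
proof (subst borel_measurable_euclidean_space, rule ballI)
  fix b :: "real ^ 'a" assume "b \<in> Basis"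
  then obtain a where "b = axis a 1" by (auto simp: Basis_vec_def)
  then show "(\<lambda>x. (\<chi> a. g x a) \<bullet> b) \<in> borel_measurable N"
    using assms by (simp add: inner_axis)
qed

text \<open>Needed because \<open>h\<close> and \<open>grad h\<close> are controlled only on
  \<open>Y\<close> and on its interior. Extension by zero off a Borel set is measurable and agrees
  with the function along \<open>u\<close>.\<close>

lemma borel_measurable_on_set:
  fixes g :: "'b::topological_space \<Rightarrow> 'c::real_normed_vector"
  assumes g: "continuous_on A g" and A: "A \<in> sets borel"
    and u: "u \<in> borel_measurable N" "\<And>x. x \<in> space N \<Longrightarrow> u x \<in> A"
  shows "(\<lambda>x. g (u x)) \<in> borel_measurable N"
proof -
  have "(\<lambda>x. indicator A (u x) *\<^sub>R g (u x)) \<in> borel_measurable N"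
    using measurable_compose[OF u(1) borel_measurable_continuous_on_indicator[OF A g]] .
  then show ?thesis
    by (rule measurable_cong[THEN iffD1, rotated]) (simp add: u)
qed

lemma borel_measurable_bregman:
  assumes mm: "mirror_map Y h"
    and u: "u \<in> borel_measurable N" "\<And>x. x \<in> space N \<Longrightarrow> u x \<in> prob_simplex"
    and z: "z \<in> borel_measurable N" "\<And>x. x \<in> space N \<Longrightarrow> z x \<in> prob_simplex \<inter> interior Y"
  shows "(\<lambda>x. bregman h (u x) (z x)) \<in> borel_measurable N"
proof -
  have h: "continuous_on prob_simplex h"
    by (rule continuous_on_subset[OF mirror_cont[OF mm] mirror_simplex[OF mm]])
  have simplex: "prob_simplex \<in> sets borel"
    by (intro borel_closed compact_imp_closed compact_prob_simplex)
  have "(\<lambda>x. h (u x)) \<in> borel_measurable N" "(\<lambda>x. h (z x)) \<in> borel_measurable N"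
    using u z by (auto intro!: borel_measurable_on_set[OF h simplex])
  moreover have "(\<lambda>x. grad h (z x)) \<in> borel_measurable N"
    using z by (auto intro!: borel_measurable_on_set[OF mirror_grad_cont[OF mm]])
  ultimately show ?thesis
    unfolding bregman_def by (intro borel_measurable_diff borel_measurable_inner u z)
qed

text \<open>The policy \<open>p0\<close> serves as an anchor: at each state its value is the simplex
  point in \<open>interior Y\<close> that keeps the projection off the frontier.\<close>

lemma mirror_step_policy:
  assumes mm: "mirror_map Y h" and p0: "is_policy M p0" "\<And>s. s \<in> space (states M) \<Longrightarrow> p0 s \<in> interior Y"
    and w: "w \<in> borel_measurable (states M)"
    and p: "\<And>s. s \<in> space (states M) \<Longrightarrow> p s = mirror_step Y h (w s)"
  shows "is_policy M p" and "s \<in> space (states M) \<Longrightarrow> p s \<in> interior Y"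
proof -
  have "(\<lambda>s. mirror_step Y h (w s)) \<in> borel_measurable (states M)"
    by (rule measurable_compose[OF w borel_measurable_continuous_onI[OF continuous_mirror_step[OF mm]]])
  then have "p \<in> borel_measurable (states M)"
    by (rule measurable_cong[THEN iffD2, rotated]) (rule p)
  then show "is_policy M p"
    by (simp add: is_policy_def p mirror_step_in[OF mm])
  show "p s \<in> interior Y" if s: "s \<in> space (states M)"
    using mirror_step_interior[OF mm policy_simplex[OF p0(1) s] p0(2)[OF s]] by (simp add: p[OF s])
qed

text \<open>
  The Young-type form of Cauchy--Schwarz with a free parameter \<open>l\<close>: it is linear in the squared
  error, so that expectations over the algorithm can be taken before \<open>l\<close> is optimised.
\<close>
lemma weighted_error_le:
  fixes g :: "'s \<Rightarrow> 'a::finite \<Rightarrow> real"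
  assumes \<rho>: "sets \<rho> = sets S" and q: "has_density (\<rho> \<Otimes>\<^sub>M count_space UNIV) v q"
    and meas: "\<And>a. (\<lambda>s. g s a) \<in> borel_measurable S" "\<And>a. (\<lambda>s. k s a) \<in> borel_measurable S"
    and k: "\<And>s a. s \<in> space S \<Longrightarrow> 0 \<le> k s a"
    and pos: "\<And>s a. s \<in> space S \<Longrightarrow> 0 < k s a \<Longrightarrow> 0 < q (s, a)"
    and err: "L2_norm_sq v g \<le> ennreal \<epsilon>" and conc: "(\<integral>\<^sup>+ (s, a). ennreal ((k s a / q (s, a))\<^sup>2) \<partial>v) \<le> ennreal C"
    and nonneg: "0 \<le> \<epsilon>" "0 \<le> C" and l: "0 < l"
  shows "(\<integral>\<^sup>+ s. ennreal (\<Sum>a\<in>UNIV. k s a * \<bar>g s a\<bar>) \<partial>\<rho>) \<le> ennreal ((l * \<epsilon> + C / l) / 2)"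
proof -
  let ?P = "\<rho> \<Otimes>\<^sub>M count_space (UNIV :: 'a set)"
  have sp: "space \<rho> = space S" by (rule sets_eq_imp_space_eq[OF \<rho>])
  interpret cnt: sigma_finite_measure "count_space (UNIV :: 'a set)"
    by (rule sigma_finite_measure_count_space)
  have pair: "(\<lambda>x. u (fst x) (snd x)) \<in> borel_measurable ?P"
    if "\<And>a. (\<lambda>s. u s a :: real) \<in> borel_measurable S" for u
    by (rule measurable_compose_countable[where f="\<lambda>a x. u (fst x) a" and g=snd, simplified])
      (use that in \<open>auto intro!: measurable_compose[OF measurable_fst] simp: measurable_cong_sets[OF \<rho> refl]\<close>)
  note g_P = pair[of g, OF meas(1)] and k_P = pair[of k, OF meas(2)]
  have q_meas: "q \<in> borel_measurable ?P" and q_nonneg: "\<And>x. x \<in> space ?P \<Longrightarrow> 0 \<le> q x"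
    and v: "v = density ?P (\<lambda>x. ennreal (q x))"
    using q by (auto simp: has_density_def)
  define G where "G x = ennreal ((g (fst x) (snd x))\<^sup>2)" for x
  define R where "R x = ennreal ((k (fst x) (snd x) / q x)\<^sup>2)" for x
  have G: "G \<in> borel_measurable ?P"
    unfolding G_def by (intro measurable_compose[OF _ measurable_ennreal] borel_measurable_power g_P)
  have R: "R \<in> borel_measurable ?P"
    unfolding R_def
    by (intro measurable_compose[OF _ measurable_ennreal] borel_measurable_power borel_measurable_divide k_P q_meas)
  have qe: "(\<lambda>x. ennreal (q x)) \<in> borel_measurable ?P"
    by (rule measurable_compose[OF q_meas measurable_ennreal])
  have "(\<integral>\<^sup>+ s. ennreal (\<Sum>a\<in>UNIV. k s a * \<bar>g s a\<bar>) \<partial>\<rho>) =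
      (\<integral>\<^sup>+ s. (\<integral>\<^sup>+ a. ennreal (k s a * \<bar>g s a\<bar>) \<partial>count_space UNIV) \<partial>\<rho>)"
    by (intro nn_integral_cong) (simp add: nn_integral_count_space_finite sum_ennreal k sp)
  also have "\<dots> = (\<integral>\<^sup>+ x. ennreal (k (fst x) (snd x) * \<bar>g (fst x) (snd x)\<bar>) \<partial>?P)"
    by (subst cnt.nn_integral_fst[symmetric])
      (auto intro!: measurable_compose[OF _ measurable_ennreal] borel_measurable_times borel_measurable_abs k_P g_P)
  also have "\<dots> \<le> (\<integral>\<^sup>+ x. ennreal (q x) * (ennreal (l / 2) * G x + ennreal (1 / (2 * l)) * R x) \<partial>?P)"
  proof (rule nn_integral_mono)
    fix x assume x: "x \<in> space ?P"
    let ?g = "g (fst x) (snd x)" and ?k = "k (fst x) (snd x)"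
    have s: "fst x \<in> space S" using x by (auto simp: space_pair_measure sp)
    have "?k * \<bar>?g\<bar> \<le> q x * (l / 2 * ?g\<^sup>2 + 1 / (2 * l) * (?k / q x)\<^sup>2)"
    \<comment> \<open>Where \<open>q\<close> vanishes, \<open>k\<close> vanishes by the positivity
      condition, so the default value of division by zero does no harm.\<close>
    proof (cases "q x = 0")
      case True
      then have "?k = 0" using pos[OF s, of "snd x"] k[OF s, of "snd x"] by (cases "?k = 0") auto
      then show ?thesis using True by simp
    next
      case False
      then have qx: "0 < q x" using q_nonneg[OF x] by simp
      define r where "r = ?k / q x"
      \<comment> \<open>Expanding this square is Young's inequality for
        \<open>r * \<bar>?g\<bar>\<close>; multiplication by \<open>q x\<close> turns
        \<open>r\<close> back into \<open>?k\<close> and the right-hand side into a density against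
        \<open>v\<close>.\<close>
      have "0 \<le> (l * \<bar>?g\<bar> - r)\<^sup>2 / (2 * l)" using l by simp
      also have "\<dots> = l / 2 * ?g\<^sup>2 + 1 / (2 * l) * r\<^sup>2 - r * \<bar>?g\<bar>"
        using l by (simp add: power2_eq_square field_simps)
      finally have "q x * (r * \<bar>?g\<bar>) \<le> q x * (l / 2 * ?g\<^sup>2 + 1 / (2 * l) * r\<^sup>2)"
        using qx by (intro mult_left_mono) auto
      then show ?thesis using qx by (simp add: r_def)
    qed
    then have "ennreal (?k * \<bar>?g\<bar>) \<le> ennreal (q x * (l / 2 * ?g\<^sup>2 + 1 / (2 * l) * (?k / q x)\<^sup>2))"
      by (rule ennreal_leI)
    also have "\<dots> = ennreal (q x) * (ennreal (l / 2) * G x + ennreal (1 / (2 * l)) * R x)"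
      using q_nonneg[OF x] l
      by (simp add: G_def R_def ennreal_mult'[symmetric] ennreal_plus[symmetric] del: ennreal_plus)
    finally show "ennreal (?k * \<bar>?g\<bar>) \<le> \<dots>" .
  qed
  also have "\<dots> = (\<integral>\<^sup>+ x. ennreal (l / 2) * G x + ennreal (1 / (2 * l)) * R x \<partial>v)"
    unfolding v using G R qe
    by (subst nn_integral_density) (auto intro!: borel_measurable_add borel_measurable_times_ennreal)
  also have "\<dots> = ennreal (l / 2) * (\<integral>\<^sup>+ x. G x \<partial>v) + ennreal (1 / (2 * l)) * (\<integral>\<^sup>+ x. R x \<partial>v)"
    unfolding v using G R
    by (simp add: nn_integral_add nn_integral_cmult borel_measurable_times_ennreal)
  also have "\<dots> \<le> ennreal (l / 2) * ennreal \<epsilon> + ennreal (1 / (2 * l)) * ennreal C"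
    using err conc by (intro add_mono mult_left_mono) (auto simp: L2_norm_sq_def G_def R_def case_prod_unfold)
  also have "\<dots> = ennreal (l / 2 * \<epsilon> + 1 / (2 * l) * C)"
    using l nonneg
    by (simp add: ennreal_mult'[symmetric] ennreal_plus[symmetric] del: ennreal_plus)
  also have "l / 2 * \<epsilon> + 1 / (2 * l) * C = (l * \<epsilon> + C / l) / 2"
    using l by (simp add: field_simps)
  finally show ?thesis .
qed

text \<open>Bridge from extended-valued bounds to Bochner integrals: integrability is obtained
  together with the estimate.\<close>

lemma integrable_integral_le_nn:
  assumes g: "g \<in> borel_measurable N" and le: "(\<integral>\<^sup>+ x. ennreal (b x) \<partial>N) \<le> ennreal c"
    and ab: "\<And>x. x \<in> space N \<Longrightarrow> \<bar>g x\<bar> \<le> b x" and c: "0 \<le> c"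
  shows "integrable N g" "\<bar>\<integral>x. g x \<partial>N\<bar> \<le> c"
proof -
  have nn: "(\<integral>\<^sup>+ x. ennreal \<bar>g x\<bar> \<partial>N) \<le> ennreal c"
    using le ab by (intro order.trans[OF nn_integral_mono le]) (auto intro: ennreal_leI)
  show int: "integrable N g"
    using g nn by (intro integrableI_bounded) (auto intro: order.strict_trans1)
  have "\<bar>\<integral>x. g x \<partial>N\<bar> \<le> (\<integral>x. \<bar>g x\<bar> \<partial>N)"
    by (rule integral_abs_bound)
  moreover have "(\<integral>\<^sup>+ x. ennreal \<bar>g x\<bar> \<partial>N) = ennreal (\<integral>x. \<bar>g x\<bar> \<partial>N)"
    by (rule nn_integral_eq_integral) (auto intro: integrable_abs int)
  with nn have "(\<integral>x. \<bar>g x\<bar> \<partial>N) \<le> c" using c by simp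
  ultimately show "\<bar>\<integral>x. g x \<partial>N\<bar> \<le> c" by linarith
qed

text \<open>
  The Young bound for the product of two nonnegative reals is optimal at \<open>l = sqrt (C / \<epsilon>)\<close>; the
  infimum is not attained when one of the two numbers vanishes.
\<close>
lemma le_sqrt_if_Young:
  fixes x c C \<epsilon> :: real
  assumes "0 \<le> c" "0 \<le> \<epsilon>" "0 \<le> C" and le: "\<And>l. 0 < l \<Longrightarrow> x \<le> c * ((l * \<epsilon> + C / l) / 2)"
  shows "x \<le> c * sqrt (C * \<epsilon>)"
proof (cases "\<epsilon> = 0 \<or> C = 0")
  case False
  then have pos: "0 < \<epsilon>" "0 < C" using assms by auto
  define l where "l = sqrt C / sqrt \<epsilon>"
  have "l * \<epsilon> = sqrt C * sqrt \<epsilon>" "C / l = sqrt C * sqrt \<epsilon>"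
    using pos by (simp_all add: l_def field_simps real_div_sqrt)
  then show ?thesis
    using le[of l] pos by (simp add: l_def real_sqrt_mult)
next
  case True
  show ?thesis
  proof (rule field_le_epsilon)
    fix e :: real assume e: "0 < e"
    \<comment> \<open>The summand 1 keeps \<open>b\<close> positive. With \<open>l = b / e\<close>
      if \<epsilon> = 0, and \<open>l = e / b\<close> if \<open>C = 0\<close>, the surviving half of
      the Young bound is at most \<open>e\<close>.\<close>
    define b where "b = c * (\<epsilon> + C) + 1"
    have b: "0 < b" using assms by (simp add: b_def add_nonneg_pos)
    have "x \<le> e"
    proof (cases "\<epsilon> = 0")
      case True
      have "x \<le> c * (C / (b / e) / 2)" using le[of "b / e"] b e True by simp
      also have "\<dots> \<le> e * (c * C / b)" using assms b e by (simp add: field_simps)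
      also have "\<dots> \<le> e * 1" using True b e assms by (intro mult_left_mono) (auto simp: b_def divide_le_eq)
      finally show ?thesis by simp
    next
      case False
      with True have "C = 0" by simp
      then have "x \<le> c * ((e / b) * \<epsilon> / 2)" using le[of "e / b"] b e by simp
      also have "\<dots> \<le> e * (c * \<epsilon> / b)" using assms b e by (simp add: field_simps)
      also have "\<dots> \<le> e * 1" using \<open>C = 0\<close> b e assms by (intro mult_left_mono) (auto simp: b_def divide_le_eq)
      finally show ?thesis by simp
    qed
    then show "x \<le> c * sqrt (C * \<epsilon>) + e"
      using assms by (simp add: add_increasing)
  qed
qed

text \<open>The divergence at the final time is kept in the claim, weighted by the current step
  size. Since step sizes do not decrease, passing to the next weight can only shrink this term, so
  the induction closes.\<close>

lemma sum_gap_le: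
  fixes \<delta> D e \<eta> :: "nat \<Rightarrow> real"
  assumes step: "\<And>t. \<delta> t + \<nu> * (\<delta> (Suc t) - \<delta> t) \<le> (D t - D (Suc t)) / (c * \<eta> t) + e t"
    and \<eta>: "\<And>t. 0 < \<eta> t" "\<And>t. \<eta> t \<le> \<eta> (Suc t)" and c: "0 < c" and D: "\<And>t. 0 \<le> D t"
  shows "(\<Sum>t<T. \<delta> t) + \<nu> * (\<delta> T - \<delta> 0) + D T / (c * \<eta> T) \<le> D 0 / (c * \<eta> 0) + (\<Sum>t<T. e t)"
proof (induction T)
  case (Suc T)
  have "D (Suc T) / (c * \<eta> (Suc T)) \<le> D (Suc T) / (c * \<eta> T)"
    using D \<eta> c by (intro divide_left_mono mult_left_mono mult_pos_pos) (auto intro: less_imp_le)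
  then show ?case
    using Suc step[of T] by (simp add: diff_divide_distrib right_diff_distrib)
qed simp

text \<open>The left-hand side is a Lyapunov function. Division of the step inequality by \<nu>
  produces the factor 1 - 1 / \<nu> in front of it at time \<open>T\<close>, with weight
  \<open>1 / (\<nu> * (c * \<eta> T))\<close> on the new divergence; the growth condition on the
  step sizes is what makes this weight dominate the one required at time
  \<open>Suc T\<close>.\<close>

lemma linear_gap_le:
  fixes \<delta> D e \<eta> :: "nat \<Rightarrow> real"
  assumes step: "\<And>t. \<delta> t + \<nu> * (\<delta> (Suc t) - \<delta> t) \<le> (D t - D (Suc t)) / (c * \<eta> t) + e t"
    and \<nu>: "1 < \<nu>" and \<eta>: "\<And>t. 0 < \<eta> t" "\<And>t. \<nu> / (\<nu> - 1) * \<eta> t \<le> \<eta> (Suc t)"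
    and c: "0 < c" and D: "\<And>t. 0 \<le> D t"
  shows "\<delta> T + D T / ((\<nu> - 1) * (c * \<eta> T)) \<le>
    (1 - 1 / \<nu>) ^ T * (\<delta> 0 + D 0 / ((\<nu> - 1) * (c * \<eta> 0))) + (\<Sum>t<T. (1 - 1 / \<nu>) ^ (T - Suc t) * (e t / \<nu>))"
proof (induction T)
  case (Suc T)
  let ?\<kappa> = "1 - 1 / \<nu>"
  have \<kappa>: "0 \<le> ?\<kappa>" "\<nu> * ?\<kappa> = \<nu> - 1" using \<nu> by (auto simp: field_simps)
  have "\<nu> * \<eta> T \<le> (\<nu> - 1) * \<eta> (Suc T)"
    using \<eta>(2)[of T] \<nu> by (simp add: divide_simps mult.commute)
  then have "\<nu> * (c * \<eta> T) \<le> (\<nu> - 1) * (c * \<eta> (Suc T))"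
    using c by (simp add: mult.left_commute)
  then have "D (Suc T) / ((\<nu> - 1) * (c * \<eta> (Suc T))) \<le> D (Suc T) / (\<nu> * (c * \<eta> T))"
    using D \<eta>(1) \<nu> c by (intro divide_left_mono mult_pos_pos) auto
  moreover have "\<delta> (Suc T) + D (Suc T) / (\<nu> * (c * \<eta> T)) \<le>
      ?\<kappa> * (\<delta> T + D T / ((\<nu> - 1) * (c * \<eta> T))) + e T / \<nu>"
  proof -
    have "\<nu> * \<delta> (Suc T) + D (Suc T) / (c * \<eta> T) \<le> (\<nu> - 1) * \<delta> T + D T / (c * \<eta> T) + e T"
      using step[of T] by (simp add: diff_divide_distrib algebra_simps)
    then have "(\<nu> * \<delta> (Suc T) + D (Suc T) / (c * \<eta> T)) / \<nu> \<le> ((\<nu> - 1) * \<delta> T + D T / (c * \<eta> T) + e T) / \<nu>"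
      using \<nu> by (intro divide_right_mono) auto
    moreover have "(\<nu> * \<delta> (Suc T) + D (Suc T) / (c * \<eta> T)) / \<nu> = \<delta> (Suc T) + D (Suc T) / (\<nu> * (c * \<eta> T))"
      using \<nu> by (simp add: add_divide_distrib mult.commute)
    moreover have "((\<nu> - 1) * \<delta> T + D T / (c * \<eta> T) + e T) / \<nu> =
        ?\<kappa> * (\<delta> T + D T / ((\<nu> - 1) * (c * \<eta> T))) + e T / \<nu>"
    proof -
      have "\<nu> - 1 \<noteq> 0" "\<nu> \<noteq> 0" "c * \<eta> T \<noteq> 0" using \<nu> c \<eta>(1)[of T] by auto
      then show ?thesis by (simp add: divide_simps)
    qed
    ultimately show ?thesis by linarith
  qed
  moreover have "?\<kappa> * (\<delta> T + D T / ((\<nu> - 1) * (c * \<eta> T))) \<le>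
      ?\<kappa> * (?\<kappa> ^ T * (\<delta> 0 + D 0 / ((\<nu> - 1) * (c * \<eta> 0))) + (\<Sum>t<T. ?\<kappa> ^ (T - Suc t) * (e t / \<nu>)))"
    by (rule mult_left_mono[OF Suc \<kappa>(1)])
  moreover have "?\<kappa> * (\<Sum>t<T. ?\<kappa> ^ (T - Suc t) * (e t / \<nu>)) + e T / \<nu> =
      (\<Sum>t<Suc T. ?\<kappa> ^ (Suc T - Suc t) * (e t / \<nu>))"
  proof -
    have "?\<kappa> * (?\<kappa> ^ (T - Suc t) * (e t / \<nu>)) = ?\<kappa> ^ (T - t) * (e t / \<nu>)" if "t < T" for t
      using that by (metis Suc_diff_Suc mult.assoc power_Suc)
    then have "?\<kappa> * (\<Sum>t<T. ?\<kappa> ^ (T - Suc t) * (e t / \<nu>)) = (\<Sum>t<T. ?\<kappa> ^ (T - t) * (e t / \<nu>))"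
      unfolding sum_distrib_left by (intro sum.cong refl) (simp only: lessThan_iff)
    then show ?thesis by (simp only: sum.lessThan_Suc diff_Suc_Suc) simp
  qed
  ultimately show ?case
    by (simp only: power_Suc distrib_left mult.assoc)
qed simp

section \<open>One step of the algorithm\<close>

lemma bregman_self: "bregman h z z = 0"
  by (simp add: bregman_def)

lemma has_density_integral:
  fixes u :: "'b \<Rightarrow> real"
  assumes p: "has_density \<rho> N p" and u: "u \<in> borel_measurable \<rho>"
  shows "integrable N u \<longleftrightarrow> integrable \<rho> (\<lambda>x. p x * u x)" "(\<integral>x. u x \<partial>N) = (\<integral>x. p x * u x \<partial>\<rho>)"
proof -
  have "p \<in> borel_measurable \<rho>" "AE x in \<rho>. 0 \<le> p x" "N = density \<rho> (\<lambda>x. ennreal (p x))"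
    using p by (auto simp: has_density_def intro: AE_I2)
  then show "integrable N u \<longleftrightarrow> integrable \<rho> (\<lambda>x. p x * u x)" "(\<integral>x. u x \<partial>N) = (\<integral>x. p x * u x \<partial>\<rho>)"
    using u by (simp_all add: integrable_density integral_density)
qed

text \<open>
  One step of AMPO. The three-point inequality is used at \<open>\<pi>star\<close> and at the old policy \<open>p\<close>; the
  latter makes \<open>x \<bullet> (p - p')\<close> nonpositive, so its average under \<open>dstar\<close> is bounded below by \<open>\<nu>\<close>
  times its average under the visitation distribution of the new policy \<open>p'\<close>.
\<close>
lemma mirror_policy_step:
  fixes M :: "('s, 'a::finite) mdp" and g :: "'s \<Rightarrow> 'a \<Rightarrow> real"
  assumes mdp: "is_mdp M" and mm: "mirror_map Y h" and polstar: "is_policy M \<pi>star"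
    and p: "is_policy M p" "\<And>s. s \<in> space (states M) \<Longrightarrow> p s \<in> interior Y"
    and f: "\<And>a. (\<lambda>s. f s a) \<in> borel_measurable (states M)" and \<eta>: "0 < \<eta>"
    and p': "\<And>s. s \<in> space (states M) \<Longrightarrow> p' s = mirror_step Y h (\<eta> *\<^sub>R (\<chi> a. f s a))"
    and \<rho>: "sets \<rho> = sets (states M)" and dstar: "has_density \<rho> (visitation M \<pi>star) dstar"
    and d: "has_density \<rho> (visitation M p') d" and q: "has_density (\<rho> \<Otimes>\<^sub>M count_space UNIV) v q"
    and constants: "0 \<le> \<epsilon>" "0 \<le> C" "0 \<le> \<nu>" "0 < l"
    and ratio: "\<And>s. s \<in> space (states M) \<Longrightarrow> dstar s \<le> \<nu> * d s"
    and err: "L2_norm_sq v (\<lambda>s a. f s a - Q_fun M p s a - inverse \<eta> * grad h (p s) $ a) \<le> ennreal \<epsilon>"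
    and conc: "\<And>d' \<pi>'. (d', \<pi>') \<in> {(dstar, \<pi>star), (d, p'), (dstar, p), (d, p)} \<Longrightarrow>
      (\<forall>s\<in>space (states M). \<forall>a. 0 < d' s * \<pi>' s $ a \<longrightarrow> 0 < q (s, a)) \<and>
      (\<integral>\<^sup>+ (s, a). ennreal ((d' s * \<pi>' s $ a / q (s, a))\<^sup>2) \<partial>v) \<le> ennreal C"
    and D_int: "integrable (visitation M \<pi>star) (\<lambda>s. bregman h (\<pi>star s) (p s))"
  shows "integrable (visitation M \<pi>star) (\<lambda>s. bregman h (\<pi>star s) (p' s))"
    and "(1 - discount M) * ((V_init M \<pi>star - V_init M p) + \<nu> * (V_init M p - V_init M p')) \<le>
      ((\<integral>s. bregman h (\<pi>star s) (p s) \<partial>visitation M \<pi>star) -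
        (\<integral>s. bregman h (\<pi>star s) (p' s) \<partial>visitation M \<pi>star)) / \<eta> + 2 * (1 + \<nu>) * ((l * \<epsilon> + C / l) / 2)"
proof -
  let ?S = "space (states M)" and ?e = "(l * \<epsilon> + C / l) / 2"
  have sp: "space \<rho> = ?S" by (rule sets_eq_imp_space_eq[OF \<rho>])
  have meas_\<rho>: "borel_measurable \<rho> = (borel_measurable (states M) :: ('s \<Rightarrow> 'b::topological_space) set)"
    by (rule measurable_cong_sets[OF \<rho> refl])
  have e: "0 \<le> ?e" using constants by simp
  have w: "(\<lambda>s. \<eta> *\<^sub>R (\<chi> a. f s a)) \<in> borel_measurable (states M)"
    by (intro borel_measurable_scaleR borel_measurable_const borel_measurable_vec_lambda f)
  have pol': "is_policy M p'" and p'_int: "\<And>s. s \<in> ?S \<Longrightarrow> p' s \<in> interior Y"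
    using mirror_step_policy[OF mm p w p'] by auto
  note pols = polstar p(1) pol'
  have D_meas: "(\<lambda>s. bregman h (\<pi>star s) (p s)) \<in> borel_measurable (states M)"
      "(\<lambda>s. bregman h (\<pi>star s) (p' s)) \<in> borel_measurable (states M)"
    using p(2) p'_int pols[THEN policy_simplex]
    by (auto intro!: borel_measurable_bregman[OF mm] pols[THEN policy_measurable])

  define Q where "Q s = (\<chi> a. Q_fun M p s a)" for s
  define g where "g s = (\<chi> a. f s a - Q_fun M p s a - inverse \<eta> * grad h (p s) $ a)" for s
  have Q_meas: "Q \<in> borel_measurable (states M)"
    unfolding Q_def by (intro borel_measurable_vec_lambda measurable_Q_fun[OF mdp p(1)])
  have grad_meas: "(\<lambda>s. grad h (p s)) \<in> borel_measurable (states M)"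
    using p(2) by (auto intro!: borel_measurable_on_set[OF mirror_grad_cont[OF mm]] policy_measurable[OF p(1)])
  have g_meas: "(\<lambda>s. g s $ a) \<in> borel_measurable (states M)" for a
  proof -
    have "(\<lambda>s. grad h (p s) $ a) \<in> borel_measurable (states M)"
      by (rule measurable_compose[OF grad_meas borel_measurable_continuous_onI]) (intro continuous_intros)
    then show ?thesis
      unfolding g_def vec_lambda_beta
      by (intro borel_measurable_diff borel_measurable_times borel_measurable_const f measurable_Q_fun[OF mdp p(1)])
  qed
  have g_meas': "g \<in> borel_measurable (states M)"
    using borel_measurable_vec_lambda[of "\<lambda>s a. g s $ a", OF g_meas] by simp

  have dstar_meas: "dstar \<in> borel_measurable (states M)" and dstar_nonneg: "\<And>s. s \<in> ?S \<Longrightarrow> 0 \<le> dstar s"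
    and d_meas: "d \<in> borel_measurable (states M)" and d_nonneg: "\<And>s. s \<in> ?S \<Longrightarrow> 0 \<le> d s"
    using dstar d by (auto simp: has_density_def sp meas_\<rho>)

  \<comment> \<open>Concentrability is used only here, one bound \<open>?e\<close> per listed pair.
    The errors are integrated against the density \<open>d'\<close> over \<rho>, so that averages
    under both visitations can be combined pointwise.\<close>
  have error: "integrable \<rho> (\<lambda>s. d' s * (g s \<bullet> \<pi>' s))" "\<bar>\<integral>s. d' s * (g s \<bullet> \<pi>' s) \<partial>\<rho>\<bar> \<le> ?e"
    if d\<pi>: "(d', \<pi>') \<in> {(dstar, \<pi>star), (d, p'), (dstar, p), (d, p)}" for d' \<pi>'
  proof -
    have d': "d' \<in> borel_measurable (states M)" "\<And>s. s \<in> ?S \<Longrightarrow> 0 \<le> d' s" and \<pi>': "is_policy M \<pi>'"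
      using d\<pi> dstar_meas dstar_nonneg d_meas d_nonneg pols by auto
    have nn: "(\<integral>\<^sup>+ s. ennreal (\<Sum>a\<in>UNIV. d' s * \<pi>' s $ a * \<bar>g s $ a\<bar>) \<partial>\<rho>) \<le> ennreal ?e"
    proof (rule weighted_error_le[OF \<rho> q])
      show "(\<lambda>s. d' s * \<pi>' s $ a) \<in> borel_measurable (states M)" for a
        by (intro borel_measurable_times d' policy_component_measurable[OF \<pi>'])
      show "0 \<le> d' s * \<pi>' s $ a" if "s \<in> ?S" for s a
        using d'(2) policy_nonneg[OF \<pi>'] that by simp
      show "L2_norm_sq v (\<lambda>s a. g s $ a) \<le> ennreal \<epsilon>"
        using err by (simp add: g_def)
    qed (use conc[OF d\<pi>] g_meas constants in auto)
    have meas: "(\<lambda>s. d' s * (g s \<bullet> \<pi>' s)) \<in> borel_measurable \<rho>"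
      unfolding meas_\<rho> by (intro borel_measurable_times borel_measurable_inner d' g_meas' policy_measurable \<pi>')
    have ab: "\<bar>d' s * (g s \<bullet> \<pi>' s)\<bar> \<le> (\<Sum>a\<in>UNIV. d' s * \<pi>' s $ a * \<bar>g s $ a\<bar>)" if s: "s \<in> space \<rho>" for s
    proof -
      have "d' s * (g s \<bullet> \<pi>' s) = (\<Sum>a\<in>UNIV. d' s * \<pi>' s $ a * g s $ a)"
        by (simp add: inner_vec_def sum_distrib_left mult_ac)
      also have "\<bar>\<dots>\<bar> \<le> (\<Sum>a\<in>UNIV. \<bar>d' s * \<pi>' s $ a * g s $ a\<bar>)" by (rule sum_abs)
      also have "\<dots> = (\<Sum>a\<in>UNIV. d' s * \<pi>' s $ a * \<bar>g s $ a\<bar>)"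
        using s d'(2) policy_nonneg[OF \<pi>'] by (intro sum.cong refl) (simp add: sp abs_mult)
      finally show ?thesis .
    qed
    show "integrable \<rho> (\<lambda>s. d' s * (g s \<bullet> \<pi>' s))" "\<bar>\<integral>s. d' s * (g s \<bullet> \<pi>' s) \<partial>\<rho>\<bar> \<le> ?e"
      using integrable_integral_le_nn[OF meas nn ab e] by auto
  qed

  have Q_bound: "\<bar>Q s \<bullet> (\<pi>1 s - \<pi>2 s)\<bar> \<le> 2 * (1 / (1 - discount M))"
    if s: "s \<in> ?S" and \<pi>: "is_policy M \<pi>1" "is_policy M \<pi>2" for s \<pi>1 \<pi>2
  proof -
    have "0 \<le> Q s \<bullet> \<pi>' s \<and> Q s \<bullet> \<pi>' s \<le> 1 / (1 - discount M)" if \<pi>': "is_policy M \<pi>'" for \<pi>'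
    proof -
      have "(\<Sum>a\<in>UNIV. Q_fun M p s a * \<pi>' s $ a) \<le> (\<Sum>a\<in>UNIV. 1 / (1 - discount M) * \<pi>' s $ a)"
        by (intro sum_mono mult_right_mono Q_fun_le[OF mdp p(1) s] policy_nonneg[OF \<pi>' s])
      also have "\<dots> = 1 / (1 - discount M)"
        using policy_sum[OF \<pi>' s] by (simp flip: sum_divide_distrib)
      finally show ?thesis
        using Q_fun_nonneg[OF mdp p(1) s] policy_nonneg[OF \<pi>' s]
        by (auto simp: Q_def inner_vec_def intro!: sum_nonneg)
    qed
    from this[OF \<pi>(1)] this[OF \<pi>(2)] show ?thesis
      unfolding inner_diff_right by linarith
  qed
  have Q_int: "integrable \<rho> (\<lambda>s. d' s * (Q s \<bullet> (\<pi>1 s - \<pi>2 s)))"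
      "(\<integral>s. d' s * (Q s \<bullet> (\<pi>1 s - \<pi>2 s)) \<partial>\<rho>) = (\<integral>s. Q s \<bullet> (\<pi>1 s - \<pi>2 s) \<partial>visitation M \<pi>')"
    if "has_density \<rho> (visitation M \<pi>') d'" "is_policy M \<pi>'" "is_policy M \<pi>1" "is_policy M \<pi>2" for \<pi>' d' \<pi>1 \<pi>2
  proof -
    have meas: "(\<lambda>s. Q s \<bullet> (\<pi>1 s - \<pi>2 s)) \<in> borel_measurable (states M)"
      by (intro borel_measurable_inner borel_measurable_diff Q_meas policy_measurable that)
    show "integrable \<rho> (\<lambda>s. d' s * (Q s \<bullet> (\<pi>1 s - \<pi>2 s)))"
      using integrable_visitation_bounded[OF mdp that(2) meas Q_bound[OF _ that(3,4)]]
        has_density_integral(1)[OF that(1)] meas by (simp add: meas_\<rho>)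
    show "(\<integral>s. d' s * (Q s \<bullet> (\<pi>1 s - \<pi>2 s)) \<partial>\<rho>) = (\<integral>s. Q s \<bullet> (\<pi>1 s - \<pi>2 s) \<partial>visitation M \<pi>')"
      using has_density_integral(2)[OF that(1)] meas by (simp add: meas_\<rho>)
  qed
  note pdl = performance_difference[OF mdp _ p(1), folded Q_def]

  \<comment> \<open>Up to the factor \<eta>, this is the dual increment in the three-point
    inequality; it is the exact action value plus the regression error \<open>g\<close>.\<close>
  define x where "x s = Q s + g s" for s
  have x: "\<eta> *\<^sub>R x s = \<eta> *\<^sub>R (\<chi> a. f s a) - grad h (p s)" for s
    using \<eta> by (simp add: x_def Q_def g_def vec_eq_iff field_simps)
  have three: "\<eta> * (x s \<bullet> (z - p' s)) \<le> bregman h z (p s) - bregman h z (p' s) - bregman h (p' s) (p s)"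
    if "s \<in> ?S" "z \<in> prob_simplex" for s z
    using mirror_step_three_point[OF mm _ that(2), of "\<eta> *\<^sub>R (\<chi> a. f s a)" "p s"] p'_int[OF that(1)]
    unfolding p'[OF that(1), symmetric] x[symmetric] by simp
  have D_nonneg: "0 \<le> bregman h z (p s)" "0 \<le> bregman h z (p' s)" if "s \<in> ?S" "z \<in> prob_simplex" for s z
    using that mirror_simplex[OF mm] p(2) p'_int by (auto intro!: bregman_nonneg[OF mm])
  have old: "x s \<bullet> (p s - p' s) \<le> 0" if s: "s \<in> ?S" for s
  proof -
    have "\<eta> * (x s \<bullet> (p s - p' s)) \<le> 0"
      using three[OF s policy_simplex[OF p(1) s]] D_nonneg(2)[OF s policy_simplex[OF p(1) s]]
        D_nonneg(1)[OF s policy_simplex[OF pol' s]] bregman_self[of h "p s"]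
      by linarith
    then show ?thesis using \<eta> by (simp add: mult_le_0_iff)
  qed
  have new: "x s \<bullet> (\<pi>star s - p' s) \<le> (bregman h (\<pi>star s) (p s) - bregman h (\<pi>star s) (p' s)) / \<eta>"
    if s: "s \<in> ?S" for s
    using three[OF s policy_simplex[OF polstar s]] D_nonneg(1)[OF s policy_simplex[OF pol' s]] \<eta>
    by (simp add: le_divide_eq mult.commute)

  have D\<rho>: "integrable \<rho> (\<lambda>s. dstar s * bregman h (\<pi>star s) (p s))"
    using D_int D_meas by (simp add: has_density_integral(1)[OF dstar] meas_\<rho>)
  \<comment> \<open>The pair of \<open>dstar\<close> with \<open>p'\<close> is not covered by
    \<open>conc\<close>. Domination by \<nu> times the integrand for \<open>d\<close> and
    \<open>p'\<close> gives integrability, which is enough to treat the new divergence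
    below.\<close>
  have g_new: "integrable \<rho> (\<lambda>s. dstar s * (g s \<bullet> p' s))"
  proof (rule Bochner_Integration.integrable_bound)
    show "integrable \<rho> (\<lambda>s. \<nu> * (d s * (g s \<bullet> p' s)))"
      using error(1)[of d p'] by simp
    show "(\<lambda>s. dstar s * (g s \<bullet> p' s)) \<in> borel_measurable \<rho>"
      unfolding meas_\<rho> by (intro borel_measurable_times borel_measurable_inner dstar_meas g_meas' policy_measurable pol')
    show "AE s in \<rho>. norm (dstar s * (g s \<bullet> p' s)) \<le> norm (\<nu> * (d s * (g s \<bullet> p' s)))"
    proof (rule AE_I2)
      fix s assume "s \<in> space \<rho>"
      then have s: "s \<in> ?S" by (simp add: sp)
      have "dstar s * \<bar>g s \<bullet> p' s\<bar> \<le> (\<nu> * d s) * \<bar>g s \<bullet> p' s\<bar>"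
        by (intro mult_right_mono ratio s) simp
      then show "norm (dstar s * (g s \<bullet> p' s)) \<le> norm (\<nu> * (d s * (g s \<bullet> p' s)))"
        using dstar_nonneg[OF s] d_nonneg[OF s] constants by (simp add: abs_mult)
    qed
  qed
  have x_new: "integrable \<rho> (\<lambda>s. dstar s * (x s \<bullet> (\<pi>star s - p' s)))"
  proof -
    have "integrable \<rho> (\<lambda>s. dstar s * (Q s \<bullet> (\<pi>star s - p' s)) +
        (dstar s * (g s \<bullet> \<pi>star s) - dstar s * (g s \<bullet> p' s)))"
      by (intro Bochner_Integration.integrable_add Bochner_Integration.integrable_diff
          Q_int(1)[OF dstar polstar polstar pol'] error(1) g_new) simp
    then show ?thesis
      by (simp add: x_def inner_add_left inner_diff_right algebra_simps)
  qed
  \<comment> \<open>The new divergence is nonnegative and bounded above by the old one minus an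
    integrable increment; this carries integrability to the next iterate.\<close>
  have D\<rho>': "integrable \<rho> (\<lambda>s. dstar s * bregman h (\<pi>star s) (p' s))"
  proof (rule Bochner_Integration.integrable_bound)
    show "integrable \<rho> (\<lambda>s. dstar s * bregman h (\<pi>star s) (p s) - \<eta> * (dstar s * (x s \<bullet> (\<pi>star s - p' s))))"
      by (intro Bochner_Integration.integrable_diff D\<rho> integrable_mult_right x_new)
    show "(\<lambda>s. dstar s * bregman h (\<pi>star s) (p' s)) \<in> borel_measurable \<rho>"
      unfolding meas_\<rho> by (intro borel_measurable_times dstar_meas D_meas)
    show "AE s in \<rho>. norm (dstar s * bregman h (\<pi>star s) (p' s)) \<le>
        norm (dstar s * bregman h (\<pi>star s) (p s) - \<eta> * (dstar s * (x s \<bullet> (\<pi>star s - p' s))))"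
    proof (rule AE_I2)
      fix s assume "s \<in> space \<rho>"
      then have s: "s \<in> ?S" by (simp add: sp)
      have "bregman h (\<pi>star s) (p' s) \<le> bregman h (\<pi>star s) (p s) - \<eta> * (x s \<bullet> (\<pi>star s - p' s))"
        using new[OF s] \<eta> by (simp add: le_divide_eq mult.commute)
      then have "dstar s * bregman h (\<pi>star s) (p' s) \<le>
          dstar s * (bregman h (\<pi>star s) (p s) - \<eta> * (x s \<bullet> (\<pi>star s - p' s)))"
        by (intro mult_left_mono dstar_nonneg s)
      then show "norm (dstar s * bregman h (\<pi>star s) (p' s)) \<le>
          norm (dstar s * bregman h (\<pi>star s) (p s) - \<eta> * (dstar s * (x s \<bullet> (\<pi>star s - p' s))))"
        using dstar_nonneg[OF s] D_nonneg(2)[OF s policy_simplex[OF polstar s]]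
        by (simp add: right_diff_distrib mult.left_commute)
    qed
  qed
  then show "integrable (visitation M \<pi>star) (\<lambda>s. bregman h (\<pi>star s) (p' s))"
    using D_meas by (simp add: has_density_integral(1)[OF dstar] meas_\<rho>)

  define I where "I d' \<pi>1 \<pi>2 = (\<integral>s. d' s * (x s \<bullet> (\<pi>1 s - \<pi>2 s)) \<partial>\<rho>)" for d' :: "'s \<Rightarrow> real" and \<pi>1 \<pi>2
  \<comment> \<open>The error \<open>g\<close> is tested against two policies, so replacing
    \<open>x\<close> by the exact \<open>Q\<close> costs \<open>2 * ?e\<close>.\<close>
  have I: "integrable \<rho> (\<lambda>s. d' s * (x s \<bullet> (\<pi>1 s - \<pi>2 s)))"
      "\<bar>I d' \<pi>1 \<pi>2 - (\<integral>s. Q s \<bullet> (\<pi>1 s - \<pi>2 s) \<partial>visitation M \<pi>')\<bar> \<le> 2 * ?e"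
    if d': "has_density \<rho> (visitation M \<pi>') d'" "is_policy M \<pi>'" "is_policy M \<pi>1" "is_policy M \<pi>2"
      and mem: "(d', \<pi>1) \<in> {(dstar, \<pi>star), (d, p'), (dstar, p), (d, p)}"
        "(d', \<pi>2) \<in> {(dstar, \<pi>star), (d, p'), (dstar, p), (d, p)}" for d' \<pi>' \<pi>1 \<pi>2
  proof -
    have eq: "d' s * (x s \<bullet> (\<pi>1 s - \<pi>2 s)) =
        d' s * (Q s \<bullet> (\<pi>1 s - \<pi>2 s)) + (d' s * (g s \<bullet> \<pi>1 s) - d' s * (g s \<bullet> \<pi>2 s))" for s
      by (simp add: x_def inner_add_left inner_diff_right algebra_simps)
    note int = Q_int(1)[OF d'] error(1)[OF mem(1)] error(1)[OF mem(2)]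
    show "integrable \<rho> (\<lambda>s. d' s * (x s \<bullet> (\<pi>1 s - \<pi>2 s)))"
      unfolding eq by (intro Bochner_Integration.integrable_add Bochner_Integration.integrable_diff int)
    have "I d' \<pi>1 \<pi>2 = (\<integral>s. Q s \<bullet> (\<pi>1 s - \<pi>2 s) \<partial>visitation M \<pi>') +
        ((\<integral>s. d' s * (g s \<bullet> \<pi>1 s) \<partial>\<rho>) - (\<integral>s. d' s * (g s \<bullet> \<pi>2 s) \<partial>\<rho>))"
      unfolding I_def eq using int by (simp add: Q_int(2)[OF d'])
    then show "\<bar>I d' \<pi>1 \<pi>2 - (\<integral>s. Q s \<bullet> (\<pi>1 s - \<pi>2 s) \<partial>visitation M \<pi>')\<bar> \<le> 2 * ?e"
      using error(2)[OF mem(1)] error(2)[OF mem(2)] by linarith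
  qed
  have I_star: "integrable \<rho> (\<lambda>s. dstar s * (x s \<bullet> (\<pi>star s - p s)))"
      "(1 - discount M) * (V_init M \<pi>star - V_init M p) - 2 * ?e \<le> I dstar \<pi>star p"
  proof -
    show "integrable \<rho> (\<lambda>s. dstar s * (x s \<bullet> (\<pi>star s - p s)))"
      by (rule I(1)[OF dstar polstar polstar p(1)]) simp_all
    have "\<bar>I dstar \<pi>star p - (\<integral>s. Q s \<bullet> (\<pi>star s - p s) \<partial>visitation M \<pi>star)\<bar> \<le> 2 * ?e"
      by (rule I(2)[OF dstar polstar polstar p(1)]) simp_all
    then show "(1 - discount M) * (V_init M \<pi>star - V_init M p) - 2 * ?e \<le> I dstar \<pi>star p"
      unfolding pdl[OF polstar] by linarith
  qed
  have I_new: "integrable \<rho> (\<lambda>s. d s * (x s \<bullet> (p' s - p s)))"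
      "I d p' p \<le> (1 - discount M) * (V_init M p' - V_init M p) + 2 * ?e"
  proof -
    show "integrable \<rho> (\<lambda>s. d s * (x s \<bullet> (p' s - p s)))"
      by (rule I(1)[OF d pol' pol' p(1)]) simp_all
    have "\<bar>I d p' p - (\<integral>s. Q s \<bullet> (p' s - p s) \<partial>visitation M p')\<bar> \<le> 2 * ?e"
      by (rule I(2)[OF d pol' pol' p(1)]) simp_all
    then show "I d p' p \<le> (1 - discount M) * (V_init M p' - V_init M p) + 2 * ?e"
      unfolding pdl[OF pol'] by linarith
  qed
  have "I dstar \<pi>star p - \<nu> * I d p' p =
      (\<integral>s. dstar s * (x s \<bullet> (\<pi>star s - p s)) - \<nu> * (d s * (x s \<bullet> (p' s - p s))) \<partial>\<rho>)"
    using I_star(1) I_new(1) by (simp add: I_def)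
  also have "\<dots> \<le> (\<integral>s. (dstar s * bregman h (\<pi>star s) (p s) - dstar s * bregman h (\<pi>star s) (p' s)) / \<eta> \<partial>\<rho>)"
  proof (rule integral_mono)
    show "integrable \<rho> (\<lambda>s. dstar s * (x s \<bullet> (\<pi>star s - p s)) - \<nu> * (d s * (x s \<bullet> (p' s - p s))))"
      by (intro Bochner_Integration.integrable_diff integrable_mult_right I_star I_new)
    show "integrable \<rho> (\<lambda>s. (dstar s * bregman h (\<pi>star s) (p s) - dstar s * bregman h (\<pi>star s) (p' s)) / \<eta>)"
      by (intro Bochner_Integration.integrable_diff integrable_divide D\<rho> D\<rho>')
    fix s assume "s \<in> space \<rho>"
    then have s: "s \<in> ?S" by (simp add: sp)
    \<comment> \<open>The increment from \<open>\<pi>star\<close> to \<open>p'\<close> is split at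
      \<open>p\<close>. The second part is nonpositive, so enlarging its weight from
      \<open>dstar s\<close> to \<open>\<nu> * d s\<close> can only lower it; its average is then
      taken under the visitation of \<open>p'\<close>, where the performance difference lemma
      applies.\<close>
    have "(\<nu> * d s) * (x s \<bullet> (p s - p' s)) \<le> dstar s * (x s \<bullet> (p s - p' s))"
      by (intro mult_right_mono_neg ratio old s)
    then have "dstar s * (x s \<bullet> (\<pi>star s - p s)) - \<nu> * (d s * (x s \<bullet> (p' s - p s))) \<le>
        dstar s * (x s \<bullet> (\<pi>star s - p' s))"
      by (simp add: inner_diff_right algebra_simps)
    also have "\<dots> \<le> dstar s * ((bregman h (\<pi>star s) (p s) - bregman h (\<pi>star s) (p' s)) / \<eta>)"
      by (intro mult_left_mono new dstar_nonneg s)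
    finally show "dstar s * (x s \<bullet> (\<pi>star s - p s)) - \<nu> * (d s * (x s \<bullet> (p' s - p s))) \<le>
        (dstar s * bregman h (\<pi>star s) (p s) - dstar s * bregman h (\<pi>star s) (p' s)) / \<eta>"
      by (simp add: right_diff_distrib)
  qed
  also have "\<dots> = ((\<integral>s. bregman h (\<pi>star s) (p s) \<partial>visitation M \<pi>star) -
      (\<integral>s. bregman h (\<pi>star s) (p' s) \<partial>visitation M \<pi>star)) / \<eta>"
    using D\<rho> D\<rho>' D_meas by (simp add: has_density_integral(2)[OF dstar] meas_\<rho>)
  finally have main: "I dstar \<pi>star p - \<nu> * I d p' p \<le> \<dots>" .
  moreover have "\<nu> * I d p' p \<le> \<nu> * ((1 - discount M) * (V_init M p' - V_init M p) + 2 * ?e)"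
    by (rule mult_left_mono[OF I_new(2) constants(3)])
  ultimately have "(1 - discount M) * (V_init M \<pi>star - V_init M p) - 2 * ?e -
      \<nu> * ((1 - discount M) * (V_init M p' - V_init M p) + 2 * ?e) \<le>
      ((\<integral>s. bregman h (\<pi>star s) (p s) \<partial>visitation M \<pi>star) -
      (\<integral>s. bregman h (\<pi>star s) (p' s) \<partial>visitation M \<pi>star)) / \<eta>"
    using I_star(2) by linarith
  moreover have ring: "a * (b - b0) - 2 * e - \<nu> * (a * (b1 - b0) + 2 * e) =
      a * ((b - b0) + \<nu> * (b0 - b1)) - 2 * (1 + \<nu>) * e" for a b b0 b1 e :: real
    by (simp add: algebra_simps)
  have "(1 - discount M) * (V_init M \<pi>star - V_init M p) - 2 * ?e -
      \<nu> * ((1 - discount M) * (V_init M p' - V_init M p) + 2 * ?e) =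
      (1 - discount M) * ((V_init M \<pi>star - V_init M p) + \<nu> * (V_init M p - V_init M p')) - 2 * (1 + \<nu>) * ?e"
    by (rule ring)
  ultimately show "(1 - discount M) * ((V_init M \<pi>star - V_init M p) + \<nu> * (V_init M p - V_init M p')) \<le>
      ((\<integral>s. bregman h (\<pi>star s) (p s) \<partial>visitation M \<pi>star) -
        (\<integral>s. bregman h (\<pi>star s) (p' s) \<partial>visitation M \<pi>star)) / \<eta> + 2 * (1 + \<nu>) * ?e"
    by linarith
qed

section \<open>Solving the recursion and taking expectations\<close>

theorem theorem4p3:
  fixes M :: "('s, 'a::finite) mdp"
    and Y :: "(real ^ 'a) set" and h :: "real ^ 'a \<Rightarrow> real"
    and \<Theta> :: "'p set" and f :: "'p \<Rightarrow> 's \<Rightarrow> 'a \<Rightarrow> real"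
    and \<Omega> :: "'w measure"
    and \<theta> :: "nat \<Rightarrow> 'w \<Rightarrow> 'p" and \<pi> :: "nat \<Rightarrow> 'w \<Rightarrow> 's \<Rightarrow> real ^ 'a"
    and \<pi>0 \<pi>star :: "'s \<Rightarrow> real ^ 'a" and \<eta> :: "nat \<Rightarrow> real"
    and v :: "nat \<Rightarrow> 'w \<Rightarrow> ('s \<times> 'a) measure"
    and \<rho> :: "'s measure" and dstar :: "'s \<Rightarrow> real"
    and d :: "nat \<Rightarrow> 'w \<Rightarrow> 's \<Rightarrow> real" and q :: "nat \<Rightarrow> 'w \<Rightarrow> 's \<times> 'a \<Rightarrow> real"
    and \<epsilon>approx Cv \<nu> D0 :: real
  assumes mdp: "is_mdp M"
    and mirror: "mirror_map Y h"
    and optimal: "is_optimal_policy M \<pi>star"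
    and f_meas: "\<And>\<theta>' a. \<theta>' \<in> \<Theta> \<Longrightarrow> (\<lambda>s. f \<theta>' s a) \<in> borel_measurable (states M)"
    and \<Omega>: "prob_space \<Omega>"
    and v: "\<And>t \<omega>. \<omega> \<in> space \<Omega> \<Longrightarrow> v t \<omega> \<in> space (prob_algebra (sa_space M))"
    and \<eta>_pos: "\<And>t. 0 < \<eta> t"
    \<comment> \<open>the iterates of AMPO\<close>
    and \<pi>0: "is_policy M \<pi>0" "\<And>s. s \<in> space (states M) \<Longrightarrow> \<pi>0 s \<in> interior Y"
    and \<pi>_0: "\<And>\<omega>. \<omega> \<in> space \<Omega> \<Longrightarrow> \<pi> 0 \<omega> = \<pi>0"
    and \<theta>: "\<And>t \<omega>. \<omega> \<in> space \<Omega> \<Longrightarrow> \<theta> (Suc t) \<omega> \<in> \<Theta>"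
    and \<pi>_Suc: "\<And>t \<omega> s. \<omega> \<in> space \<Omega> \<Longrightarrow> s \<in> space (states M) \<Longrightarrow>
        \<pi> (Suc t) \<omega> s =
          bregman_proj h prob_simplex
            (grad (conjugate_fun Y h) (\<eta> t *\<^sub>R (\<chi> a. f (\<theta> (Suc t) \<omega>) s a)))"
    \<comment> \<open>densities with respect to a common reference measure\<close>
    and \<rho>: "sets \<rho> = sets (states M)"
    and dstar: "has_density \<rho> (visitation M \<pi>star) dstar"
    and d: "\<And>t. AE \<omega> in \<Omega>. has_density \<rho> (visitation M (\<pi> t \<omega>)) (d t \<omega>)"
    and q: "\<And>t. AE \<omega> in \<Omega>. has_density (\<rho> \<Otimes>\<^sub>M count_space UNIV) (v t \<omega>) (q t \<omega>)"
    \<comment> \<open>the expectations below are well defined\<close>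
    and V_meas: "\<And>t. (\<lambda>\<omega>. V_init M (\<pi> t \<omega>)) \<in> borel_measurable \<Omega>"
    and err_meas: "\<And>t. (\<lambda>\<omega>. L2_norm_sq (v t \<omega>)
          (\<lambda>s a. f (\<theta> (Suc t) \<omega>) s a - Q_fun M (\<pi> t \<omega>) s a - inverse (\<eta> t) * grad h (\<pi> t \<omega> s) $ a))
        \<in> borel_measurable \<Omega>"
    and D0_integrable: "integrable (visitation M \<pi>star) (\<lambda>s. bregman h (\<pi>star s) (\<pi>0 s))"
    and constants: "0 \<le> \<epsilon>approx" "0 \<le> Cv" "0 \<le> \<nu>"
    and A1: "\<And>t. (\<integral>\<^sup>+ \<omega>. L2_norm_sq (v t \<omega>)
          (\<lambda>s a. f (\<theta> (Suc t) \<omega>) s a - Q_fun M (\<pi> t \<omega>) s a - inverse (\<eta> t) * grad h (\<pi> t \<omega> s) $ a)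
        \<partial>\<Omega>) \<le> ennreal \<epsilon>approx"
    and A2: "\<And>t. AE \<omega> in \<Omega>.
        \<forall>(d', \<pi>') \<in> {(dstar, \<pi>star), (d (Suc t) \<omega>, \<pi> (Suc t) \<omega>),
                      (dstar, \<pi> t \<omega>), (d (Suc t) \<omega>, \<pi> t \<omega>)}.
          (\<forall>s\<in>space (states M). \<forall>a. 0 < d' s * \<pi>' s $ a \<longrightarrow> 0 < q t \<omega> (s, a)) \<and>
          (\<integral>\<^sup>+ (s, a). ennreal ((d' s * \<pi>' s $ a / q t \<omega> (s, a))\<^sup>2) \<partial>v t \<omega>) \<le> ennreal Cv"
    and A3: "\<And>t. AE \<omega> in \<Omega>.
        (\<forall>s\<in>space (states M). 0 < dstar s \<longrightarrow> 0 < d t \<omega> s) \<and>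
        (SUP s\<in>space (states M). ereal (dstar s / d t \<omega> s)) \<le> ereal \<nu>"
    and D0: "D0 = (\<integral>s. bregman h (\<pi>star s) (\<pi>0 s) \<partial>visitation M \<pi>star)"
  shows
    "((\<forall>t. \<eta> t \<le> \<eta> (Suc t)) \<longrightarrow>
        (\<forall>T::nat. 1 \<le> T \<longrightarrow>
          V_init M \<pi>star - 1 / real T * (\<Sum>t<T. \<integral>\<omega>. V_init M (\<pi> t \<omega>) \<partial>\<Omega>)
            \<le> 1 / real T * (D0 / ((1 - discount M) * \<eta> 0) + \<nu> / (1 - discount M))
               + 2 * (1 + \<nu>) * sqrt (Cv * \<epsilon>approx) / (1 - discount M)))
     \<and> (1 < \<nu> \<and> (\<forall>t. \<nu> / (\<nu> - 1) * \<eta> t \<le> \<eta> (Suc t)) \<longrightarrow>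
        (\<forall>T::nat.
          V_init M \<pi>star - (\<integral>\<omega>. V_init M (\<pi> T \<omega>) \<partial>\<Omega>)
            \<le> 1 / (1 - discount M) * (1 - 1 / \<nu>) ^ T * (1 + D0 / (\<eta> 0 * (\<nu> - 1)))
               + 2 * (1 + \<nu>) * sqrt (Cv * \<epsilon>approx) / (1 - discount M)))"
proof -
  interpret \<Omega>: prob_space \<Omega> by (rule \<Omega>)
  note \<gamma> = mdp_discount[OF mdp]
  define c where "c = 1 - discount M"
  have c: "0 < c" using \<gamma> by (simp add: c_def)
  let ?S = "space (states M)" and ?G = "\<lambda>t \<omega>. L2_norm_sq (v t \<omega>)
    (\<lambda>s a. f (\<theta> (Suc t) \<omega>) s a - Q_fun M (\<pi> t \<omega>) s a - inverse (\<eta> t) * grad h (\<pi> t \<omega> s) $ a)"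
  have polstar: "is_policy M \<pi>star" using optimal by (simp add: is_optimal_policy_def)
  have \<pi>_Suc': "\<pi> (Suc t) \<omega> s = mirror_step Y h (\<eta> t *\<^sub>R (\<chi> a. f (\<theta> (Suc t) \<omega>) s a))"
    if "\<omega> \<in> space \<Omega>" "s \<in> ?S" for t \<omega> s
    by (simp add: \<pi>_Suc[OF that] mirror_step_def)
  have w: "(\<lambda>s. \<eta> t *\<^sub>R (\<chi> a. f (\<theta> (Suc t) \<omega>) s a)) \<in> borel_measurable (states M)"
    if "\<omega> \<in> space \<Omega>" for t \<omega>
    by (intro borel_measurable_scaleR borel_measurable_const borel_measurable_vec_lambda f_meas \<theta> that)
  have pol: "is_policy M (\<pi> t \<omega>)" and int: "\<And>s. s \<in> ?S \<Longrightarrow> \<pi> t \<omega> s \<in> interior Y"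
    if \<omega>: "\<omega> \<in> space \<Omega>" for t \<omega>
  proof -
    have "is_policy M (\<pi> t \<omega>) \<and> (\<forall>s\<in>?S. \<pi> t \<omega> s \<in> interior Y)"
    proof (cases t)
      case 0
      then show ?thesis using \<pi>0 \<pi>_0[OF \<omega>] by simp
    next
      case (Suc t')
      \<comment> \<open>The anchor is \<open>\<pi>0\<close> at every time, so no induction on
        \<open>t\<close> is needed.\<close>
      show ?thesis
        using mirror_step_policy[OF mirror \<pi>0 w[OF \<omega>] \<pi>_Suc'[OF \<omega>]] unfolding Suc by blast
    qed
    then show "is_policy M (\<pi> t \<omega>)" "\<And>s. s \<in> ?S \<Longrightarrow> \<pi> t \<omega> s \<in> interior Y" by auto
  qed
  define \<delta> where "\<delta> t \<omega> = V_init M \<pi>star - V_init M (\<pi> t \<omega>)" for t \<omega>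
  define D where "D t \<omega> = (\<integral>s. bregman h (\<pi>star s) (\<pi> t \<omega> s) \<partial>visitation M \<pi>star)" for t \<omega>
  \<comment> \<open>\<open>enn2real\<close> sends infinity to 0, but an infinite norm occurs only on
    a null set because (A1) bounds its mean.\<close>
  define E where "E t \<omega> = enn2real (?G t \<omega>)" for t \<omega>
  define K where "K = 2 * (1 + \<nu>) / c"
  have K: "0 \<le> K" using constants c by (simp add: K_def)
  \<comment> \<open>Optimality of \<open>\<pi>star\<close> gives the sign of the gap; the upper
    bound holds because values lie between 0 and 1 / (1 - \<gamma>).\<close>
  have \<delta>_nonneg: "0 \<le> \<delta> t \<omega>" and \<delta>_le: "\<delta> t \<omega> \<le> 1 / c" if "\<omega> \<in> space \<Omega>" for t \<omega>
    using optimal pol[OF that, of t] V_init_le[OF mdp polstar] V_init_nonneg[OF mdp pol[OF that, of t]]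
    by (auto simp: \<delta>_def is_optimal_policy_def c_def)
  have D_nonneg: "0 \<le> D t \<omega>" if "\<omega> \<in> space \<Omega>" for t \<omega>
    unfolding D_def
    by (rule Bochner_Integration.integral_nonneg)
      (use int[OF that] policy_simplex[OF polstar] mirror_simplex[OF mirror]
        sets_eq_imp_space_eq[OF sets_visitation[OF mdp polstar]] in \<open>auto intro!: bregman_nonneg[OF mirror]\<close>)

  have V_int: "integrable \<Omega> (\<lambda>\<omega>. V_init M (\<pi> t \<omega>))" for t
    by (rule \<Omega>.integrable_const_bound[OF AE_I2 V_meas, where B = "1 / c"])
      (use V_init_le[OF mdp pol] V_init_nonneg[OF mdp pol] in \<open>simp add: c_def\<close>)
  have \<delta>_int: "integrable \<Omega> (\<delta> t)" "(\<integral>\<omega>. \<delta> t \<omega> \<partial>\<Omega>) = V_init M \<pi>star - (\<integral>\<omega>. V_init M (\<pi> t \<omega>) \<partial>\<Omega>)" for t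
    unfolding \<delta>_def using V_int by (simp_all add: \<Omega>.prob_space)
  have G_finite: "AE \<omega> in \<Omega>. ?G t \<omega> \<noteq> \<infinity>" for t
    by (rule nn_integral_noteq_infinite[OF err_meas]) (use A1[of t] in \<open>auto simp: top_unique\<close>)
  have "E t \<in> borel_measurable \<Omega>" for t
    unfolding E_def by (intro borel_measurable_enn2real err_meas)
  moreover have "(\<integral>\<^sup>+ \<omega>. ennreal (E t \<omega>) \<partial>\<Omega>) \<le> ennreal \<epsilon>approx" for t
  proof -
    have "(\<integral>\<^sup>+ \<omega>. ennreal (E t \<omega>) \<partial>\<Omega>) = (\<integral>\<^sup>+ \<omega>. ?G t \<omega> \<partial>\<Omega>)"
      by (rule nn_integral_cong_AE) (use G_finite[of t] in \<open>auto simp: E_def less_top\<close>)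
    then show ?thesis using A1[of t] by simp
  qed
  ultimately have E_int: "integrable \<Omega> (E t)" and E_le: "(\<integral>\<omega>. E t \<omega> \<partial>\<Omega>) \<le> \<epsilon>approx" for t
    using integrable_integral_le_nn[of "E t" \<Omega> "E t" \<epsilon>approx] constants(1)
    by (auto simp: E_def abs_le_iff)

  define err where "err l t \<omega> = K * ((l * E t \<omega> + Cv / l) / 2)" for l t \<omega>
  have err_int: "integrable \<Omega> (err l t)" for l t
    unfolding err_def by (intro integrable_mult_right integrable_divide Bochner_Integration.integrable_add E_int) simp
  have err_le: "(\<integral>\<omega>. err l t \<omega> \<partial>\<Omega>) \<le> K * ((l * \<epsilon>approx + Cv / l) / 2)" if "0 < l" for l t
  proof -
    have "(\<integral>\<omega>. err l t \<omega> \<partial>\<Omega>) = K * ((l * (\<integral>\<omega>. E t \<omega> \<partial>\<Omega>) + Cv / l) / 2)"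
      unfolding err_def using E_int[of t] by (simp add: \<Omega>.prob_space)
    also have "\<dots> \<le> K * ((l * \<epsilon>approx + Cv / l) / 2)"
      using E_le[of t] that K by (intro mult_left_mono divide_right_mono add_right_mono) auto
    finally show ?thesis .
  qed

  have "AE \<omega> in \<Omega>. \<forall>t. has_density \<rho> (visitation M (\<pi> t \<omega>)) (d t \<omega>)"
    "AE \<omega> in \<Omega>. \<forall>t. has_density (\<rho> \<Otimes>\<^sub>M count_space UNIV) (v t \<omega>) (q t \<omega>)"
    "AE \<omega> in \<Omega>. \<forall>t. \<forall>(d', \<pi>') \<in> {(dstar, \<pi>star), (d (Suc t) \<omega>, \<pi> (Suc t) \<omega>),
                      (dstar, \<pi> t \<omega>), (d (Suc t) \<omega>, \<pi> t \<omega>)}.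
          (\<forall>s\<in>space (states M). \<forall>a. 0 < d' s * \<pi>' s $ a \<longrightarrow> 0 < q t \<omega> (s, a)) \<and>
          (\<integral>\<^sup>+ (s, a). ennreal ((d' s * \<pi>' s $ a / q t \<omega> (s, a))\<^sup>2) \<partial>v t \<omega>) \<le> ennreal Cv"
    "AE \<omega> in \<Omega>. \<forall>t. (\<forall>s\<in>space (states M). 0 < dstar s \<longrightarrow> 0 < d t \<omega> s) \<and>
        (SUP s\<in>space (states M). ereal (dstar s / d t \<omega> s)) \<le> ereal \<nu>"
    "AE \<omega> in \<Omega>. \<forall>t. ?G t \<omega> \<noteq> \<infinity>"
    unfolding AE_all_countable using d q A2 A3 G_finite by blast+
  \<comment> \<open>Times are countable, so one null set serves all \<open>t\<close>; it is also
    independent of \<open>l\<close>, which enters only through the deterministic Young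
    bound.\<close>
  then have gap_step: "AE \<omega> in \<Omega>. \<forall>l>0. \<forall>t.
    \<delta> t \<omega> + \<nu> * (\<delta> (Suc t) \<omega> - \<delta> t \<omega>) \<le> (D t \<omega> - D (Suc t) \<omega>) / (c * \<eta> t) + err l t \<omega>"
    using AE_space
  proof eventually_elim
    case (elim \<omega>)
    note \<omega> = elim(6)
    \<comment> \<open>The bound on the supremum in product form, which also covers states where
      \<open>dstar\<close> vanishes and the quotient carries no information.\<close>
    have ratio: "dstar s \<le> \<nu> * d t \<omega> s" if s: "s \<in> ?S" for s t
    proof (cases "0 < dstar s")
      case True
      then have pos: "0 < d t \<omega> s"
        using conjunct1[OF spec[OF elim(4), of t]] s by blast
      have "ereal (dstar s / d t \<omega> s) \<le> ereal \<nu>"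
        by (rule order.trans[OF SUP_upper[OF s] conjunct2[OF spec[OF elim(4), of t]]])
      then show ?thesis using pos by (simp add: divide_le_eq)
    next
      case False
      have "0 \<le> d t \<omega> s"
        using elim(1) s by (auto simp: has_density_def sets_eq_imp_space_eq[OF \<rho>])
      then show ?thesis using False mult_nonneg_nonneg[OF constants(3), of "d t \<omega> s"] by linarith
    qed
    have G: "?G t \<omega> \<le> ennreal (E t \<omega>)" for t
      using elim(5) by (simp add: E_def less_top)
    have conc: "(d', \<pi>') \<in> {(dstar, \<pi>star), (d (Suc t) \<omega>, \<pi> (Suc t) \<omega>),
                      (dstar, \<pi> t \<omega>), (d (Suc t) \<omega>, \<pi> t \<omega>)} \<Longrightarrow>
          (\<forall>s\<in>space (states M). \<forall>a. 0 < d' s * \<pi>' s $ a \<longrightarrow> 0 < q t \<omega> (s, a)) \<and>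
          (\<integral>\<^sup>+ (s, a). ennreal ((d' s * \<pi>' s $ a / q t \<omega> (s, a))\<^sup>2) \<partial>v t \<omega>) \<le> ennreal Cv" for t d' \<pi>'
      using elim(3) by blast
    note step = mirror_policy_step[OF mdp mirror polstar pol[OF \<omega>] int[OF \<omega>] f_meas[OF \<theta>[OF \<omega>]] \<eta>_pos
        \<pi>_Suc'[OF \<omega>] \<rho> dstar elim(1)[rule_format] elim(2)[rule_format] _ constants(2,3) _ ratio G conc]
    have E_nonneg: "0 \<le> E t \<omega>" for t by (simp add: E_def)
    \<comment> \<open>The choice \<open>l = 1\<close> is arbitrary: integrability of the next
      divergence does not depend on the weight.\<close>
    have D_int: "integrable (visitation M \<pi>star) (\<lambda>s. bregman h (\<pi>star s) (\<pi> t \<omega> s))" for t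
    proof (induction t)
      case 0
      then show ?case using D0_integrable by (simp add: \<pi>_0[OF \<omega>])
    next
      case (Suc t)
      show ?case by (rule step(1)[where l = 1]) (use Suc E_nonneg in simp_all)
    qed
    show ?case
    proof (intro allI impI)
      fix l :: real and t assume l: "0 < l"
      have "c * (\<delta> t \<omega> + \<nu> * (\<delta> (Suc t) \<omega> - \<delta> t \<omega>)) \<le>
          (D t \<omega> - D (Suc t) \<omega>) / \<eta> t + 2 * (1 + \<nu>) * ((l * E t \<omega> + Cv / l) / 2)"
        using step(2)[OF _ _ E_nonneg l _ _ D_int, of t] by (simp add: \<delta>_def D_def c_def right_diff_distrib)
      then have "\<delta> t \<omega> + \<nu> * (\<delta> (Suc t) \<omega> - \<delta> t \<omega>) \<le>
          ((D t \<omega> - D (Suc t) \<omega>) / \<eta> t + 2 * (1 + \<nu>) * ((l * E t \<omega> + Cv / l) / 2)) / c"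
        using c by (simp add: le_divide_eq mult.commute)
      also have "\<dots> = (D t \<omega> - D (Suc t) \<omega>) / (c * \<eta> t) + err l t \<omega>"
        unfolding err_def K_def
        by (simp only: add_divide_distrib divide_divide_eq_left times_divide_eq_left mult.commute[of "\<eta> t" c])
      finally show "\<delta> t \<omega> + \<nu> * (\<delta> (Suc t) \<omega> - \<delta> t \<omega>) \<le> (D t \<omega> - D (Suc t) \<omega>) / (c * \<eta> t) + err l t \<omega>" .
    qed
  qed
  have D_0: "D 0 \<omega> = D0" if "\<omega> \<in> space \<Omega>" for \<omega>
    by (simp add: D_def D0 \<pi>_0[OF that])

  have sublinear: "V_init M \<pi>star - 1 / real T * (\<Sum>t<T. \<integral>\<omega>. V_init M (\<pi> t \<omega>) \<partial>\<Omega>)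
      \<le> 1 / real T * (D0 / (c * \<eta> 0) + \<nu> / c) + K * sqrt (Cv * \<epsilon>approx)"
    if mono: "\<And>t. \<eta> t \<le> \<eta> (Suc t)" and T: "1 \<le> T" for T
  proof -
    let ?B = "D0 / (c * \<eta> 0) + \<nu> / c"
    have "(\<Sum>t<T. \<integral>\<omega>. \<delta> t \<omega> \<partial>\<Omega>) / real T - ?B / real T \<le> K * ((l * \<epsilon>approx + Cv / l) / 2)" if l: "0 < l" for l
    proof -
      have "(\<integral>\<omega>. (\<Sum>t<T. \<delta> t \<omega>) \<partial>\<Omega>) \<le> (\<integral>\<omega>. ?B + (\<Sum>t<T. err l t \<omega>) \<partial>\<Omega>)"
      proof (rule integral_mono_AE)
        show "AE \<omega> in \<Omega>. (\<Sum>t<T. \<delta> t \<omega>) \<le> ?B + (\<Sum>t<T. err l t \<omega>)"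
          using gap_step AE_space
        proof eventually_elim
          case (elim \<omega>)
          have "(\<Sum>t<T. \<delta> t \<omega>) + \<nu> * (\<delta> T \<omega> - \<delta> 0 \<omega>) + D T \<omega> / (c * \<eta> T) \<le>
              D 0 \<omega> / (c * \<eta> 0) + (\<Sum>t<T. err l t \<omega>)"
            by (rule sum_gap_le[where \<delta> = "\<lambda>t. \<delta> t \<omega>" and D = "\<lambda>t. D t \<omega>" and e = "\<lambda>t. err l t \<omega>"])
              (use elim l \<eta>_pos mono c D_nonneg in auto)
          \<comment> \<open>The telescoped gaps are bounded by the extreme values at both ends; this
            is the origin of the term \<nu> / (1 - \<gamma>).\<close>
          moreover have "\<nu> * (0 - 1 / c) \<le> \<nu> * (\<delta> T \<omega> - \<delta> 0 \<omega>)"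
            using \<delta>_nonneg[OF elim(2), of T] \<delta>_le[OF elim(2), of 0] constants
            by (intro mult_left_mono) auto
          moreover have "0 \<le> D T \<omega> / (c * \<eta> T)"
            using D_nonneg[OF elim(2)] c \<eta>_pos[of T] by simp
          ultimately show ?case by (simp add: D_0[OF elim(2)])
        qed
      qed (auto intro!: Bochner_Integration.integrable_sum Bochner_Integration.integrable_add \<delta>_int err_int)
      also have "\<dots> = ?B + (\<Sum>t<T. \<integral>\<omega>. err l t \<omega> \<partial>\<Omega>)"
        by (subst Bochner_Integration.integral_add)
          (auto simp: Bochner_Integration.integral_sum err_int \<Omega>.prob_space intro!: Bochner_Integration.integrable_sum)
      also have "\<dots> \<le> ?B + (\<Sum>t<T. K * ((l * \<epsilon>approx + Cv / l) / 2))"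
        by (intro add_left_mono sum_mono err_le l)
      also have "(\<Sum>t<T. K * ((l * \<epsilon>approx + Cv / l) / 2)) = K * ((l * \<epsilon>approx + Cv / l) / 2) * real T"
        by simp
      finally have "(\<Sum>t<T. \<integral>\<omega>. \<delta> t \<omega> \<partial>\<Omega>) - ?B \<le> K * ((l * \<epsilon>approx + Cv / l) / 2) * real T"
        unfolding Bochner_Integration.integral_sum[OF \<delta>_int(1)] by linarith
      then have "((\<Sum>t<T. \<integral>\<omega>. \<delta> t \<omega> \<partial>\<Omega>) - ?B) / real T \<le> K * ((l * \<epsilon>approx + Cv / l) / 2)"
        using T by (simp add: divide_le_eq)
      then show ?thesis by (simp add: diff_divide_distrib)
    qed
    \<comment> \<open>Expectations have already been taken, so the weight may now depend on
      \<open>Cv\<close> and \<open>\<epsilon>approx\<close>.\<close>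
    from le_sqrt_if_Young[OF K constants(1,2) this]
    have "(\<Sum>t<T. \<integral>\<omega>. \<delta> t \<omega> \<partial>\<Omega>) / real T - ?B / real T \<le> K * sqrt (Cv * \<epsilon>approx)" .
    moreover have "(\<Sum>t<T. \<integral>\<omega>. \<delta> t \<omega> \<partial>\<Omega>) / real T =
        V_init M \<pi>star - 1 / real T * (\<Sum>t<T. \<integral>\<omega>. V_init M (\<pi> t \<omega>) \<partial>\<Omega>)"
      using T by (simp add: \<delta>_int(2) sum_subtractf diff_divide_distrib)
    ultimately show ?thesis by simp
  qed

  have linear: "V_init M \<pi>star - (\<integral>\<omega>. V_init M (\<pi> T \<omega>) \<partial>\<Omega>)
      \<le> 1 / c * (1 - 1 / \<nu>) ^ T * (1 + D0 / (\<eta> 0 * (\<nu> - 1))) + K * sqrt (Cv * \<epsilon>approx)"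
    if \<nu>: "1 < \<nu>" and grow: "\<And>t. \<nu> / (\<nu> - 1) * \<eta> t \<le> \<eta> (Suc t)" for T
  proof -
    let ?\<kappa> = "1 - 1 / \<nu>"
    let ?B = "?\<kappa> ^ T * (1 / c + D0 / ((\<nu> - 1) * (c * \<eta> 0)))"
    have \<kappa>: "0 \<le> ?\<kappa>" using \<nu> by simp
    \<comment> \<open>The geometric weights sum to at most \<nu>, which cancels the division of each
      error by \<nu>; the accumulated error is therefore no larger than the bound for a single
      step.\<close>
    have "(\<Sum>t<T. ?\<kappa> ^ (T - Suc t)) = (\<Sum>t<T. ?\<kappa> ^ t)"
      by (rule sum.nat_diff_reindex)
    also have "\<dots> = (1 - ?\<kappa> ^ T) / (1 - ?\<kappa>)"
      using \<nu> by (subst sum_gp_strict) auto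
    also have "\<dots> = \<nu> * (1 - ?\<kappa> ^ T)" by simp
    also have "\<dots> \<le> \<nu> * 1" using \<nu> \<kappa> by (intro mult_left_mono) auto
    finally have geo: "(\<Sum>t<T. ?\<kappa> ^ (T - Suc t)) \<le> \<nu>" by simp
    have "(\<integral>\<omega>. \<delta> T \<omega> \<partial>\<Omega>) - ?B \<le> K * ((l * \<epsilon>approx + Cv / l) / 2)" if l: "0 < l" for l
    proof -
      let ?e = "K * ((l * \<epsilon>approx + Cv / l) / 2)"
      have e: "0 \<le> ?e" using K l constants by simp
      have "(\<integral>\<omega>. \<delta> T \<omega> \<partial>\<Omega>) \<le> (\<integral>\<omega>. ?B + (\<Sum>t<T. ?\<kappa> ^ (T - Suc t) * (err l t \<omega> / \<nu>)) \<partial>\<Omega>)"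
      proof (rule integral_mono_AE)
        show "AE \<omega> in \<Omega>. \<delta> T \<omega> \<le> ?B + (\<Sum>t<T. ?\<kappa> ^ (T - Suc t) * (err l t \<omega> / \<nu>))"
          using gap_step AE_space
        proof eventually_elim
          case (elim \<omega>)
          have "\<delta> T \<omega> + D T \<omega> / ((\<nu> - 1) * (c * \<eta> T)) \<le>
              ?\<kappa> ^ T * (\<delta> 0 \<omega> + D 0 \<omega> / ((\<nu> - 1) * (c * \<eta> 0))) + (\<Sum>t<T. ?\<kappa> ^ (T - Suc t) * (err l t \<omega> / \<nu>))"
            by (rule linear_gap_le[where \<delta> = "\<lambda>t. \<delta> t \<omega>" and D = "\<lambda>t. D t \<omega>" and e = "\<lambda>t. err l t \<omega>"])
              (use elim l \<eta>_pos grow \<nu> c D_nonneg in auto)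
          \<comment> \<open>The initial gap is at most \<open>1 / c\<close>; factoring this out
            leaves the 1 next to the divergence term of the claim.\<close>
          moreover have "?\<kappa> ^ T * (\<delta> 0 \<omega> + D 0 \<omega> / ((\<nu> - 1) * (c * \<eta> 0))) \<le> ?B"
            using \<delta>_le[OF elim(2), of 0] \<kappa> by (intro mult_left_mono) (auto simp: D_0[OF elim(2)])
          moreover have "0 \<le> D T \<omega> / ((\<nu> - 1) * (c * \<eta> T))"
            using D_nonneg[OF elim(2)] c \<eta>_pos[of T] \<nu> by simp
          ultimately show ?case by linarith
        qed
      qed (auto intro!: Bochner_Integration.integrable_sum Bochner_Integration.integrable_add integrable_mult_right
          integrable_divide \<delta>_int err_int)
      also have "\<dots> = ?B + (\<Sum>t<T. ?\<kappa> ^ (T - Suc t) * ((\<integral>\<omega>. err l t \<omega> \<partial>\<Omega>) / \<nu>))"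
        by (subst Bochner_Integration.integral_add)
          (auto simp: Bochner_Integration.integral_sum err_int \<Omega>.prob_space
            intro!: Bochner_Integration.integrable_sum integrable_mult_right integrable_divide)
      also have "\<dots> \<le> ?B + (\<Sum>t<T. ?\<kappa> ^ (T - Suc t) * (?e / \<nu>))"
        using \<kappa> \<nu> by (intro add_left_mono sum_mono mult_left_mono divide_right_mono err_le l) auto
      also have "(\<Sum>t<T. ?\<kappa> ^ (T - Suc t) * (?e / \<nu>)) = (\<Sum>t<T. ?\<kappa> ^ (T - Suc t)) * (?e / \<nu>)"
        by (rule sum_distrib_right[symmetric])
      also have "\<dots> \<le> \<nu> * (?e / \<nu>)"
        using geo e \<nu> by (intro mult_right_mono) auto
      also have "\<dots> = ?e" using \<nu> by simp
      finally show ?thesis by linarith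
    qed
    from le_sqrt_if_Young[OF K constants(1,2) this]
    have "(\<integral>\<omega>. \<delta> T \<omega> \<partial>\<Omega>) - ?B \<le> K * sqrt (Cv * \<epsilon>approx)" .
    moreover have "?B = 1 / c * ?\<kappa> ^ T * (1 + D0 / (\<eta> 0 * (\<nu> - 1)))"
      by (simp add: distrib_left mult.commute mult.left_commute)
    ultimately show ?thesis by (simp add: \<delta>_int(2))
  qed

  show ?thesis
    using sublinear linear unfolding K_def c_def by auto
qed

end
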